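(* There exists an infinite family of graphs of orders $16{,}464^k$, one for each integer $k\ge 1$, that are vertex-transitive and do not admit semiregular automorphisms. That is, for each integer $k\ge1$ there is a vertex-transitive graph with exactly $16{,}464^k$ vertices that has no semiregular automorphism.
   Context: Graphs here are finite, undirected and simple (no loops or multiple edges). The order of a graph is its number of vertices. A non-trivial permutation of a finite set is semiregular if all of its cycles have the same length (so in particular it has no fixed points); an automorphism of a graph is semiregular if it is semiregular as a permutation of the vertex set. *)

theory Defs
  imports "Graph_Theory.Pair_Digraph" "HOL-Combinatorics.Orbits"
begin

text \<open>
  Finite simple undirected graphs are modelled by \<^locale>\<open>pair_graph\<close>: an undirected edge is
  represented by its two opposite arcs.
\<close>

definition automorphism :: "'a pair_pre_digraph \<Rightarrow> ('a \<Rightarrow> 'a) \<Rightarrow> bool" where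
  "automorphism G p \<longleftrightarrow>
     p permutes pverts G \<and>
     (\<forall>u\<in>pverts G. \<forall>v\<in>pverts G. (p u, p v) \<in> parcs G \<longleftrightarrow> (u, v) \<in> parcs G)"

definition vertex_transitive :: "'a pair_pre_digraph \<Rightarrow> bool" where
  "vertex_transitive G \<longleftrightarrow>
     (\<forall>u\<in>pverts G. \<forall>v\<in>pverts G. \<exists>p. automorphism G p \<and> p u = v)"

text \<open>
  The cycle of \<open>p\<close> through \<open>x\<close> is \<^term>\<open>orbit p x\<close>; a fixed point is a cycle of length 1.
  Since \<^const>\<open>permutes\<close> makes \<open>p\<close> the identity outside \<open>V\<close>, \<open>p \<noteq> id\<close> says that \<open>p\<close> is
  non-trivial on \<open>V\<close>.
\<close>
definition semiregular :: "'a set \<Rightarrow> ('a \<Rightarrow> 'a) \<Rightarrow> bool" where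
  "semiregular V p \<longleftrightarrow>
     p permutes V \<and> p \<noteq> id \<and> (\<forall>x\<in>V. \<forall>y\<in>V. card (orbit p x) = card (orbit p y))"

lemma semiregular_no_fixed_point:
  assumes "finite V" "semiregular V p" "x \<in> V"
  shows "p x \<noteq> x"
proof
  assume fx: "p x = x"
  have perm: "p permutes V" and ne: "p \<noteq> id"
    and eq: "\<And>y. y \<in> V \<Longrightarrow> card (orbit p y) = card (orbit p x)"
    using assms unfolding semiregular_def by blast+
  have "z = x" if "z \<in> orbit p x" for z
    using that by induction (auto simp: fx)
  then have "orbit p x = {x}"
    using orbit.base[of p x] unfolding fx by blast
  then have card1: "card (orbit p y) = 1" if "y \<in> V" for y
    using eq[OF that] by simp
  have "p y = y" for y
  proof (cases "y \<in> V")
    case True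
    have "permutation p"
      using perm assms(1) permutation_permutes by blast
    then have "y \<in> orbit p y"
      by (rule permutation_self_in_orbit)
    moreover have "p y \<in> orbit p y" by (rule orbit.base)
    ultimately show ?thesis
      using card1[OF True] by (metis card_1_singletonE singletonD)
  next
    case False
    then show ?thesis using perm by (simp add: permutes_def)
  qed
  then have "p = id" by (simp add: fun_eq_iff)
  with ne show False by contradiction
qed

end

(*
A graph on which every automorphism of prime order fixes a vertex has no semiregular automorphism,
since a suitable power of a semiregular permutation has prime order and moves every vertex.

For k = 1 take a geometry with 126 points and 336 three-point lines whose automorphism group is
G_2(2) = PSU(3,3):2, and the sevenfold cover of it that belongs to a non-split extension of PSU(3,3) by
the six-dimensional module over F_7. The cover has 336 * 49 = 16464 lines; two of them are adjacent
when they meet. A large clique consists of lines through one point, so an automorphism of this graph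
is a collineation a of the cover, and a induces an automorphism s of the base geometry. If a has
prime order q different from 2, 3 and 7, then it fixes a line because q does not divide 16464. If q
is 2 or 3, then by Sylow's theorem and a check of Sylow subgroups s fixes a base line, and a fixes
one of the 49 lines above it. If q = 7 and s is trivial, then a is a translation of the fibres by an
element of the module, and every element of the module vanishes on some base line. If q = 7 and s is
non-trivial, then up to conjugacy and powers a lifts one fixed element of order 7, but all
lifts of that element have order 49.

For larger k take iterated lexicographic products. The number of common neighbours of two vertices
tells whether they lie in the same block, so automorphisms permute the blocks; an automorphism of
prime order fixes a block and then a vertex in it.
*)

theory Submission
  imports Defs "HOL-Computational_Algebra.Primes"
begin

text \<open>The obstacle is the prime 7. An element of order 7 moves every one of the 336 base
  lines, because a line stabiliser has order 12096 / 336 = 36; so the line graph of the base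
  geometry has a semiregular automorphism, and the cover has to destroy it. A line of the cover is a
  solution of one linear equation over F_7 in three unknowns. Hence 7^2 lines lie above a base line,
  a number prime to 2 and 3, which preserves the fixed lines found for these primes. In a split
  extension a complement would supply an element of order 7 whose image fixes no base line. Here
  such elements lift only to order 49, so an element of order 7 is a translation, given by a
  function on the 126 points that satisfies all homogeneous line equations. Vanishing on a line
  means two conditions on it, and a search shows that they can always be met. Of the group of the
  cover only its image inside a group of order 12096 = 2^6 * 3^3 * 7 is used. This order, computed
  by a stabiliser chain, makes the listed subgroups of orders 64, 27 and 7 Sylow subgroups.\<close>

section \<open>Actions of finite permutation groups\<close>

text \<open>By Bezout \<open>d * u = q * v + 1\<close>, and the powers with exponents
  \<open>d * u\<close> and \<open>q * v\<close> both fix \<open>x\<close>.\<close>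

lemma funpow_id_fixed:
  assumes q: "prime (q::nat)" and fq: "(f ^^ q) x = x" and d: "0 < d" "d < q" and fd: "(f ^^ d) x = x"
  shows "f x = x"
proof -
  have mult: "(f ^^ (n * m)) x = x" if "(f ^^ n) x = x" for n m
    using that by (induction m) (simp_all add: funpow_add)
  have "coprime d q"
    using q d by (metis coprime_commute nat_dvd_not_less prime_imp_coprime_nat)
  then obtain u v where "d * u = q * v + 1"
    using bezout_nat[of d q] d by (metis coprime_imp_gcd_eq_1 less_irrefl_nat)
  then have "(f ^^ (q * v + 1)) x = x" using mult[OF fd, of u] by metis
  then show ?thesis using mult[OF fq, of v] by (simp add: funpow_swap1)
qed

text \<open>Without a fixed point every cycle would have exactly \<open>q\<close> elements, and the
  cycles would partition \<open>X\<close>. The formulation for a self-map of a set lets it serve for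
  cosets as well as for sets of lines.\<close>

lemma exists_fixed_point:
  assumes fin: "finite X" and q: "prime (q::nat)" and fX: "f ` X \<subseteq> X"
    and fq: "\<And>x. x \<in> X \<Longrightarrow> (f ^^ q) x = x" and nd: "\<not> q dvd card X"
  shows "\<exists>x\<in>X. f x = x"
proof (rule ccontr)
  assume nofix: "\<not> ?thesis"
  define Ob where "Ob x = (\<lambda>n. (f ^^ n) x) ` {..<q}" for x
  have q0: "0 < q" using q by (simp add: prime_gt_0_nat)
  have pow: "(f ^^ n) x \<in> X" if "x \<in> X" for x n
    using that fX by (induction n) auto
  have fmod: "(f ^^ n) x = (f ^^ (n mod q)) x" if "x \<in> X" for n x
  proof -
    have "(f ^^ (q * m)) x = x" for m
      using fq[OF that] by (induction m) (simp_all add: funpow_add)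
    then show ?thesis
      by (metis comp_apply funpow_add mod_mult_div_eq)
  qed
  have mem: "(f ^^ n) x \<in> Ob x" if "x \<in> X" for n x
    using fmod[OF that, of n] q0 unfolding Ob_def by auto
  have inj: "inj_on (\<lambda>n. (f ^^ n) x) {..<q}" if x: "x \<in> X" for x
  proof -
    have False if mn: "m < n" "n < q" and eq: "(f ^^ m) x = (f ^^ n) x" for m n
    proof -
      let ?y = "(f ^^ m) x"
      have "(f ^^ (n - m)) ?y = ?y"
        using mn eq by (metis comp_apply funpow_add le_add_diff_inverse2 less_imp_le_nat)
      then have "f ?y = ?y"
        using funpow_id_fixed[OF q, of f ?y "n - m"] fq[OF pow[OF x]] mn by auto
      with nofix pow[OF x] show False by blast
    qed
    then show ?thesis by (auto simp: inj_on_def) (metis linorder_neqE_nat)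
  qed
  have card_Ob: "card (Ob x) = q" if "x \<in> X" for x
    unfolding Ob_def using card_image[OF inj[OF that]] by simp
  have ObX: "Ob x \<subseteq> X" if "x \<in> X" for x unfolding Ob_def using pow[OF that] by auto
  have sub: "Ob y \<subseteq> Ob x" if x: "x \<in> X" and y: "y \<in> Ob x" for x y
  proof -
    obtain n where "y = (f ^^ n) x" using y unfolding Ob_def by auto
    then have "(f ^^ m) y = (f ^^ (m + n)) x" for m by (simp add: funpow_add)
    then show ?thesis using mem[OF x] unfolding Ob_def by auto
  qed
  \<comment> \<open>A shared point \<open>z\<close> generates a cycle inside both; all cycles have
    \<open>q\<close> elements, so the inclusions are equalities.\<close>
  have disj: "Ob x = Ob y" if x: "x \<in> X" and y: "y \<in> X" and z: "z \<in> Ob x" "z \<in> Ob y" for x y z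
  proof -
    have zX: "z \<in> X" using ObX x z by blast
    have "Ob z = Ob x" using card_subset_eq[of "Ob x" "Ob z"] sub[OF x z(1)] card_Ob x zX
      by (metis ObX fin finite_subset)
    moreover have "Ob z = Ob y" using card_subset_eq[of "Ob y" "Ob z"] sub[OF y z(2)] card_Ob y zX
      by (metis ObX fin finite_subset)
    ultimately show ?thesis by simp
  qed
  have U: "\<Union> (Ob ` X) = X" using ObX mem[of _ 0] by fastforce
  have "q * card (Ob ` X) = card (\<Union> (Ob ` X))"
  proof (rule card_partition)
    show "finite (Ob ` X)" "finite (\<Union> (Ob ` X))" using fin U by auto
    show "card c = q" if "c \<in> Ob ` X" for c using that card_Ob by auto
    show "c1 \<inter> c2 = {}" if "c1 \<in> Ob ` X" "c2 \<in> Ob ` X" "c1 \<noteq> c2" for c1 c2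
      using that disj by blast
  qed
  with U nd show False by (metis dvd_triv_left)
qed

locale perm_group =
  fixes S :: "'a set" and G :: "('a \<Rightarrow> 'a) set"
  assumes finG: "finite G" and permutes: "g \<in> G \<Longrightarrow> g permutes S"
    and id_mem: "id \<in> G" and comp_mem: "g \<in> G \<Longrightarrow> h \<in> G \<Longrightarrow> g \<circ> h \<in> G"
    and inv_mem: "g \<in> G \<Longrightarrow> inv g \<in> G"
begin

lemma bij: "g \<in> G \<Longrightarrow> bij g"
  using permutes permutes_bij by blast

lemma inv_comp: "g \<in> G \<Longrightarrow> inv g \<circ> g = id" and comp_inv: "g \<in> G \<Longrightarrow> g \<circ> inv g = id"
  using permutes permutes_inv_o by blast+

lemma funpow_mem: "g \<in> G \<Longrightarrow> g ^^ n \<in> G"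
  by (induction n) (auto simp: id_mem comp_mem)

lemma orbit_stabilizer:
  "card G = card ((\<lambda>g. g x) ` G) * card {g \<in> G. g x = x}"
proof -
  define F where "F y = {g \<in> G. g x = y}" for y
  let ?Orb = "(\<lambda>g. g x) ` G"
  have F: "card (F y) = card (F x)" if y: "y \<in> ?Orb" for y
  proof -
    obtain h where h: "h \<in> G" "y = h x" using y by blast
    have "bij_betw (\<lambda>g. h \<circ> g) (F x) (F y)"
    proof (rule bij_betw_byWitness[where f' = "\<lambda>g. inv h \<circ> g"])
      show "\<forall>a\<in>F x. inv h \<circ> (h \<circ> a) = a" using inv_comp[OF h(1)] by (metis comp_assoc id_o)
      show "\<forall>a\<in>F y. h \<circ> (inv h \<circ> a) = a" using comp_inv[OF h(1)] by (metis comp_assoc id_o)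
      show "(\<lambda>g. h \<circ> g) ` F x \<subseteq> F y" using h comp_mem unfolding F_def by auto
      show "(\<lambda>g. inv h \<circ> g) ` F y \<subseteq> F x"
        using h comp_mem inv_mem bij[OF h(1)] unfolding F_def by (auto simp: bij_is_inj)
    qed
    then show ?thesis using bij_betw_same_card by fastforce
  qed
  have "card G = card (\<Union>y\<in>?Orb. F y)" by (rule arg_cong[of _ _ card]) (auto simp: F_def)
  also have "\<dots> = (\<Sum>y\<in>?Orb. card (F y))"
    by (rule card_UN_disjoint) (auto simp: F_def finG)
  also have "\<dots> = card ?Orb * card (F x)" using F by simp
  finally show ?thesis unfolding F_def .
qed

text \<open>Lagrange's theorem, with the cosets kept as an explicit set because group elements will
  act on it.\<close>

lemma card_cosets:
  assumes P: "perm_group S P" and sub: "P \<subseteq> G"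
  shows "card G = card P * card ((\<lambda>g. (\<circ>) g ` P) ` G)"
proof -
  interpret P: perm_group S P by (rule P)
  let ?X = "(\<lambda>g. (\<circ>) g ` P) ` G"
  have inj: "inj_on ((\<circ>) g) A" if "g \<in> G" for g :: "'a \<Rightarrow> 'a" and A :: "('a \<Rightarrow> 'a) set"
    using inv_comp[OF that] by (intro inj_onI) (metis comp_assoc id_o)
  have U: "\<Union> ?X = G"
  proof
    show "\<Union> ?X \<subseteq> G" using comp_mem sub by auto
    show "G \<subseteq> \<Union> ?X"
    proof
      fix g assume "g \<in> G"
      moreover have "g \<in> (\<circ>) g ` P" using P.id_mem by (auto intro!: image_eqI[of _ _ id])
      ultimately show "g \<in> \<Union> ?X" by blast
    qed
  qed
  have "card P * card ?X = card (\<Union> ?X)"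
  proof (rule card_partition)
    show "finite ?X" "finite (\<Union> ?X)" using finG U by auto
    show "card c = card P" if "c \<in> ?X" for c using that card_image[OF inj] by auto
    show "c1 \<inter> c2 = {}" if c: "c1 \<in> ?X" "c2 \<in> ?X" "c1 \<noteq> c2" for c1 c2
    proof (rule ccontr)
      assume "c1 \<inter> c2 \<noteq> {}"
      moreover obtain g h where gh: "g \<in> G" "h \<in> G" "c1 = (\<circ>) g ` P" "c2 = (\<circ>) h ` P"
        using c by auto
      ultimately obtain p r where pr: "p \<in> P" "r \<in> P" "g \<circ> p = h \<circ> r" by auto
      have sub1: "(\<circ>) g ` P \<subseteq> (\<circ>) h ` P"
        if gh: "g \<in> G" "h \<in> G" and pr: "p \<in> P" "r \<in> P" "g \<circ> p = h \<circ> r" for g h p r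
      proof
        fix x assume "x \<in> (\<circ>) g ` P"
        then obtain y where y: "y \<in> P" "x = g \<circ> y" by auto
        have "h \<circ> (r \<circ> (inv p \<circ> y)) = (h \<circ> r) \<circ> inv p \<circ> y" by (simp add: comp_assoc)
        also have "\<dots> = g \<circ> (p \<circ> inv p) \<circ> y" unfolding pr(3)[symmetric] by (simp only: comp_assoc)
        also have "\<dots> = x" using y P.comp_inv[OF pr(1)] by simp
        finally have "h \<circ> (r \<circ> (inv p \<circ> y)) = x" .
        moreover have "r \<circ> (inv p \<circ> y) \<in> P" using pr y P.comp_mem P.inv_mem by blast
        ultimately show "x \<in> (\<circ>) h ` P" by blast
      qed
      have "c1 = c2" using sub1[OF gh(1,2) pr] sub1[OF gh(2,1) pr(2,1) pr(3)[symmetric]] gh by auto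
      with c show False by simp
    qed
  qed
  with U show ?thesis by simp
qed

text \<open>An element of order \<open>q\<close> fixes one of the cosets of \<open>P\<close> when their number is prime to \<open>q\<close>.\<close>

lemma conj_into_subgroup:
  assumes P: "perm_group S P" and sub: "P \<subseteq> G" and q: "prime (q::nat)"
    and card: "card G = card P * m" and m: "\<not> q dvd m" and x: "x \<in> G" "x ^^ q = id"
  shows "\<exists>g\<in>G. inv g \<circ> x \<circ> g \<in> P"
proof -
  interpret P: perm_group S P by (rule P)
  let ?X = "(\<lambda>g. (\<circ>) g ` P) ` G" and ?f = "\<lambda>C. (\<circ>) x ` C"
  have "card P > 0" using P.finG P.id_mem card_gt_0_iff by blast
  then have cX: "card ?X = m" using card card_cosets[OF P sub] by (metis mult_left_cancel not_gr_zero)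
  have pw: "(?f ^^ n) C = (\<circ>) (x ^^ n) ` C" for n C
    by (induction n) (auto simp: image_comp comp_assoc o_def)
  have "\<exists>C\<in>?X. ?f C = C"
  proof (rule exists_fixed_point[OF _ q])
    show "finite ?X" using finG by simp
    show "?f ` ?X \<subseteq> ?X"
    proof
      fix C assume "C \<in> ?f ` ?X"
      then obtain g where g: "g \<in> G" "C = (\<circ>) x ` ((\<circ>) g ` P)" by blast
      then have "C = (\<circ>) (x \<circ> g) ` P" by (auto simp: image_comp comp_assoc o_def)
      then show "C \<in> ?X" using g x comp_mem by blast
    qed
    show "(?f ^^ q) C = C" for C using x(2) unfolding pw by auto
    show "\<not> q dvd card ?X" using cX m by simp
  qed
  then obtain g where g: "g \<in> G" "(\<circ>) x ` ((\<circ>) g ` P) = (\<circ>) g ` P" by auto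
  have "x \<circ> g \<in> (\<circ>) x ` ((\<circ>) g ` P)"
  proof -
    have "g \<in> (\<circ>) g ` P" using P.id_mem by (auto intro!: image_eqI[of _ _ id])
    then show ?thesis by blast
  qed
  then obtain p where p: "p \<in> P" "x \<circ> g = g \<circ> p" using g(2) by auto
  then have "inv g \<circ> x \<circ> g = p" using inv_comp[OF g(1)] by (metis comp_assoc id_o)
  then show ?thesis using g p by auto
qed

end

section \<open>Partial linear spaces with three points on a line\<close>

locale three_point_lines =
  fixes Pt :: "'p set" and tri :: "'p \<Rightarrow> 'p \<Rightarrow> 'p \<Rightarrow> bool"
  assumes finite_Pt: "finite Pt"
    and tri_in: "tri P Q R \<Longrightarrow> P \<in> Pt" and tri_neq: "tri P Q R \<Longrightarrow> P \<noteq> Q"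
    and tri_rot: "tri P Q R \<Longrightarrow> tri Q P R" and tri_swap: "tri P Q R \<Longrightarrow> tri P R Q"
    and tri_det: "tri P Q R \<Longrightarrow> tri P Q R' \<Longrightarrow> R = R'"
begin

definition Lines :: "'p set set" where "Lines = {{P, Q, R} |P Q R. tri P Q R}"

definition star :: "'p \<Rightarrow> 'p set set" where "star P = {l \<in> Lines. P \<in> l}"

lemma Lines_Pt: "l \<in> Lines \<Longrightarrow> l \<subseteq> Pt"
  unfolding Lines_def using tri_in tri_rot tri_swap by blast

lemma finite_Lines: "finite Lines"
  by (rule finite_subset[of _ "Pow Pt"]) (use Lines_Pt finite_Pt in auto)

lemma finite_star: "finite (star P)"
  unfolding star_def using finite_Lines by simp

lemma tri_distinct: "tri P Q R \<Longrightarrow> P \<noteq> Q \<and> P \<noteq> R \<and> Q \<noteq> R"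
  using tri_neq tri_rot tri_swap by blast

lemma card_line: "l \<in> Lines \<Longrightarrow> card l = 3"
  unfolding Lines_def using tri_distinct by fastforce

lemma line_through:
  assumes "l \<in> Lines" "P \<in> l" "Q \<in> l" "P \<noteq> Q"
  obtains R where "tri P Q R" "l = {P, Q, R}"
proof -
  obtain A B C where t: "tri A B C" "l = {A, B, C}" using assms(1) unfolding Lines_def by blast
  have 1: "tri A C B" and 2: "tri B A C" using t tri_rot tri_swap by blast+
  have 3: "tri B C A" and 4: "tri C A B" using 1 2 tri_rot tri_swap by blast+
  have 5: "tri C B A" using 3 tri_rot by blast
  consider "P = A" "Q = B" | "P = A" "Q = C" | "P = B" "Q = A" | "P = B" "Q = C" | "P = C" "Q = A" | "P = C" "Q = B"
    using assms t(2) by blast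
  then show thesis using that t 1 2 3 4 5 by cases (simp_all add: insert_commute)
qed

lemma line_eq:
  assumes "l \<in> Lines" "m \<in> Lines" "P \<in> l" "Q \<in> l" "P \<in> m" "Q \<in> m" "P \<noteq> Q"
  shows "l = m"
  by (metis assms line_through tri_det)

text \<open>Two lines through \<open>P\<close> that meet \<open>m\<close> in the same point would
  share two points; so the intersection with \<open>m\<close> tells them apart.\<close>

lemma star_other_card:
  assumes m: "m \<in> Lines" and P: "P \<notin> m"
  shows "card {l \<in> star P. l \<inter> m \<noteq> {}} \<le> 3"
proof -
  define f where "f l = (SOME X. X \<in> l \<inter> m)" for l
  have f: "f l \<in> l" "f l \<in> m" if "l \<in> star P" "l \<inter> m \<noteq> {}" for l
    using that someI_ex[of "\<lambda>X. X \<in> l \<inter> m"] unfolding f_def by blast+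
  have "inj_on f {l \<in> star P. l \<inter> m \<noteq> {}}"
  proof (rule inj_onI)
    fix l l' assume a: "l \<in> {l \<in> star P. l \<inter> m \<noteq> {}}" "l' \<in> {l \<in> star P. l \<inter> m \<noteq> {}}" "f l = f l'"
    have "f l \<noteq> P" using f[of l] a P by auto
    then show "l = l'" using line_eq[of l l' P "f l"] f[of l] f[of l'] a unfolding star_def by auto
  qed
  moreover have "f ` {l \<in> star P. l \<inter> m \<noteq> {}} \<subseteq> m" using f by auto
  moreover have "finite m" using card_line[OF m] card.infinite by fastforce
  ultimately show ?thesis using card_inj_on_le[of f _ m] card_line[OF m] by simp
qed

text \<open>Pairwise intersecting lines without a common point: every one of them meets a fixed line in
  one of its three points, and through each of these there are at most three.\<close>

lemma clique_common_point:
  assumes C: "C \<subseteq> Lines" and meet: "\<And>l m. l \<in> C \<Longrightarrow> m \<in> C \<Longrightarrow> l \<inter> m \<noteq> {}" and big: "10 \<le> card C"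
  shows "\<exists>P. \<forall>l\<in>C. P \<in> l"
proof (rule ccontr)
  assume no: "\<not> ?thesis"
  obtain l0 where l0: "l0 \<in> C" using big by fastforce
  then have l0L: "l0 \<in> Lines" using C by blast
  have fin: "finite l0" using card_line[OF l0L] card.infinite by fastforce
  have le3: "card (C \<inter> star P) \<le> 3" if "P \<in> l0" for P
  proof -
    obtain m where m: "m \<in> C" "P \<notin> m" using no by blast
    have "C \<inter> star P \<subseteq> {l \<in> star P. l \<inter> m \<noteq> {}}" using meet m by auto
    then have "card (C \<inter> star P) \<le> card {l \<in> star P. l \<inter> m \<noteq> {}}"
      by (rule card_mono[rotated]) (use finite_star in auto)
    also have "\<dots> \<le> 3" using star_other_card m C by blast
    finally show ?thesis .
  qed
  have "C \<subseteq> (\<Union>P\<in>l0. C \<inter> star P)" using meet[OF _ l0] C unfolding star_def by blast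
  then have "card C \<le> card (\<Union>P\<in>l0. C \<inter> star P)"
    by (rule card_mono[rotated]) (use fin finite_star in auto)
  also have "\<dots> \<le> (\<Sum>P\<in>l0. card (C \<inter> star P))" by (rule card_UN_le[OF fin])
  also have "\<dots> \<le> (\<Sum>P\<in>l0. 3)" by (rule sum_mono) (rule le3)
  finally show False using big card_line[OF l0L] by simp
qed

definition collineation :: "('p \<Rightarrow> 'p) \<Rightarrow> bool" where
  "collineation a \<longleftrightarrow> bij_betw a Pt Pt \<and> (\<forall>P Q R. tri P Q R \<longrightarrow> tri (a P) (a Q) (a R))"

lemma collineation_id: "collineation id" unfolding collineation_def by auto

lemma collineation_comp: "collineation a \<Longrightarrow> collineation b \<Longrightarrow> collineation (a \<circ> b)"
  unfolding collineation_def by (auto intro: bij_betw_trans)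

lemma collineation_funpow: "collineation a \<Longrightarrow> collineation (a ^^ n)"
  by (induction n) (auto simp: collineation_id collineation_comp)

lemma collineation_image: "collineation a \<Longrightarrow> l \<in> Lines \<Longrightarrow> a ` l \<in> Lines"
  unfolding collineation_def Lines_def by fastforce

lemma collineation_inj: "collineation a \<Longrightarrow> inj_on ((`) a) Lines"
  using Lines_Pt unfolding collineation_def bij_betw_def
  by (meson inj_on_image inj_on_subset Pow_iff inj_on_image_Pow subsetI)

lemma collineation_Lines: "collineation a \<Longrightarrow> bij_betw ((`) a) Lines Lines"
  unfolding bij_betw_def using collineation_inj collineation_image finite_Lines
  by (simp add: endo_inj_surj image_subsetI)

text \<open>A collineation is injective on the finite set of lines, hence onto it; a triple whose
  image is a line is therefore itself a line.\<close>

lemma collineation_tri_iff: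
  assumes a: "collineation a" and "P \<in> Pt" "Q \<in> Pt" "R \<in> Pt"
  shows "tri (a P) (a Q) (a R) \<longleftrightarrow> tri P Q R"
proof
  assume t: "tri (a P) (a Q) (a R)"
  then have "{a P, a Q, a R} \<in> Lines" unfolding Lines_def by blast
  then obtain l where l: "l \<in> Lines" "a ` l = a ` {P, Q, R}"
    using collineation_Lines[OF a] unfolding bij_betw_def by (metis (no_types) image_iff image_insert image_empty)
  have "inj_on a Pt" using a unfolding collineation_def bij_betw_def by blast
  then have "l = {P, Q, R}" using l Lines_Pt assms
    by (metis empty_subsetI inj_on_image_eq_iff insert_subset)
  moreover have "P \<noteq> Q" "P \<noteq> R" "Q \<noteq> R" using tri_distinct[OF t] by auto
  ultimately obtain R' where R': "tri P Q R'" "{P, Q, R} = {P, Q, R'}"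
    using line_through[OF l(1), of P Q] by auto
  then have "R \<in> {P, Q, R'}" by blast
  then have "R' = R" using \<open>P \<noteq> R\<close> \<open>Q \<noteq> R\<close> by auto
  with R' show "tri P Q R" by simp
qed (use a in \<open>auto simp: collineation_def\<close>)

lemma collineation_inv:
  assumes a: "collineation a"
  shows "collineation (inv_into Pt a)"
proof -
  have bij: "bij_betw a Pt Pt" using a unfolding collineation_def by blast
  then have b: "bij_betw (inv_into Pt a) Pt Pt" by (rule bij_betw_inv_into)
  have "tri (inv_into Pt a P) (inv_into Pt a Q) (inv_into Pt a R)" if t: "tri P Q R" for P Q R
  proof -
    have "P \<in> Pt" "Q \<in> Pt" "R \<in> Pt" using t tri_in tri_rot tri_swap by blast+
    moreover have "inv_into Pt a X \<in> Pt" "a (inv_into Pt a X) = X" if "X \<in> Pt" for X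
      using that b bij bij_betwE bij_betw_inv_into_right by metis+
    ultimately show ?thesis
      using collineation_tri_iff[OF a, of "inv_into Pt a P" "inv_into Pt a Q" "inv_into Pt a R"] t by simp
  qed
  with b show ?thesis unfolding collineation_def by blast
qed

end

text \<open>Ten exceeds the nine lines that a clique without a common point can contain, so the
  image of a full pencil of lines is again concurrent.\<close>

locale thick_lines = three_point_lines +
  assumes thick: "P \<in> Pt \<Longrightarrow> 10 \<le> card (star P)"
begin

lemma star_inter:
  assumes "P \<in> Pt" "\<And>l. l \<in> star P \<Longrightarrow> Q \<in> l"
  shows "P = Q"
proof (rule ccontr)
  assume ne: "P \<noteq> Q"
  have "l = m" if "l \<in> star P" "m \<in> star P" for l m
    using line_eq[of l m P Q] that assms ne unfolding star_def by blast
  then have "card (star P) \<le> Suc 0" using finite_star by (simp add: card_le_Suc0_iff_eq)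
  then show False using thick[OF assms(1)] by simp
qed

lemma inj_star: "P \<in> Pt \<Longrightarrow> star P \<subseteq> star Q \<Longrightarrow> P = Q"
  using star_inter unfolding star_def by blast

text \<open>The common point of the images of the lines through \<open>P\<close> defines the map on
  points. Surjectivity comes from the same argument for the inverse of \<open>f\<close>, and
  bijectivity then from finiteness.\<close>

lemma line_action_is_collineation:
  assumes bij: "bij_betw f Lines Lines"
    and meet: "\<And>l m. l \<in> Lines \<Longrightarrow> m \<in> Lines \<Longrightarrow> f l \<inter> f m \<noteq> {} \<longleftrightarrow> l \<inter> m \<noteq> {}"
  shows "\<exists>a. collineation a \<and> (\<forall>l\<in>Lines. f l = a ` l)"
proof -
  \<comment> \<open>Stated for an arbitrary \<open>g\<close>, as it is applied both to
    \<open>f\<close> and to its inverse.\<close>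
  have step: "\<exists>Q\<in>Pt. g ` star P \<subseteq> star Q"
    if g: "bij_betw g Lines Lines" and gm: "\<And>l m. l \<in> Lines \<Longrightarrow> m \<in> Lines \<Longrightarrow> g l \<inter> g m \<noteq> {} \<longleftrightarrow> l \<inter> m \<noteq> {}"
      and P: "P \<in> Pt" for g P
  proof -
    have sub: "g ` star P \<subseteq> Lines" using g unfolding bij_betw_def star_def by blast
    have inj: "inj_on g (star P)" using g unfolding bij_betw_def star_def
      by (metis (no_types, lifting) inj_on_subset mem_Collect_eq subsetI)
    obtain Q where Q: "\<forall>l\<in>g ` star P. Q \<in> l"
    proof -
      have "\<exists>Q. \<forall>l\<in>g ` star P. Q \<in> l"
      proof (rule clique_common_point[OF sub])
        show "10 \<le> card (g ` star P)" using card_image[OF inj] thick[OF P] by simp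
        show "l \<inter> m \<noteq> {}" if "l \<in> g ` star P" "m \<in> g ` star P" for l m
          using that gm unfolding star_def by blast
      qed
      then show ?thesis using that by blast
    qed
    moreover obtain l where "l \<in> star P" using thick[OF P] by fastforce
    ultimately show ?thesis using sub Lines_Pt unfolding star_def by blast
  qed
  define h where "h = inv_into Lines f"
  have h: "bij_betw h Lines Lines" unfolding h_def using bij by (rule bij_betw_inv_into)
  have fh: "f (h l) = l" "h (f l) = l" "h l \<in> Lines" "f l \<in> Lines" if "l \<in> Lines" for l
    using that bij h unfolding h_def by (auto simp: bij_betw_inv_into_left bij_betw_inv_into_right bij_betw_def)
  have hm: "h l \<inter> h m \<noteq> {} \<longleftrightarrow> l \<inter> m \<noteq> {}" if "l \<in> Lines" "m \<in> Lines" for l m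
    using meet[of "h l" "h m"] fh that by simp
  define a where "a P = (SOME Q. Q \<in> Pt \<and> f ` star P \<subseteq> star Q)" for P
  have a: "a P \<in> Pt" "f ` star P \<subseteq> star (a P)" if "P \<in> Pt" for P
    using someI_ex[of "\<lambda>Q. Q \<in> Pt \<and> f ` star P \<subseteq> star Q"] step[OF bij meet that] unfolding a_def by blast+
  have surj: "\<exists>P\<in>Pt. a P = Q" if Q: "Q \<in> Pt" for Q
  proof -
    obtain P where P: "P \<in> Pt" "h ` star Q \<subseteq> star P" using step[OF h hm Q] by blast
    have "star Q \<subseteq> star (a P)"
    proof
      fix l assume l: "l \<in> star Q"
      then have "f (h l) \<in> star (a P)" using P a by blast
      then show "l \<in> star (a P)" using fh l unfolding star_def by simp
    qed
    then show ?thesis using inj_star[OF Q] P by blast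
  qed
  have "a ` Pt = Pt" using a surj by blast
  then have bij_a: "bij_betw a Pt Pt" using finite_Pt by (simp add: bij_betw_def finite_surj_inj)
  have img: "f l = a ` l" if l: "l \<in> Lines" for l
  proof -
    have "a ` l \<subseteq> f l" using a Lines_Pt[OF l] l unfolding star_def by blast
    moreover have "card (a ` l) = card (f l)"
      using card_line[OF l] card_line[OF fh(4)[OF l]] bij_a Lines_Pt[OF l]
      by (metis bij_betw_def card_image inj_on_subset)
    moreover have "finite (f l)" using card_line[OF fh(4)[OF l]] card.infinite by fastforce
    ultimately show ?thesis using card_subset_eq by metis
  qed
  have "tri (a P) (a Q) (a R)" if t: "tri P Q R" for P Q R
  proof -
    have l: "{P, Q, R} \<in> Lines" using t unfolding Lines_def by blast
    have im: "f {P, Q, R} = {a P, a Q, a R}" using img[OF l] by simp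
    then have L: "{a P, a Q, a R} \<in> Lines" using fh(4)[OF l] by simp
    moreover have "P \<in> Pt" "Q \<in> Pt" "R \<in> Pt" using Lines_Pt[OF l] by auto
    then have "a P \<noteq> a Q" "a P \<noteq> a R" "a Q \<noteq> a R"
      using tri_distinct[OF t] bij_a unfolding bij_betw_def inj_on_def by blast+
    ultimately obtain R' where R': "tri (a P) (a Q) R'" "{a P, a Q, a R} = {a P, a Q, R'}"
      using line_through[OF L, of "a P" "a Q"] by auto
    then have "a R \<in> {a P, a Q, R'}" by blast
    then have "R' = a R" using \<open>a P \<noteq> a R\<close> \<open>a Q \<noteq> a R\<close> by auto
    with R' show ?thesis by simp
  qed
  then show ?thesis using bij_a img unfolding collineation_def by blast
qed

text \<open>The image of \<open>P\<close> lies on all lines through \<open>P\<close>, and these have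
  no other point in common. This carries an identity between powers from lines to points.\<close>

lemma collineation_trivial_on_lines:
  assumes a: "collineation a" and triv: "\<And>l. l \<in> Lines \<Longrightarrow> a ` l = l" and P: "P \<in> Pt"
  shows "a P = P"
proof -
  have "a P \<in> l" if "l \<in> star P" for l using triv[of l] that unfolding star_def by blast
  then show ?thesis using star_inter[OF P] by metis
qed

end

section \<open>Elusive graphs and lexicographic products\<close>

text \<open>The condition \<open>p ^^ q = id\<close> admits order \<open>q\<close> or 1, so no
  notion of order is involved; on a nonempty graph the identity satisfies the conclusion
  anyway.\<close>

definition elusive :: "'a pair_pre_digraph \<Rightarrow> bool" where
  "elusive G \<longleftrightarrow> (\<forall>p q. automorphism G p \<longrightarrow> prime (q::nat) \<longrightarrow> p ^^ q = id \<longrightarrow> (\<exists>v\<in>pverts G. p v = v))"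

lemma automorphism_permutes: "automorphism G p \<Longrightarrow> p permutes pverts G"
  unfolding automorphism_def by blast

lemma automorphism_arc:
  "automorphism G p \<Longrightarrow> u \<in> pverts G \<Longrightarrow> v \<in> pverts G \<Longrightarrow> (p u, p v) \<in> parcs G \<longleftrightarrow> (u, v) \<in> parcs G"
  unfolding automorphism_def by blast

lemma automorphism_in: "automorphism G p \<Longrightarrow> u \<in> pverts G \<Longrightarrow> p u \<in> pverts G"
  using automorphism_permutes permutes_in_image by metis

lemma automorphism_id: "automorphism G id"
  unfolding automorphism_def by (simp add: permutes_id)

lemma automorphism_comp:
  assumes "automorphism G p" "automorphism G r"
  shows "automorphism G (p \<circ> r)"
  using assms automorphism_in[OF assms(2)] unfolding automorphism_def by (simp add: permutes_compose)

lemma automorphism_funpow: "automorphism G p \<Longrightarrow> automorphism G (p ^^ n)"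
  by (induction n) (auto simp: automorphism_id automorphism_comp)

text \<open>If all cycles of \<open>p\<close> have length \<open>n\<close> and \<open>q\<close> is a prime divisor of \<open>n\<close>, then
  \<open>p\<close> to the power \<open>n div q\<close> has order \<open>q\<close> and no fixed vertex.\<close>

lemma elusive_no_semiregular:
  assumes fin: "finite (pverts G)" and el: "elusive G" and p: "automorphism G p"
  shows "\<not> semiregular (pverts G) p"
proof
  let ?V = "pverts G"
  assume sr: "semiregular ?V p"
  have perm: "p permutes ?V" by (rule automorphism_permutes[OF p])
  have ne: "p \<noteq> id" using sr unfolding semiregular_def by blast
  have permn: "permutation p" using perm fin permutation_permutes by blast
  obtain x0 where x0: "x0 \<in> ?V" using ne perm unfolding permutes_def by fastforce
  define n where "n = card (orbit p x0)"
  have card: "card (orbit p x) = n" if "x \<in> ?V" for x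
    using sr that x0 unfolding semiregular_def n_def by blast
  have self: "x \<in> orbit p x" for x by (rule permutation_self_in_orbit[OF permn])
  have nodup: "funpow_dist1 p x x = n" if "x \<in> ?V" for x
  proof -
    have "orbit p x = (\<lambda>m. (p ^^ m) x) ` {0..<funpow_dist1 p x x}" by (rule orbit_conv_funpow_dist1[OF self])
    moreover have "inj_on (\<lambda>m. (p ^^ m) x) {0..<funpow_dist1 p x x}" by (rule inj_on_funpow_dist1[OF self])
    ultimately show ?thesis using card[OF that] card_image by fastforce
  qed
  have pn: "(p ^^ n) x = x" if "x \<in> ?V" for x
    using funpow_dist1_prop[OF self, of x] unfolding nodup[OF that] .
  have least: "(p ^^ m) x \<noteq> x" if "x \<in> ?V" "0 < m" "m < n" for x m
    using funpow_dist1_least[of m p x x] that unfolding nodup[OF that(1)] by blast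
  have "n \<noteq> 0" using nodup[OF x0] by linarith
  have "n \<noteq> 1"
  proof
    assume "n = 1"
    then have "p x = x" for x using pn[of x] perm by (cases "x \<in> ?V") (auto simp: permutes_def)
    with ne show False by (simp add: fun_eq_iff)
  qed
  then obtain q where q: "prime q" "q dvd n" using prime_factor_nat by blast
  define r where "r = p ^^ (n div q)"
  have r: "automorphism G r" unfolding r_def by (rule automorphism_funpow[OF p])
  have "(r ^^ q) x = x" for x
  proof (cases "x \<in> ?V")
    case True
    then show ?thesis using pn q by (simp add: r_def funpow_mult)
  next
    case False
    moreover have "r ^^ q permutes ?V"
      using automorphism_permutes[OF automorphism_funpow[OF r]] .
    ultimately show ?thesis by (simp add: permutes_def)
  qed
  then have "r ^^ q = id" by (simp add: fun_eq_iff)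
  then obtain v where "v \<in> ?V" "r v = v" using el r q unfolding elusive_def by blast
  moreover obtain m where m: "n = q * m" using q by blast
  then have "n div q = m" "0 < m" "m < n" using \<open>n \<noteq> 0\<close> prime_gt_1_nat[OF q(1)] by auto
  ultimately show False using least unfolding r_def by blast
qed

section \<open>Constructing graphs and renaming their vertices\<close>

lemma pair_graphI:
  assumes fin: "finite (pverts G)"
    and arc: "\<And>u v. (u, v) \<in> parcs G \<Longrightarrow> u \<in> pverts G \<and> v \<in> pverts G \<and> u \<noteq> v \<and> (v, u) \<in> parcs G"
  shows "pair_graph G"
proof -
  have "parcs G \<subseteq> pverts G \<times> pverts G" using arc by auto
  then have finA: "finite (parcs G)" using fin finite_subset by blast
  show ?thesis
  proof unfold_locales
    show "fst e \<in> pverts G" "snd e \<in> pverts G" "fst e \<noteq> snd e" if "e \<in> parcs G" for e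
      using that arc[of "fst e" "snd e"] by auto
    show "symmetric (with_proj G)"
      using arc unfolding symmetric_conv by force
  qed (use fin finA in auto)
qed

text \<open>Each product enlarges the vertex type. Renaming the vertices by natural numbers keeps
  all powers in one type, as the induction over the exponent requires.\<close>

definition relabel :: "('a \<Rightarrow> 'b) \<Rightarrow> 'a pair_pre_digraph \<Rightarrow> 'b pair_pre_digraph" where
  "relabel f G = \<lparr>pverts = f ` pverts G, parcs = (\<lambda>(u, v). (f u, f v)) ` parcs G\<rparr>"

lemma relabel_sel [simp]:
  "pverts (relabel f G) = f ` pverts G" "parcs (relabel f G) = (\<lambda>(u, v). (f u, f v)) ` parcs G"
  by (simp_all add: relabel_def)

definition transport :: "('a \<Rightarrow> 'b) \<Rightarrow> 'a set \<Rightarrow> ('a \<Rightarrow> 'a) \<Rightarrow> 'b \<Rightarrow> 'b" where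
  "transport f V p y = (if y \<in> f ` V then f (p (inv_into V f y)) else y)"

lemma transport_apply: "inj_on f V \<Longrightarrow> x \<in> V \<Longrightarrow> transport f V p (f x) = f (p x)"
  by (simp add: transport_def)

lemma transport_permutes:
  assumes f: "inj_on f V" and p: "p permutes V"
  shows "transport f V p permutes (f ` V)"
proof (rule bij_imp_permutes)
  have "inj_on (transport f V p) (f ` V)"
  proof (rule inj_onI)
    fix x y assume xy: "x \<in> f ` V" "y \<in> f ` V" "transport f V p x = transport f V p y"
    then obtain u v where uv: "u \<in> V" "v \<in> V" "x = f u" "y = f v" by blast
    then have "f (p u) = f (p v)" using xy transport_apply[OF f] by metis
    then have "p u = p v" using f uv p permutes_in_image by (metis inj_onD)
    then show "x = y" using uv permutes_inj[OF p] by (metis injD)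
  qed
  moreover have "transport f V p ` f ` V = f ` p ` V"
    using transport_apply[OF f] by (force simp: image_iff)
  ultimately show "bij_betw (transport f V p) (f ` V) (f ` V)"
    unfolding bij_betw_def using permutes_image[OF p] by simp
qed (simp add: transport_def)

lemma relabel_arc:
  assumes G: "pair_graph G" and f: "inj_on f (pverts G)" and uv: "u \<in> pverts G" "v \<in> pverts G"
  shows "(f u, f v) \<in> parcs (relabel f G) \<longleftrightarrow> (u, v) \<in> parcs G"
proof -
  interpret pair_graph G by (rule G)
  show ?thesis
  proof
    assume "(f u, f v) \<in> parcs (relabel f G)"
    then obtain a b where ab: "(a, b) \<in> parcs G" "f a = f u" "f b = f v" by auto
    then have "a = u" "b = v" using f uv in_arcsD1[OF ab(1)] in_arcsD2[OF ab(1)] by (simp_all add: inj_on_eq_iff)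
    with ab show "(u, v) \<in> parcs G" by simp
  qed force
qed

lemma relabel_props:
  assumes G: "pair_graph G" and f: "inj_on f (pverts G)"
  shows "pair_graph (relabel f G)" and "card (pverts (relabel f G)) = card (pverts G)"
    and "vertex_transitive G \<Longrightarrow> vertex_transitive (relabel f G)"
    and "elusive G \<Longrightarrow> elusive (relabel f G)"
proof -
  interpret pair_graph G by (rule G)
  let ?V = "pverts G" and ?H = "relabel f G"
  note arc = relabel_arc[OF G f]
  show "pair_graph ?H"
  proof (rule pair_graphI)
    fix x y assume "(x, y) \<in> parcs ?H"
    then obtain u v where uv: "(u, v) \<in> parcs G" "x = f u" "y = f v" by auto
    have V: "u \<in> ?V" "v \<in> ?V" using in_arcsD1[OF uv(1)] in_arcsD2[OF uv(1)] by auto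
    have "u \<noteq> v" using no_loops[of "(u, v)"] uv(1) by auto
    moreover have "(v, u) \<in> parcs G" using arcs_symmetric uv(1) by blast
    ultimately show "x \<in> pverts ?H \<and> y \<in> pverts ?H \<and> x \<noteq> y \<and> (y, x) \<in> parcs ?H"
      using V uv(2,3) f by (auto simp: inj_on_eq_iff image_iff intro!: bexI[of _ "(v, u)"])
  qed simp
  show "card (pverts ?H) = card ?V" using card_image[OF f] by simp
  have tr: "automorphism ?H (transport f ?V p)" if p: "automorphism G p" for p
  proof -
    have "(transport f ?V p x, transport f ?V p y) \<in> parcs ?H \<longleftrightarrow> (x, y) \<in> parcs ?H"
      if xy: "x \<in> f ` ?V" "y \<in> f ` ?V" for x y
    proof -
      obtain u v where uv: "u \<in> ?V" "v \<in> ?V" "x = f u" "y = f v" using xy by blast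
      have "(f (p u), f (p v)) \<in> parcs ?H \<longleftrightarrow> (f u, f v) \<in> parcs ?H"
        unfolding arc[OF automorphism_in[OF p uv(1)] automorphism_in[OF p uv(2)]] arc[OF uv(1,2)]
        by (rule automorphism_arc[OF p uv(1,2)])
      then show ?thesis unfolding uv(3,4) transport_apply[OF f uv(1)] transport_apply[OF f uv(2)] .
    qed
    then show ?thesis using transport_permutes[OF f automorphism_permutes[OF p]]
      unfolding automorphism_def relabel_sel(1) by blast
  qed
  show "vertex_transitive ?H" if vt: "vertex_transitive G"
    unfolding vertex_transitive_def
  proof (intro ballI)
    fix x y assume "x \<in> pverts ?H" "y \<in> pverts ?H"
    then obtain u v where uv: "u \<in> ?V" "v \<in> ?V" "x = f u" "y = f v" by auto
    then obtain p where "automorphism G p" "p u = v" using vt unfolding vertex_transitive_def by blast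
    then show "\<exists>p. automorphism ?H p \<and> p x = y" using tr transport_apply[OF f] uv by metis
  qed
  show "elusive ?H" if el: "elusive G"
    unfolding elusive_def
  proof (intro allI impI)
    fix p and q :: nat assume p: "automorphism ?H p" and q: "prime q" "p ^^ q = id"
    \<comment> \<open>\<open>?r\<close> is the conjugate of \<open>p\<close> by the renaming: an
      automorphism of \<open>G\<close> whose fixed vertices correspond to those of \<open>p\<close>
      under \<open>f\<close>.\<close>
    let ?g = "inv_into ?V f" and ?r = "transport (inv_into ?V f) (f ` ?V) p"
    have gi: "inj_on ?g (f ` ?V)" by (rule inj_on_inv_into) simp
    have gV: "?g ` f ` ?V = ?V" using f by (auto simp: image_iff)
    have fr: "f (?r u) = p (f u)" if "u \<in> ?V" for u
    proof -
      have "?r (?g (f u)) = ?g (p (f u))" using transport_apply[OF gi] that by blast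
      moreover have "p (f u) \<in> f ` ?V" using automorphism_in[OF p] that by auto
      ultimately show ?thesis using f that by (simp add: f_inv_into_f)
    qed
    have perm: "?r permutes ?V"
      using transport_permutes[OF gi] automorphism_permutes[OF p] unfolding gV by simp
    have rin: "?r u \<in> ?V" if "u \<in> ?V" for u using perm that permutes_in_image by metis
    have "(?r u, ?r v) \<in> parcs G \<longleftrightarrow> (u, v) \<in> parcs G" if uv: "u \<in> ?V" "v \<in> ?V" for u v
      using arc[OF rin rin, OF uv] arc[OF uv] automorphism_arc[OF p, of "f u" "f v"] fr uv by auto
    then have r: "automorphism G ?r" using perm unfolding automorphism_def by blast
    have frn: "f ((?r ^^ n) u) = (p ^^ n) (f u) \<and> (?r ^^ n) u \<in> ?V" if "u \<in> ?V" for u n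
      using that by (induction n) (auto simp: fr rin)
    have "(?r ^^ q) u = u" for u
    proof (cases "u \<in> ?V")
      case True
      then show ?thesis using frn[of u q] q f by (metis id_apply inj_onD)
    next
      case False
      then show ?thesis using automorphism_permutes[OF automorphism_funpow[OF r]] by (simp add: permutes_def)
    qed
    then have "?r ^^ q = id" by (simp add: fun_eq_iff)
    then obtain v where "v \<in> ?V" "?r v = v" using el r q unfolding elusive_def by blast
    then show "\<exists>v\<in>pverts ?H. p v = v" using fr[of v] by (intro bexI[of _ "f v"]) auto
  qed
qed

section \<open>Common neighbours and twins\<close>

definition nbhd :: "'a pair_pre_digraph \<Rightarrow> 'a \<Rightarrow> 'a set" where
  "nbhd G u = {v \<in> pverts G. (u, v) \<in> parcs G}"

text \<open>The exception \<open>w \<noteq> v\<close> makes the condition rule out twins with equal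
  closed neighbourhoods as well as those with equal open ones. Twins in the outer factor would blur
  the blocks of a lexicographic product.\<close>

definition twin_free :: "'a pair_pre_digraph \<Rightarrow> bool" where
  "twin_free G \<longleftrightarrow> (\<forall>u\<in>pverts G. \<forall>v\<in>pverts G. u \<noteq> v \<longrightarrow>
     (\<exists>w\<in>pverts G. w \<noteq> v \<and> (u, w) \<in> parcs G \<and> (v, w) \<notin> parcs G))"

lemma automorphism_nbhd:
  assumes p: "automorphism G p" and u: "u \<in> pverts G"
  shows "nbhd G (p u) = p ` nbhd G u"
proof
  show "p ` nbhd G u \<subseteq> nbhd G (p u)"
    using automorphism_in[OF p] automorphism_arc[OF p u] unfolding nbhd_def by auto
  show "nbhd G (p u) \<subseteq> p ` nbhd G u"
  proof
    fix y assume y: "y \<in> nbhd G (p u)"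
    then have "y \<in> p ` pverts G" using permutes_image[OF automorphism_permutes[OF p]] unfolding nbhd_def by simp
    then obtain x where "x \<in> pverts G" "y = p x" by blast
    then show "y \<in> p ` nbhd G u" using y automorphism_arc[OF p u] unfolding nbhd_def by auto
  qed
qed

lemma automorphism_card_common:
  assumes p: "automorphism G p" and uv: "u \<in> pverts G" "v \<in> pverts G"
  shows "card (nbhd G (p u) \<inter> nbhd G (p v)) = card (nbhd G u \<inter> nbhd G v)"
proof -
  have inj: "inj p" by (rule permutes_inj[OF automorphism_permutes[OF p]])
  then have "nbhd G (p u) \<inter> nbhd G (p v) = p ` (nbhd G u \<inter> nbhd G v)"
    unfolding automorphism_nbhd[OF p uv(1)] automorphism_nbhd[OF p uv(2)] by (simp add: image_Int)
  then show ?thesis using card_image[OF inj_on_subset[OF inj]] by simp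
qed

lemma vertex_transitive_regular:
  assumes "vertex_transitive G" "u \<in> pverts G" "v \<in> pverts G"
  shows "card (nbhd G u) = card (nbhd G v)"
proof -
  obtain p where p: "automorphism G p" "p u = v" using assms unfolding vertex_transitive_def by blast
  then show ?thesis using automorphism_card_common[OF p(1) assms(2,2)] by simp
qed

section \<open>The lexicographic product and its blocks\<close>

definition lex :: "'a pair_pre_digraph \<Rightarrow> 'b pair_pre_digraph \<Rightarrow> ('a \<times> 'b) pair_pre_digraph" where
  "lex G D = \<lparr>pverts = pverts G \<times> pverts D,
     parcs = {((u, d), (v, e)) |u d v e. u \<in> pverts G \<and> v \<in> pverts G \<and> d \<in> pverts D \<and> e \<in> pverts D \<and>
       ((u, v) \<in> parcs G \<or> u = v \<and> (d, e) \<in> parcs D)}\<rparr>"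

lemma lex_verts [simp]: "pverts (lex G D) = pverts G \<times> pverts D"
  by (simp add: lex_def)

lemma lex_arc:
  "((u, d), (v, e)) \<in> parcs (lex G D) \<longleftrightarrow> u \<in> pverts G \<and> v \<in> pverts G \<and> d \<in> pverts D \<and> e \<in> pverts D \<and>
     ((u, v) \<in> parcs G \<or> u = v \<and> (d, e) \<in> parcs D)"
  by (simp add: lex_def)

locale lex_product =
  fixes G :: "'a pair_pre_digraph" and D :: "'b pair_pre_digraph"
  assumes G: "pair_graph G" and D: "pair_graph D"
    and vtG: "vertex_transitive G" and vtD: "vertex_transitive D"
    and twG: "twin_free G" and neD: "pverts D \<noteq> {}"
begin

sublocale G: pair_graph G by (rule G)
sublocale D: pair_graph D by (rule D)

lemma loopG: "(u, u) \<notin> parcs G" and loopD: "(d, d) \<notin> parcs D"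
  using G.no_loops[of "(u, u)"] D.no_loops[of "(d, d)"] by auto

lemma pair_graph_lex: "pair_graph (lex G D)"
  by (rule pair_graphI) (auto simp: lex_arc loopG loopD G.arcs_symmetric D.arcs_symmetric)

lemma vertex_transitive_lex: "vertex_transitive (lex G D)"
  unfolding vertex_transitive_def
proof (intro ballI)
  fix x y assume xy: "x \<in> pverts (lex G D)" "y \<in> pverts (lex G D)"
  obtain u d v e where e: "x = (u, d)" "y = (v, e)" by fastforce
  obtain p where p: "automorphism G p" "p u = v" using vtG xy e unfolding vertex_transitive_def by auto
  obtain r where r: "automorphism D r" "r d = e" using vtD xy e unfolding vertex_transitive_def by auto
  let ?V = "pverts (lex G D)"
  let ?f = "\<lambda>x. if x \<in> ?V then (p (fst x), r (snd x)) else x"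
  have inj: "inj p" "inj r" using p r automorphism_permutes permutes_inj by blast+
  have "?f permutes ?V"
  proof (rule bij_imp_permutes)
    have "inj_on ?f ?V"
    proof (rule inj_onI)
      fix x y assume a: "x \<in> ?V" "y \<in> ?V" "?f x = ?f y"
      then have "p (fst x) = p (fst y)" "r (snd x) = r (snd y)" by (simp_all only: if_True prod.inject)
      then show "x = y" using inj by (metis injD prod.expand)
    qed
    moreover have "?f ` ?V \<subseteq> ?V" using automorphism_in[OF p(1)] automorphism_in[OF r(1)] by auto
    moreover have "finite ?V" by simp
    ultimately have "?f ` ?V = ?V" using endo_inj_surj by blast
    with \<open>inj_on ?f ?V\<close> show "bij_betw ?f ?V ?V" unfolding bij_betw_def by blast
  qed simp
  moreover have "(?f x, ?f y) \<in> parcs (lex G D) \<longleftrightarrow> (x, y) \<in> parcs (lex G D)" if xy: "x \<in> ?V" "y \<in> ?V" for x y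
    using xy automorphism_in[OF p(1)] automorphism_in[OF r(1)] automorphism_arc[OF p(1)] automorphism_arc[OF r(1)] inj
    by (cases x; cases y) (auto simp: lex_arc inj_eq)
  ultimately have "automorphism (lex G D) ?f" unfolding automorphism_def by blast
  then show "\<exists>p. automorphism (lex G D) p \<and> p x = y" using xy e p r by auto
qed

text \<open>Vertices of one block have at least \<open>r n\<close> common neighbours, \<open>r\<close> the valency of \<open>G\<close> and
  \<open>n\<close> the order of \<open>D\<close>; vertices of different blocks have fewer.\<close>

lemma same_block:
  assumes x: "(u, d) \<in> pverts (lex G D)" and y: "(v, e) \<in> pverts (lex G D)"
  shows "u = v \<longleftrightarrow> card (nbhd G u) * card (pverts D) \<le> card (nbhd (lex G D) (u, d) \<inter> nbhd (lex G D) (v, e))"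
proof -
  let ?n = "card (pverts D)" and ?C = "nbhd (lex G D) (u, d) \<inter> nbhd (lex G D) (v, e)"
  have fin: "finite (nbhd G w)" "finite (pverts D)" for w unfolding nbhd_def by auto
  have finC: "finite ?C" unfolding nbhd_def by auto
  have npos: "0 < ?n" using neD by (simp add: card_gt_0_iff)
  have uv: "u \<in> pverts G" "v \<in> pverts G" "d \<in> pverts D" "e \<in> pverts D" using x y by auto
  show ?thesis
  proof
    assume "u = v"
    then have "nbhd G u \<times> pverts D \<subseteq> ?C" using uv unfolding nbhd_def by (auto simp: lex_arc)
    then show "card (nbhd G u) * ?n \<le> card ?C" using card_mono[OF finC] by (metis card_cartesian_product)
  next
    assume le: "card (nbhd G u) * ?n \<le> card ?C"
    show "u = v"
    proof (rule ccontr)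
      assume ne: "u \<noteq> v"
      obtain w where w: "w \<in> pverts G" "w \<noteq> v" "(u, w) \<in> parcs G" "(v, w) \<notin> parcs G"
        using twG uv ne unfolding twin_free_def by blast
      show False
      proof (cases "(u, v) \<in> parcs G")
        case True
        then have vu: "(v, u) \<in> parcs G" by (rule G.arcs_symmetric)
        \<comment> \<open>With r the valency and n the block size, \<open>v\<close> and
          \<open>w\<close> are lost among the r neighbours of \<open>u\<close>, while the two blocks
          themselves contribute at most n - 1 vertices each, as there are no loops: (r - 2) n + 2 (n
          - 1) < r n.\<close>
        have sub: "?C \<subseteq> (nbhd G u - {v, w}) \<times> pverts D \<union> {v} \<times> (pverts D - {e}) \<union> {u} \<times> (pverts D - {d})"
          using w ne True vu unfolding nbhd_def by (auto simp: lex_arc loopG loopD)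
        have "card ?C \<le> card ((nbhd G u - {v, w}) \<times> pverts D \<union> {v} \<times> (pverts D - {e}) \<union> {u} \<times> (pverts D - {d}))"
          by (rule card_mono[OF _ sub]) (use fin in auto)
        also have "\<dots> \<le> card ((nbhd G u - {v, w}) \<times> pverts D) + card ({v} \<times> (pverts D - {e})) + card ({u} \<times> (pverts D - {d}))"
          by (meson add_le_mono1 card_Un_le order_trans)
        also have "\<dots> = (card (nbhd G u) - 2) * ?n + (?n - 1) + (?n - 1)"
        proof -
          have "{v, w} \<subseteq> nbhd G u" using True w uv unfolding nbhd_def by auto
          then have "card (nbhd G u - {v, w}) = card (nbhd G u) - 2"
            using card_Diff_subset[of "{v, w}" "nbhd G u"] w(2) by auto
          then show ?thesis using uv by (simp add: card_cartesian_product)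
        qed
        also have "\<dots> < card (nbhd G u) * ?n"
        proof -
          have "{v, w} \<subseteq> nbhd G u" using True w uv unfolding nbhd_def by auto
          then have "card {v, w} \<le> card (nbhd G u)" by (rule card_mono[OF fin(1)])
          then have "2 \<le> card (nbhd G u)" using w(2) by (simp add: w(2)[symmetric])
          then obtain m where "card (nbhd G u) = m + 2" by (metis add.commute le_Suc_ex)
          then show ?thesis using npos by (simp add: algebra_simps)
        qed
        finally show False using le by simp
      next
        case False
        then have vu: "(v, u) \<notin> parcs G" using G.arcs_symmetric by blast
        have wn: "w \<in> nbhd G u" using w unfolding nbhd_def by auto
        have sub: "?C \<subseteq> (nbhd G u - {w}) \<times> pverts D"
          using w ne False vu unfolding nbhd_def by (auto simp: lex_arc loopG loopD)
        have "card ?C \<le> card ((nbhd G u - {w}) \<times> pverts D)" by (rule card_mono[OF _ sub]) (use fin in auto)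
        also have "\<dots> = (card (nbhd G u) - 1) * ?n" using wn by (simp add: card_cartesian_product)
        also have "\<dots> < card (nbhd G u) * ?n"
          using npos wn fin(1) by (metis card_gt_0_iff diff_less empty_iff mult_less_mono1 zero_less_one)
        finally show False using le by simp
      qed
    qed
  qed
qed

lemma elusive_lex:
  assumes elG: "elusive G" and elD: "elusive D"
  shows "elusive (lex G D)"
  unfolding elusive_def
proof (intro allI impI)
  fix p and q :: nat assume p: "automorphism (lex G D) p" and q: "prime q" "p ^^ q = id"
  let ?V = "pverts (lex G D)"
  obtain d0 where d0: "d0 \<in> pverts D" using neD by blast
  have reg: "card (nbhd G u) = card (nbhd G v)" if "u \<in> pverts G" "v \<in> pverts G" for u v
    using vertex_transitive_regular[OF vtG that] .
  \<comment> \<open>Counts of common neighbours are invariant, and the threshold in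
    \<open>same_block\<close> depends on the block only through the valency, which is
    constant.\<close>
  have block: "fst (p x) = fst (p y) \<longleftrightarrow> fst x = fst y" if xy: "x \<in> ?V" "y \<in> ?V" for x y
  proof -
    obtain u d v e where e: "x = (u, d)" "y = (v, e)" by fastforce
    obtain u' d' v' e' where e': "p x = (u', d')" "p y = (v', e')" by fastforce
    have V: "(u', d') \<in> ?V" "(v', e') \<in> ?V" using automorphism_in[OF p] xy e' by metis+
    have V0: "(u, d) \<in> ?V" "(v, e) \<in> ?V" using xy e by auto
    have "card (nbhd (lex G D) (u', d') \<inter> nbhd (lex G D) (v', e')) =
        card (nbhd (lex G D) (u, d) \<inter> nbhd (lex G D) (v, e))"
      using automorphism_card_common[OF p xy] by (simp only: e e'[unfolded e])
    moreover have "card (nbhd G u') = card (nbhd G u)" using reg V(1) V0(1) by auto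
    ultimately have "u' = v' \<longleftrightarrow> u = v" by (simp only: same_block[OF V] same_block[OF V0])
    then show ?thesis by (simp only: e e'[unfolded e] fst_conv)
  qed
  define s where "s u = (if u \<in> pverts G then fst (p (u, d0)) else u)" for u
  have s: "fst (p (u, d)) = s u" if "u \<in> pverts G" "d \<in> pverts D" for u d
    using block[of "(u, d)" "(u, d0)"] that d0 by (simp add: s_def)
  have s_in: "s u \<in> pverts G" if "u \<in> pverts G" for u
    using automorphism_in[OF p, of "(u, d0)"] that d0 by (auto simp: s_def mem_Times_iff)
  have pn: "fst ((p ^^ n) (u, d0)) = (s ^^ n) u \<and> (p ^^ n) (u, d0) \<in> ?V" if u: "u \<in> pverts G" for u n
  proof (induction n)
    case (Suc n)
    obtain b where b: "(p ^^ n) (u, d0) = ((s ^^ n) u, b)" using Suc by (metis prod.collapse)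
    then show ?case using s[of "(s ^^ n) u" b] automorphism_in[OF p, of "((s ^^ n) u, b)"] Suc by auto
  qed (use u d0 in auto)
  have "s permutes pverts G"
  proof (rule bij_imp_permutes)
    have "inj_on s (pverts G)"
    proof (rule inj_onI)
      fix u v assume "u \<in> pverts G" "v \<in> pverts G" "s u = s v"
      then show "u = v" using block[of "(u, d0)" "(v, d0)"] d0 by (simp add: s_def)
    qed
    then show "bij_betw s (pverts G) (pverts G)"
      using s_in by (simp add: bij_betw_def endo_inj_surj image_subsetI)
  qed (simp add: s_def)
  \<comment> \<open>Between different blocks adjacency does not depend on the second coordinates, so
    one representative of each block decides.\<close>
  moreover have "(s u, s v) \<in> parcs G \<longleftrightarrow> (u, v) \<in> parcs G" if uv: "u \<in> pverts G" "v \<in> pverts G" for u v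
  proof (cases "u = v")
    case False
    obtain d e where de: "p (u, d0) = (s u, d)" "p (v, d0) = (s v, e)" using s[OF uv(1) d0] s[OF uv(2) d0]
      by (metis prod.collapse)
    have V: "(s u, d) \<in> ?V" "(s v, e) \<in> ?V" using automorphism_in[OF p] uv d0 de by (metis lex_verts mem_Sigma_iff)+
    have "s u \<noteq> s v" using block[of "(u, d0)" "(v, d0)"] False uv d0 de by simp
    then show ?thesis using automorphism_arc[OF p, of "(u, d0)" "(v, d0)"] uv d0 de False V by (simp add: lex_arc)
  qed (simp add: loopG)
  ultimately have saut: "automorphism G s" unfolding automorphism_def by blast
  have "(s ^^ q) u = u" for u
  proof (cases "u \<in> pverts G")
    case True
    then show ?thesis using pn[OF True, of q] q by simp
  next
    case False
    then show ?thesis using automorphism_permutes[OF automorphism_funpow[OF saut]] by (simp add: permutes_def)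
  qed
  then have "s ^^ q = id" by (simp add: fun_eq_iff)
  then obtain u where u: "u \<in> pverts G" "s u = u" using elG saut q unfolding elusive_def by blast
  define r where "r d = (if d \<in> pverts D then snd (p (u, d)) else d)" for d
  have pr: "p (u, d) = (u, r d)" if "d \<in> pverts D" for d
    using s[OF u(1) that] u that by (metis prod.collapse r_def)
  have r_in: "r d \<in> pverts D" if "d \<in> pverts D" for d
    using automorphism_in[OF p, of "(u, d)"] pr[OF that] that u by auto
  have "r permutes pverts D"
  proof (rule bij_imp_permutes)
    have "inj p" by (rule permutes_inj[OF automorphism_permutes[OF p]])
    then have "inj_on r (pverts D)" using pr by (metis inj_onI injD prod.inject)
    then show "bij_betw r (pverts D) (pverts D)"
      using r_in by (simp add: bij_betw_def endo_inj_surj image_subsetI)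
  qed (simp add: r_def)
  moreover have "(r d, r e) \<in> parcs D \<longleftrightarrow> (d, e) \<in> parcs D" if "d \<in> pverts D" "e \<in> pverts D" for d e
    using automorphism_arc[OF p, of "(u, d)" "(u, e)"] pr[OF that(1)] pr[OF that(2)] that u r_in
    by (simp add: lex_arc loopG)
  ultimately have raut: "automorphism D r" unfolding automorphism_def by blast
  have prn: "(p ^^ n) (u, d) = (u, (r ^^ n) d) \<and> (r ^^ n) d \<in> pverts D" if "d \<in> pverts D" for d n
    using that by (induction n) (auto simp: pr r_in)
  have "(r ^^ q) d = d" for d
  proof (cases "d \<in> pverts D")
    case True
    then show ?thesis using prn[OF True, of q] q by simp
  next
    case False
    then show ?thesis using automorphism_permutes[OF automorphism_funpow[OF raut]] by (simp add: permutes_def)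
  qed
  then have "r ^^ q = id" by (simp add: fun_eq_iff)
  then obtain d where "d \<in> pverts D" "r d = d" using elD raut q unfolding elusive_def by blast
  then show "\<exists>v\<in>?V. p v = v" using pr u by force
qed

end

text \<open>\<open>G\<close> is the outer factor at every stage, so twin-freeness is required of
  \<open>G\<close> alone and not of its powers. The exponent \<open>Suc k\<close> starts the
  induction at the first power.\<close>

lemma elusive_powers:
  fixes G :: "'a pair_pre_digraph"
  assumes G: "pair_graph G" "vertex_transitive G" "twin_free G" "elusive G" and ne: "pverts G \<noteq> {}"
  shows "\<exists>H :: nat pair_pre_digraph. pair_graph H \<and> card (pverts H) = card (pverts G) ^ Suc k \<and>
    vertex_transitive H \<and> elusive H"
proof (induction k)
  case 0
  interpret pair_graph G by (rule G(1))
  obtain f :: "'a \<Rightarrow> nat" where f: "inj_on f (pverts G)"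
    using finite_imp_inj_to_nat_seg[of "pverts G"] by auto
  show ?case using relabel_props[OF G(1) f] G by (intro exI[of _ "relabel f G"]) simp
next
  case (Suc k)
  note elG = G(4)
  from Suc obtain D :: "nat pair_pre_digraph" where D: "pair_graph D" "card (pverts D) = card (pverts G) ^ Suc k"
    "vertex_transitive D" "elusive D" by blast
  interpret pair_graph G by (rule G(1))
  note cardD = D(2) and elD = D(4)
  have "card (pverts D) \<noteq> 0" using D(2) ne by simp
  then have "pverts D \<noteq> {}" by auto
  then interpret lex_product G D by (intro lex_product.intro G D)
  obtain f :: "'a \<times> nat \<Rightarrow> nat" where f: "inj_on f (pverts (lex G D))"
    using finite_imp_inj_to_nat_seg[of "pverts (lex G D)"] by auto
  show ?case
    using relabel_props[OF pair_graph_lex f] vertex_transitive_lex elusive_lex[OF elG elD] cardD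
    by (intro exI[of _ "relabel f (lex G D)"]) (simp add: card_cartesian_product)
qed

section \<open>The tables\<close>

text \<open>The underlying geometry has 126 points \<open>0, \<dots>, 125\<close> and 336 lines of three points; it is the geometry of
  \<open>PSU(3,3)\<close> on one orbit of projective points of its six-dimensional representation over the field with seven
  elements. Row \<open>i\<close> lists the eight lines through \<open>i\<close>: the entry \<open>(j, k, p, q, c)\<close> is the line \<open>{i, j, k}\<close> together
  with the equation \<open>x + p * y + q * z = c\<close> modulo 7 of its preimage in the sevenfold cover, normalised so
  that the coefficient at \<open>i\<close> is 1.\<close>

definition line_table :: "(int \<times> int \<times> int \<times> int \<times> int) list list" where
  "line_table = [
    [(9,50,2,4,0), (10,102,1,6,6), (16,33,6,1,6), (22,43,1,1,0), (44,66,4,6,3), (62,92,4,5,1),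
    (80,90,6,1,0), (108,123,1,1,5)], [(10,51,2,4,0), (11,103,1,6,6), (17,34,6,1,6),
    (23,44,1,1,0), (45,67,4,6,3), (56,93,4,5,6), (81,84,6,1,4), (109,124,1,1,5)], [(11,52,2,4,0),
    (12,104,1,6,6), (18,28,6,1,0), (24,45,1,1,0), (46,68,4,6,3), (57,94,4,5,6), (82,85,6,1,4),
    (110,125,1,1,5)], [(12,53,2,4,0), (13,98,1,6,0), (19,29,6,1,0), (25,46,1,1,0), (47,69,4,6,3),
    (58,95,4,5,6), (83,86,6,1,4), (111,119,1,1,3)], [(7,99,1,6,0), (13,54,2,4,0), (20,30,6,1,0),
    (26,47,1,1,0), (48,63,4,6,3), (59,96,4,5,6), (77,87,6,1,1), (105,120,1,1,6)], [(7,55,2,4,0),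
    (8,100,1,6,0), (14,31,6,1,0), (27,48,1,1,0), (42,64,4,6,4), (60,97,4,5,6), (78,88,6,1,1),
    (106,121,1,1,6)], [(8,49,2,4,1), (9,101,1,6,0), (15,32,6,1,0), (21,42,1,1,1), (43,65,4,6,4),
    (61,91,4,5,2), (79,89,6,1,1), (107,122,1,1,6)], [(15,64,2,4,0), (24,48,6,3,3), (29,61,3,6,0),
    (47,97,6,1,3), (55,5,2,4,0), (77,84,1,1,0), (99,4,6,1,0), (109,125,1,5,0)], [(16,65,2,4,0),
    (25,42,6,3,2), (30,62,3,6,0), (48,91,6,1,5), (49,6,2,4,4), (78,85,1,1,0), (100,5,6,1,0),
    (110,119,1,5,4)], [(17,66,2,4,0), (26,43,6,3,2), (31,56,3,6,4), (42,92,6,1,3), (50,0,2,4,0),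
    (79,86,1,1,0), (101,6,6,1,0), (111,120,1,5,4)], [(18,67,2,4,0), (27,44,6,3,2), (32,57,3,6,4),
    (43,93,6,1,3), (51,1,2,4,0), (80,87,1,1,0), (102,0,6,1,6), (105,121,1,5,0)], [(19,68,2,4,0),
    (21,45,6,3,3), (33,58,3,6,4), (44,94,6,1,3), (52,2,2,4,0), (81,88,1,1,0), (103,1,6,1,6),
    (106,122,1,5,0)], [(20,69,2,4,0), (22,46,6,3,3), (34,59,3,6,4), (45,95,6,1,3), (53,3,2,4,0),
    (82,89,1,1,0), (104,2,6,1,6), (107,123,1,5,0)], [(14,63,2,4,0), (23,47,6,3,3), (28,60,3,6,0),
    (46,96,6,1,3), (54,4,2,4,0), (83,90,1,1,0), (98,3,6,1,0), (108,124,1,5,0)], [(31,5,6,6,0),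
    (33,81,3,6,0), (40,60,5,4,0), (48,54,1,6,0), (58,88,1,1,4), (63,13,2,4,0), (72,116,1,6,3),
    (92,124,1,1,4)], [(32,6,6,6,0), (34,82,3,6,0), (41,61,5,4,0), (42,55,1,6,2), (59,89,1,1,4),
    (64,7,2,4,0), (73,117,1,6,3), (93,125,1,1,4)], [(28,83,3,6,3), (33,0,6,6,1), (35,62,5,4,2),
    (43,49,1,6,0), (60,90,1,1,4), (65,8,2,4,0), (74,118,1,6,3), (94,119,1,1,2)], [(29,77,3,6,0),
    (34,1,6,6,1), (36,56,5,4,0), (44,50,1,6,0), (61,84,1,1,1), (66,9,2,4,0), (75,112,1,6,1),
    (95,120,1,1,2)], [(28,2,6,6,0), (30,78,3,6,0), (37,57,5,4,0), (45,51,1,6,0), (62,85,1,1,1),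
    (67,10,2,4,0), (76,113,1,6,1), (96,121,1,1,2)], [(29,3,6,6,0), (31,79,3,6,0), (38,58,5,4,0),
    (46,52,1,6,0), (56,86,1,1,4), (68,11,2,4,0), (70,114,1,6,3), (97,122,1,1,2)], [(30,4,6,6,0),
    (32,80,3,6,0), (39,59,5,4,0), (47,53,1,6,0), (57,87,1,1,4), (69,12,2,4,0), (71,115,1,6,3),
    (91,123,1,1,4)], [(24,52,3,2,0), (25,49,5,3,5), (32,55,6,1,1), (33,53,3,6,6), (42,6,1,1,1),
    (45,11,4,6,4), (67,103,1,6,6), (92,101,1,1,1)], [(25,53,3,2,0), (26,50,5,3,5), (33,49,6,1,3),
    (34,54,3,6,6), (43,0,1,1,0), (46,12,4,6,4), (68,104,1,6,6), (93,102,1,1,1)], [(26,54,3,2,0),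
    (27,51,5,3,5), (28,55,3,6,2), (34,50,6,1,3), (44,1,1,1,0), (47,13,4,6,4), (69,98,1,6,0),
    (94,103,1,1,1)], [(27,55,3,2,0), (28,51,6,1,2), (29,49,3,6,0), (45,2,1,1,0), (48,7,4,6,4),
    (52,21,3,5,0), (63,99,1,6,0), (95,104,1,1,1)], [(29,52,6,1,2), (30,50,3,6,0), (42,8,4,6,5),
    (46,3,1,1,0), (49,21,2,3,1), (53,22,3,5,0), (64,100,1,6,0), (96,98,1,1,0)], [(30,53,6,1,2),
    (31,51,3,6,0), (43,9,4,6,5), (47,4,1,1,0), (50,22,2,3,1), (54,23,3,5,0), (65,101,1,6,0),
    (97,99,1,1,0)], [(31,54,6,1,2), (32,52,3,6,0), (44,10,4,6,5), (48,5,1,1,0), (51,23,2,3,1),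
    (55,24,3,5,0), (66,102,1,6,0), (91,100,1,1,2)], [(2,18,1,6,0), (37,94,5,2,0), (40,63,1,1,1),
    (51,24,6,6,5), (55,23,2,5,3), (60,13,2,5,0), (62,82,1,1,0), (83,16,2,5,1)], [(3,19,1,6,0),
    (38,95,5,2,0), (41,64,1,1,1), (49,24,2,5,0), (52,25,6,6,5), (56,83,1,1,3), (61,7,2,5,0),
    (77,17,2,5,0)], [(4,20,1,6,0), (35,65,1,1,0), (39,96,5,2,0), (50,25,2,5,0), (53,26,6,6,5),
    (57,77,1,1,6), (62,8,2,5,0), (78,18,2,5,0)], [(5,14,1,6,0), (36,66,1,1,0), (40,97,5,2,0),
    (51,26,2,5,0), (54,27,6,6,5), (56,9,2,5,6), (58,78,1,1,6), (79,19,2,5,0)], [(6,15,1,6,0),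
    (37,67,1,1,0), (41,91,5,2,4), (52,27,2,5,0), (55,21,6,6,6), (57,10,2,5,6), (59,79,1,1,6),
    (80,20,2,5,0)], [(0,16,1,6,6), (35,92,5,2,6), (38,68,1,1,0), (49,22,6,6,4), (53,21,2,5,2),
    (58,11,2,5,6), (60,80,1,1,6), (81,14,2,5,0)], [(1,17,1,6,6), (36,93,5,2,6), (39,69,1,1,0),
    (50,23,6,6,4), (54,22,2,5,2), (59,12,2,5,6), (61,81,1,1,6), (82,15,2,5,0)], [(53,101,1,1,5),
    (62,16,5,3,6), (65,30,1,1,0), (77,125,6,5,2), (81,124,1,1,6), (82,83,2,3,6), (84,109,1,6,6),
    (92,33,6,3,4)], [(54,102,1,1,5), (56,17,5,3,0), (66,31,1,1,0), (77,83,3,2,1), (78,119,6,5,6),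
    (82,125,1,1,6), (85,110,1,6,6), (93,34,6,3,4)], [(55,103,1,1,5), (57,18,5,3,0),
    (67,32,1,1,0), (77,78,2,3,0), (79,120,6,5,6), (83,119,1,1,4), (86,111,1,6,6), (94,28,6,3,0)],
    [(49,104,1,1,0), (58,19,5,3,0), (68,33,1,1,0), (77,120,1,1,0), (78,79,2,3,0), (80,121,6,5,6),
    (87,105,1,6,3), (95,29,6,3,0)], [(50,98,1,1,6), (59,20,5,3,0), (69,34,1,1,0), (78,121,1,1,0),
    (79,80,2,3,0), (81,122,6,5,6), (88,106,1,6,3), (96,30,6,3,0)], [(51,99,1,1,6), (60,14,5,3,0),
    (63,28,1,1,1), (79,122,1,1,0), (80,81,2,3,0), (82,123,6,5,6), (89,107,1,6,3), (97,31,6,3,0)],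
    [(52,100,1,1,6), (61,15,5,3,0), (64,29,1,1,1), (80,123,1,1,0), (81,82,2,3,0), (83,124,6,5,6),
    (90,108,1,6,3), (91,32,6,3,5)], [(6,21,1,1,1), (8,25,5,2,3), (50,62,2,5,6), (55,15,6,1,2),
    (64,5,5,2,1), (92,9,6,6,4), (106,113,5,2,0), (111,117,1,1,2)], [(0,22,1,1,0), (9,26,5,2,3),
    (49,16,6,1,0), (51,56,2,5,0), (65,6,5,2,1), (93,10,6,6,4), (105,118,1,1,5), (107,114,5,2,0)],
    [(1,23,1,1,0), (10,27,5,2,3), (50,17,6,1,0), (52,57,2,5,0), (66,0,5,2,6), (94,11,6,6,4),
    (106,112,1,1,0), (108,115,5,2,0)], [(2,24,1,1,0), (11,21,5,2,1), (51,18,6,1,0),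
    (53,58,2,5,0), (67,1,5,2,6), (95,12,6,6,4), (107,113,1,1,0), (109,116,5,2,0)], [(3,25,1,1,0),
    (12,22,5,2,1), (52,19,6,1,0), (54,59,2,5,0), (68,2,5,2,6), (96,13,6,6,4), (108,114,1,1,0),
    (110,117,5,2,0)], [(4,26,1,1,0), (13,23,5,2,1), (53,20,6,1,0), (55,60,2,5,0), (69,3,5,2,6),
    (97,7,6,6,4), (109,115,1,1,0), (111,118,5,2,0)], [(5,27,1,1,0), (7,24,5,2,1), (49,61,2,5,4),
    (54,14,6,1,0), (63,4,5,2,6), (91,8,6,6,2), (105,112,5,2,5), (110,116,1,1,0)], [(6,8,2,4,2),
    (16,43,6,6,0), (21,25,5,4,4), (22,33,1,6,3), (24,29,6,4,0), (61,48,6,4,2), (74,105,1,1,5),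
    (104,38,1,1,0)], [(0,9,2,4,0), (17,44,6,6,0), (22,26,5,4,4), (23,34,1,6,3), (25,30,6,4,0),
    (62,42,6,4,3), (75,106,1,1,5), (98,39,1,1,6)], [(1,10,2,4,0), (18,45,6,6,0), (23,27,5,4,4),
    (24,28,1,6,2), (26,31,6,4,0), (56,43,6,4,0), (76,107,1,1,5), (99,40,1,1,6)], [(2,11,2,4,0),
    (19,46,6,6,0), (21,24,4,5,0), (25,29,1,6,2), (27,32,6,4,0), (57,44,6,4,0), (70,108,1,1,0),
    (100,41,1,1,6)], [(3,12,2,4,0), (20,47,6,6,0), (21,33,6,4,1), (22,25,4,5,0), (26,30,1,6,2),
    (58,45,6,4,0), (71,109,1,1,0), (101,35,1,1,5)], [(4,13,2,4,0), (14,48,6,6,0), (22,34,6,4,1),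
    (23,26,4,5,0), (27,31,1,6,2), (59,46,6,4,0), (72,110,1,1,0), (102,36,1,1,5)], [(5,7,2,4,0),
    (15,42,6,6,5), (21,32,1,6,1), (23,28,6,4,5), (24,27,4,5,0), (60,47,6,4,0), (73,111,1,1,0),
    (103,37,1,1,5)], [(9,31,6,4,3), (17,36,2,3,0), (43,51,3,6,0), (64,124,6,5,3), (76,114,1,1,4),
    (83,29,1,1,3), (86,19,1,1,4), (93,1,3,2,5)], [(10,32,6,4,3), (18,37,2,3,0), (44,52,3,6,0),
    (65,125,6,5,3), (70,115,1,1,6), (77,30,1,1,6), (87,20,1,1,4), (94,2,3,2,5)], [(11,33,6,4,3),
    (19,38,2,3,0), (45,53,3,6,0), (66,119,6,5,0), (71,116,1,1,6), (78,31,1,1,6), (88,14,1,1,4),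
    (95,3,3,2,5)], [(12,34,6,4,3), (20,39,2,3,0), (46,54,3,6,0), (67,120,6,5,0), (72,117,1,1,6),
    (79,32,1,1,6), (89,15,1,1,4), (96,4,3,2,5)], [(13,28,6,4,0), (14,40,2,3,0), (47,55,3,6,0),
    (68,121,6,5,0), (73,118,1,1,6), (80,33,1,1,6), (90,16,1,1,4), (97,5,3,2,5)], [(7,29,6,4,0),
    (15,41,2,3,0), (48,49,3,6,5), (69,122,6,5,0), (74,112,1,1,1), (81,34,1,1,6), (84,17,1,1,1),
    (91,6,3,2,4)], [(8,30,6,4,0), (16,35,2,3,4), (42,50,3,6,4), (63,123,6,5,0), (75,113,1,1,1),
    (82,28,1,1,0), (85,18,1,1,1), (92,0,3,2,2)], [(4,48,6,3,4), (13,14,2,4,0), (28,40,1,1,1),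
    (75,95,1,6,0), (92,108,3,5,0), (99,24,6,1,0), (112,120,1,1,0), (123,62,2,6,0)],
    [(5,42,6,3,3), (7,15,2,4,0), (29,41,1,1,1), (76,96,1,6,0), (93,109,3,5,0), (100,25,6,1,0),
    (113,121,1,1,0), (124,56,2,6,4)], [(6,43,6,3,3), (8,16,2,4,0), (30,35,1,1,0), (70,97,1,6,2),
    (94,110,3,5,0), (101,26,6,1,0), (114,122,1,1,0), (125,57,2,6,4)], [(0,44,6,3,4),
    (9,17,2,4,0), (31,36,1,1,0), (71,91,1,6,0), (95,111,3,5,0), (102,27,6,1,0), (115,123,1,1,0),
    (119,58,2,6,0)], [(1,45,6,3,4), (10,18,2,4,0), (32,37,1,1,0), (72,92,1,6,0), (96,105,3,5,1),
    (103,21,6,1,6), (116,124,1,1,0), (120,59,2,6,0)], [(2,46,6,3,4), (11,19,2,4,0),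
    (33,38,1,1,0), (73,93,1,6,0), (97,106,3,5,1), (104,22,6,1,6), (117,125,1,1,0),
    (121,60,2,6,0)], [(3,47,6,3,4), (12,20,2,4,0), (34,39,1,1,0), (74,94,1,6,0), (91,107,3,5,0),
    (98,23,6,1,0), (118,119,1,1,5), (122,61,2,6,0)], [(71,87,1,6,0), (76,86,1,6,5),
    (90,100,1,6,2), (97,65,6,1,2), (99,101,1,1,0), (108,52,1,1,0), (114,19,6,1,3),
    (115,57,1,1,6)], [(72,88,1,6,0), (84,101,1,6,6), (87,70,6,1,0), (91,66,6,1,0),
    (100,102,1,1,0), (109,53,1,1,0), (115,20,6,1,3), (116,58,1,1,6)], [(73,89,1,6,0),
    (85,102,1,6,6), (88,71,6,1,0), (92,67,6,1,0), (101,103,1,1,0), (110,54,1,1,0),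
    (116,14,6,1,3), (117,59,1,1,6)], [(74,90,1,6,0), (86,103,1,6,6), (89,72,6,1,0),
    (93,68,6,1,0), (102,104,1,1,0), (111,55,1,1,0), (117,15,6,1,3), (118,60,1,1,6)],
    [(75,84,1,6,3), (87,104,1,6,6), (90,73,6,1,0), (94,69,6,1,0), (98,103,1,1,6), (105,49,1,1,5),
    (112,61,1,1,1), (118,16,6,1,3)], [(76,85,1,6,3), (84,74,6,1,3), (88,98,1,6,0), (95,63,6,1,0),
    (99,104,1,1,6), (106,50,1,1,5), (112,17,6,1,1), (113,62,1,1,1)], [(85,75,6,1,3),
    (86,70,6,1,5), (89,99,1,6,0), (96,64,6,1,0), (98,100,1,1,5), (107,51,1,1,5), (113,18,6,1,1),
    (114,56,1,1,4)], [(17,29,6,4,0), (30,57,1,1,6), (78,37,5,4,0), (83,36,3,5,5), (84,7,1,1,0),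
    (87,4,6,6,6), (120,38,1,1,0), (125,35,2,6,5)], [(18,30,6,4,0), (31,58,1,1,6), (37,77,5,3,0),
    (79,38,5,4,0), (85,8,1,1,0), (88,5,6,6,6), (119,36,2,6,1), (121,39,1,1,0)], [(19,31,6,4,0),
    (32,59,1,1,6), (38,78,5,3,0), (80,39,5,4,0), (86,9,1,1,0), (89,6,6,6,6), (120,37,2,6,1),
    (122,40,1,1,0)], [(20,32,6,4,0), (33,60,1,1,6), (39,79,5,3,0), (81,40,5,4,0), (87,10,1,1,0),
    (90,0,6,6,0), (121,38,2,6,1), (123,41,1,1,0)], [(14,33,6,4,0), (34,61,1,1,6), (40,80,5,3,0),
    (82,41,5,4,0), (84,1,6,6,3), (88,11,1,1,0), (122,39,2,6,1), (124,35,1,1,6)], [(15,34,6,4,0),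
    (28,62,1,1,0), (41,81,5,3,0), (83,35,5,4,3), (85,2,6,6,3), (89,12,1,1,0), (123,40,2,6,1),
    (125,36,1,1,6)], [(16,28,6,4,4), (29,56,1,1,3), (35,82,5,3,2), (36,77,4,5,4), (86,3,6,6,3),
    (90,13,1,1,0), (119,37,1,1,4), (124,41,2,6,1)], [(1,81,1,6,4), (7,77,1,1,0), (17,61,1,1,1),
    (74,75,6,6,4), (87,99,1,1,3), (88,103,1,1,0), (101,71,6,1,6), (109,35,6,1,6)], [(2,82,1,6,4),
    (8,78,1,1,0), (18,62,1,1,1), (75,76,6,6,4), (88,100,1,1,3), (89,104,1,1,0), (102,72,6,1,6),
    (110,36,6,1,6)], [(3,83,1,6,4), (9,79,1,1,0), (19,56,1,1,4), (70,76,6,6,2), (89,101,1,1,3),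
    (90,98,1,1,6), (103,73,6,1,6), (111,37,6,1,6)], [(4,77,1,6,1), (10,80,1,1,0), (20,57,1,1,4),
    (70,71,6,6,0), (90,102,1,1,3), (99,84,1,1,3), (104,74,6,1,6), (105,38,6,1,3)], [(5,78,1,6,1),
    (11,81,1,1,0), (14,58,1,1,4), (71,72,6,6,0), (98,75,6,1,0), (100,85,1,1,3), (103,84,1,1,0),
    (106,39,6,1,3)], [(6,79,1,6,1), (12,82,1,1,0), (15,59,1,1,4), (72,73,6,6,0), (99,76,6,1,0),
    (101,86,1,1,3), (104,85,1,1,0), (107,40,6,1,3)], [(0,80,1,6,0), (13,83,1,1,0), (16,60,1,1,4),
    (73,74,6,6,0), (98,86,1,1,6), (100,70,6,1,2), (102,87,1,1,3), (108,41,6,1,3)], [(6,61,3,5,6),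
    (8,48,1,6,5), (32,41,4,6,2), (66,71,6,6,0), (100,27,1,1,2), (107,69,4,5,0), (116,119,1,2,3),
    (123,20,1,1,4)], [(0,62,3,5,3), (9,42,1,6,3), (33,35,4,6,3), (67,72,6,6,0), (101,21,1,1,1),
    (108,63,4,5,0), (117,120,1,2,3), (124,14,1,1,4)], [(1,56,3,5,4), (10,43,1,6,3),
    (34,36,4,6,3), (68,73,6,6,0), (102,22,1,1,1), (109,64,4,5,0), (118,121,1,2,3),
    (125,15,1,1,4)], [(2,57,3,5,4), (11,44,1,6,3), (28,37,4,6,0), (69,74,6,6,0), (103,23,1,1,1),
    (110,65,4,5,0), (112,122,1,2,5), (119,16,1,1,2)], [(3,58,3,5,4), (12,45,1,6,3),
    (29,38,4,6,0), (63,75,6,6,0), (104,24,1,1,1), (111,66,4,5,0), (113,123,1,2,5),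
    (120,17,1,1,2)], [(4,59,3,5,4), (13,46,1,6,3), (30,39,4,6,0), (64,76,6,6,0), (98,25,1,1,0),
    (105,67,4,5,5), (114,124,1,2,5), (121,18,1,1,2)], [(5,60,3,5,4), (7,47,1,6,3), (31,40,4,6,0),
    (65,70,6,6,5), (99,26,1,1,0), (106,68,4,5,5), (115,125,1,2,5), (122,19,1,1,2)],
    [(3,13,6,6,0), (23,69,6,6,0), (25,96,1,1,0), (39,50,1,1,6), (75,88,6,6,0), (86,90,1,1,6),
    (100,76,1,1,5), (103,74,1,1,6)], [(4,7,6,6,0), (24,63,6,6,0), (26,97,1,1,0), (40,51,1,1,6),
    (76,89,6,6,0), (84,87,1,1,3), (101,70,1,1,0), (104,75,1,1,6)], [(5,8,6,6,0), (25,64,6,6,0),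
    (27,91,1,1,2), (41,52,1,1,6), (70,90,6,6,5), (76,98,1,1,5), (85,88,1,1,3), (102,71,1,1,0)],
    [(6,9,6,6,0), (21,92,1,1,1), (26,65,6,6,0), (35,53,1,1,5), (70,99,1,1,0), (71,84,6,6,1),
    (86,89,1,1,3), (103,72,1,1,0)], [(0,10,6,6,1), (22,93,1,1,1), (27,66,6,6,0), (36,54,1,1,5),
    (71,100,1,1,0), (72,85,6,6,1), (87,90,1,1,3), (104,73,1,1,0)], [(1,11,6,6,1), (21,67,6,6,1),
    (23,94,1,1,1), (37,55,1,1,5), (72,101,1,1,0), (73,86,6,6,1), (74,98,1,1,6), (84,88,1,1,0)],
    [(2,12,6,6,1), (22,68,6,6,1), (24,95,1,1,1), (38,49,1,1,0), (73,102,1,1,0), (74,87,6,6,1),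
    (75,99,1,1,6), (85,89,1,1,0)], [(38,87,6,6,4), (49,74,1,1,5), (67,96,3,2,3), (112,48,6,3,1),
    (114,116,5,4,2), (118,43,1,1,5), (120,4,1,1,6), (121,10,5,1,0)], [(39,88,6,6,4),
    (50,75,1,1,5), (68,97,3,2,3), (112,44,1,1,0), (113,42,6,3,0), (115,117,5,4,2), (121,5,1,1,6),
    (122,11,5,1,0)], [(40,89,6,6,4), (51,76,1,1,5), (69,91,3,2,0), (113,45,1,1,0),
    (114,43,6,3,0), (116,118,5,4,2), (122,6,1,1,6), (123,12,5,1,0)], [(41,90,6,6,4),
    (52,70,1,1,0), (63,92,3,2,0), (112,117,4,5,3), (114,46,1,1,0), (115,44,6,3,0), (123,0,1,1,5),
    (124,13,5,1,0)], [(35,84,6,6,1), (53,71,1,1,0), (64,93,3,2,0), (113,118,4,5,3),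
    (115,47,1,1,0), (116,45,6,3,0), (124,1,1,1,5), (125,7,5,1,0)], [(36,85,6,6,1), (54,72,1,1,0),
    (65,94,3,2,0), (112,114,5,4,6), (116,48,1,1,0), (117,46,6,3,0), (119,8,5,1,4),
    (125,2,1,1,5)], [(37,86,6,6,1), (55,73,1,1,0), (66,95,3,2,0), (113,115,5,4,6),
    (117,42,1,1,2), (118,47,6,3,0), (119,3,1,1,3), (120,9,5,1,4)], [(17,75,6,6,6),
    (44,106,1,1,0), (48,105,4,6,6), (61,74,1,1,1), (114,110,5,3,4), (117,108,3,2,6),
    (120,63,1,1,0), (122,94,2,1,5)], [(18,76,6,6,6), (42,106,4,6,0), (45,107,1,1,0),
    (62,75,1,1,1), (115,111,5,3,4), (118,109,3,2,6), (121,64,1,1,0), (123,95,2,1,5)],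
    [(19,70,6,6,4), (43,107,4,6,0), (46,108,1,1,0), (56,76,1,1,4), (110,112,2,3,5),
    (116,105,5,3,6), (122,65,1,1,0), (124,96,2,1,5)], [(20,71,6,6,4), (44,108,4,6,0),
    (47,109,1,1,0), (57,70,1,1,6), (111,113,2,3,5), (117,106,5,3,6), (123,66,1,1,0),
    (125,97,2,1,5)], [(14,72,6,6,4), (45,109,4,6,0), (48,110,1,1,0), (58,71,1,1,6),
    (105,114,2,3,4), (118,107,5,3,6), (119,91,2,1,3), (124,67,1,1,0)], [(15,73,6,6,4),
    (42,111,1,1,2), (46,110,4,6,0), (59,72,1,1,6), (106,115,2,3,4), (108,112,3,5,2),
    (120,92,2,1,3), (125,68,1,1,0)], [(16,74,6,6,4), (43,105,1,1,5), (47,111,4,6,0),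
    (60,73,1,1,6), (107,116,2,3,4), (109,113,3,5,2), (119,69,1,1,5), (121,93,2,1,3)],
    [(3,111,1,1,3), (8,110,3,3,5), (16,94,1,1,2), (36,78,3,4,4), (37,83,1,1,4), (58,66,3,4,0),
    (69,118,1,1,5), (91,116,4,4,5)], [(4,105,1,1,6), (9,111,3,3,5), (17,95,1,1,2), (37,79,3,4,4),
    (38,77,1,1,0), (59,67,3,4,0), (63,112,1,1,0), (92,117,4,4,5)], [(5,106,1,1,6),
    (10,105,3,3,0), (18,96,1,1,2), (38,80,3,4,4), (39,78,1,1,0), (60,68,3,4,0), (64,113,1,1,0),
    (93,118,4,4,5)], [(6,107,1,1,6), (11,106,3,3,0), (19,97,1,1,2), (39,81,3,4,4), (40,79,1,1,0),
    (61,69,3,4,0), (65,114,1,1,0), (94,112,4,4,6)], [(0,108,1,1,5), (12,107,3,3,0),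
    (20,91,1,1,4), (40,82,3,4,4), (41,80,1,1,0), (62,63,3,4,0), (66,115,1,1,0), (95,113,4,4,6)],
    [(1,109,1,1,5), (13,108,3,3,0), (14,92,1,1,4), (35,81,1,1,6), (41,83,3,4,4), (56,64,3,4,2),
    (67,116,1,1,0), (96,114,4,4,6)], [(2,110,1,1,5), (7,109,3,3,0), (15,93,1,1,4), (35,77,3,4,6),
    (36,82,1,1,6), (57,65,3,4,2), (68,117,1,1,0), (97,115,4,4,6)]]"

text \<open>\<open>a\<close> (order 7) and \<open>b\<close> (order 3) generate \<open>PSU(3,3)\<close>, and the involution \<open>o\<close> extends it to \<open>G\<^sub>2(2)\<close>. Slopes and
  shifts describe lifts \<open>(i, x) \<mapsto> (s i, slope i * x + shift i)\<close> of \<open>a\<close> (slope 1) and \<open>b\<close> to the cover; \<open>o\<close> is only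
  used on the 126 points.\<close>

definition a_table :: "int list" where
  "a_table = [
    1, 2, 3, 4, 5, 6, 0, 8, 9, 10, 11, 12, 13, 7, 15, 16, 17, 18, 19, 20, 14, 22, 23, 24, 25, 26,
    27, 21, 29, 30, 31, 32, 33, 34, 28, 36, 37, 38, 39, 40, 41, 35, 43, 44, 45, 46, 47, 48, 42,
    50, 51, 52, 53, 54, 55, 49, 57, 58, 59, 60, 61, 62, 56, 64, 65, 66, 67, 68, 69, 63, 71, 72,
    73, 74, 75, 76, 70, 78, 79, 80, 81, 82, 83, 77, 85, 86, 87, 88, 89, 90, 84, 92, 93, 94, 95,
    96, 97, 91, 99, 100, 101, 102, 103, 104, 98, 106, 107, 108, 109, 110, 111, 105, 113, 114,
    115, 116, 117, 118, 112, 120, 121, 122, 123, 124, 125, 119]"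

definition a_shift_table :: "int list" where
  "a_shift_table = [
    0, 0, 0, 0, 0, 0, 6, 0, 0, 0, 0, 0, 0, 0, 0, 0, 0, 0, 0, 0, 0, 0, 0, 0, 0, 0, 0, 6, 0, 0, 0,
    0, 0, 0, 1, 0, 0, 0, 0, 0, 0, 6, 0, 0, 0, 0, 0, 0, 2, 0, 0, 0, 0, 0, 0, 2, 0, 0, 0, 0, 0, 0,
    3, 0, 0, 0, 0, 0, 0, 0, 0, 0, 0, 0, 0, 0, 2, 0, 0, 0, 0, 0, 0, 3, 0, 0, 0, 0, 0, 0, 4, 0, 0,
    0, 0, 0, 0, 2, 0, 0, 0, 0, 0, 0, 6, 0, 0, 0, 0, 0, 0, 3, 0, 0, 0, 0, 0, 0, 2, 0, 0, 0, 0, 0,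
    0, 5]"

definition b_table :: "int list" where
  "b_table = [
    3, 59, 125, 5, 51, 0, 74, 10, 16, 98, 12, 117, 7, 31, 9, 87, 119, 96, 82, 106, 24, 73, 47,
    54, 93, 60, 23, 22, 36, 121, 28, 50, 104, 111, 4, 37, 30, 85, 113, 63, 17, 38, 90, 69, 46,
    15, 97, 27, 43, 118, 13, 34, 68, 55, 26, 102, 39, 2, 42, 99, 66, 105, 83, 56, 80, 94, 25, 89,
    115, 48, 11, 21, 101, 71, 116, 124, 81, 18, 62, 75, 95, 120, 77, 78, 67, 35, 88, 45, 92, 84,
    58, 49, 86, 20, 110, 64, 40, 44, 14, 1, 33, 103, 53, 72, 109, 107, 108, 61, 19, 32, 65, 100,
    114, 41, 122, 52, 6, 70, 91, 8, 76, 123, 112, 29, 79, 57]"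

definition b_slope_table :: "int list" where
  "b_slope_table = [
    1, 5, 6, 2, 4, 4, 5, 1, 3, 5, 4, 5, 2, 2, 5, 2, 6, 3, 1, 5, 3, 5, 2, 2, 6, 4, 5, 4, 6, 2, 3,
    1, 2, 1, 6, 2, 2, 2, 3, 1, 2, 3, 2, 6, 4, 6, 6, 1, 4, 1, 4, 5, 3, 2, 5, 5, 2, 3, 2, 2, 5, 6,
    3, 4, 4, 5, 6, 2, 2, 5, 5, 2, 2, 5, 5, 5, 5, 4, 6, 2, 4, 6, 2, 2, 2, 2, 2, 3, 5, 2, 2, 4, 5,
    2, 2, 4, 6, 5, 2, 5, 3, 2, 5, 2, 5, 4, 4, 5, 6, 5, 5, 5, 4, 4, 6, 6, 2, 2, 2, 2, 4, 4, 5, 1,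
    5, 2]"

definition b_shift_table :: "int list" where
  "b_shift_table = [
    3, 3, 2, 1, 2, 5, 1, 1, 3, 3, 3, 0, 3, 2, 5, 6, 4, 1, 0, 6, 3, 1, 4, 4, 6, 2, 4, 2, 4, 6, 3,
    5, 1, 4, 2, 0, 3, 2, 3, 3, 6, 1, 0, 2, 5, 3, 5, 6, 0, 6, 0, 6, 5, 0, 3, 0, 6, 2, 6, 6, 1, 4,
    2, 0, 0, 2, 3, 4, 2, 1, 4, 6, 4, 6, 6, 3, 4, 2, 4, 1, 4, 6, 0, 3, 4, 5, 2, 4, 5, 4, 1, 4, 2,
    6, 0, 5, 2, 6, 3, 4, 4, 2, 5, 1, 3, 5, 0, 6, 2, 5, 1, 1, 2, 3, 2, 0, 5, 6, 2, 1, 2, 4, 6, 1,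
    1, 5]"

definition o_table :: "int list" where
  "o_table = [
    0, 112, 2, 78, 64, 47, 101, 7, 53, 9, 108, 94, 85, 121, 118, 99, 33, 17, 46, 37, 100, 65, 62,
    106, 125, 30, 42, 115, 68, 77, 25, 111, 70, 16, 75, 49, 95, 19, 83, 98, 73, 87, 26, 92, 44,
    110, 18, 5, 109, 35, 50, 117, 57, 8, 113, 97, 120, 52, 119, 76, 60, 84, 22, 93, 4, 21, 66,
    114, 28, 88, 32, 91, 107, 40, 81, 34, 59, 29, 3, 86, 90, 74, 104, 38, 61, 12, 79, 41, 69, 89,
    80, 71, 43, 63, 11, 36, 96, 55, 39, 15, 20, 6, 123, 122, 82, 124, 23, 72, 10, 48, 45, 31, 1,
    54, 67, 27, 116, 51, 14, 58, 56, 13, 103, 102, 105, 24]"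

text \<open>The functions \<open>f\<close> with \<open>f i + p * f j + q * f k = 0\<close> on all lines form a six-dimensional space. Row \<open>i\<close> of
  \<open>co_table\<close> expresses \<open>f i\<close> through the values of \<open>f\<close> at 0, 9, 10, 11, 1, 3. Row \<open>i\<close> of \<open>seed_table\<close> does the same, for
  \<open>f\<close> vanishing at these six points, through the values at 23, 22, 19, 111, 60, 5, 70, 52.\<close>

definition co_table :: "int list list" where
  "co_table = [
    [1,0,0,0,0,0], [0,0,0,0,1,0], [2,6,6,4,6,0], [0,0,0,0,0,1], [5,3,5,6,6,4], [0,1,3,1,1,0],
    [6,4,0,3,0,2], [3,2,2,0,3,1], [4,0,4,6,6,4], [0,1,0,0,0,0], [0,0,1,0,0,0], [0,0,0,1,0,0],
    [4,5,0,3,1,2], [3,6,0,4,4,0], [0,1,3,3,1,6], [2,4,2,3,3,2], [0,4,4,0,0,0], [0,0,4,4,0,0],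
    [2,6,0,2,4,1], [0,2,0,0,6,1], [3,4,1,2,0,4], [1,3,2,2,3,4], [6,5,6,2,3,6], [2,4,4,4,6,0],
    [0,0,5,5,0,1], [4,0,5,5,4,0], [0,0,3,1,5,3], [1,2,3,2,0,0], [0,0,1,5,5,1], [0,2,0,0,6,0],
    [5,1,3,3,1,0], [0,0,0,2,0,6], [3,0,2,0,3,0], [6,4,4,0,0,0], [0,0,4,4,6,0], [3,1,0,2,4,1],
    [0,2,2,0,0,1], [5,3,0,1,6,4], [1,4,3,2,3,4], [6,5,0,3,3,6], [6,2,4,1,0,2], [0,4,5,5,5,3],
    [0,0,5,2,4,1], [0,2,1,5,4,1], [5,3,3,3,0,0], [5,1,3,5,1,6], [3,0,2,2,3,6], [2,4,6,0,3,0],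
    [6,4,1,4,6,0], [0,6,5,5,4,1], [5,3,0,0,0,0], [0,0,3,0,5,0], [3,2,2,2,2,0], [5,1,0,2,3,4],
    [6,5,4,0,0,6], [2,4,0,5,0,3], [0,1,0,6,0,4], [2,0,0,0,2,0], [4,5,5,1,0,0], [4,5,5,1,5,2],
    [3,6,3,5,5,3], [3,1,2,0,0,1], [5,3,6,1,2,4], [1,5,2,1,2,4], [0,1,2,2,3,4], [6,5,4,2,2,6],
    [0,5,5,5,0,0], [6,4,5,6,5,3], [0,6,0,5,4,3], [1,2,3,0,5,1], [0,4,0,5,5,0], [2,6,6,0,0,3],
    [1,2,0,3,6,5], [0,3,0,0,0,5], [4,1,0,2,2,6], [0,5,1,1,5,0], [0,0,0,3,3,2], [0,6,4,4,4,0],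
    [3,2,2,4,0,1], [0,2,0,6,6,5], [5,4,0,2,2,4], [4,6,1,3,1,6], [2,4,0,1,0,2], [0,4,0,1,1,3],
    [4,6,1,3,0,6], [0,5,1,4,1,2], [0,4,0,1,1,2], [2,3,6,5,5,3], [3,1,6,3,6,1], [1,5,0,3,6,3],
    [4,4,0,2,2,4], [2,4,4,5,0,3], [0,6,5,2,4,1], [0,2,0,5,4,1], [5,3,3,2,0,0], [1,3,3,2,0,4],
    [0,1,2,5,6,6], [6,2,4,0,0,6], [3,6,0,4,4,1], [1,5,0,6,2,5], [4,1,0,0,0,4], [6,5,0,3,0,2],
    [1,0,1,0,0,0], [0,0,0,1,1,0], [6,4,6,0,0,2], [3,0,2,0,1,0], [2,6,6,6,2,0], [0,0,4,4,6,5],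
    [4,1,5,0,0,0], [0,0,1,5,4,0], [0,0,3,4,1,3], [5,0,0,2,0,6], [0,5,5,5,5,0], [2,6,0,5,0,3],
    [0,6,0,5,4,1], [5,3,0,2,0,0], [1,3,3,6,0,4], [2,0,2,3,3,0], [4,5,4,2,2,6], [2,0,0,5,0,0],
    [6,4,0,1,0,3], [5,0,5,0,4,0], [1,3,3,0,1,0], [2,6,2,0,0,0], [0,0,6,2,2,0], [5,1,5,6,0,4]]"

definition seed_table :: "int list list" where
  "seed_table = [
    [0,0,0,0,0,0,0,0], [0,0,0,0,0,0,0,0], [0,0,0,0,0,0,0,3], [0,0,0,0,0,0,0,0],
    [0,0,3,3,6,0,0,0], [0,0,0,0,0,1,0,0], [0,4,0,0,2,4,6,0], [0,5,1,2,0,3,0,0],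
    [6,0,0,3,6,6,1,0], [0,0,0,0,0,0,0,0], [0,0,0,0,0,0,0,0], [0,0,0,0,0,0,0,0],
    [0,1,3,0,0,0,0,4], [1,6,4,1,1,0,0,0], [0,1,0,0,0,1,0,0], [2,1,0,0,1,2,3,3],
    [1,0,0,4,0,0,0,0], [1,0,0,0,0,0,0,0], [2,5,1,2,0,0,0,3], [0,0,1,0,0,0,0,0],
    [0,5,1,5,5,0,0,5], [1,6,4,1,0,0,0,5], [0,1,0,0,0,0,0,0], [1,0,0,0,0,0,0,0],
    [2,5,1,2,0,0,0,0], [0,0,1,0,0,0,0,6], [0,4,0,0,0,0,0,0], [4,0,0,0,0,0,0,0],
    [2,5,1,2,0,0,0,0], [0,0,1,0,0,0,0,0], [0,0,2,0,0,0,0,5], [0,1,0,0,0,0,0,0],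
    [1,0,0,0,0,0,0,5], [1,0,0,4,0,0,0,0], [1,0,0,0,0,0,0,0], [0,0,5,0,5,3,1,2],
    [4,6,0,0,0,0,0,0], [0,3,1,1,0,0,0,0], [6,0,4,3,0,0,0,0], [6,1,3,6,6,0,0,0],
    [0,4,0,0,2,4,0,0], [1,0,0,4,1,0,6,6], [5,0,3,6,6,5,4,4], [0,6,0,0,0,0,0,0],
    [6,0,0,0,0,0,0,0], [5,2,6,5,0,0,0,4], [0,0,6,0,0,0,0,1], [0,5,1,2,2,0,0,0],
    [3,0,0,0,0,6,0,0], [1,6,0,4,0,0,0,0], [0,0,0,0,0,0,0,0], [0,0,0,0,0,0,0,0],
    [0,0,0,0,0,0,0,1], [0,3,2,0,0,0,0,5], [3,1,0,0,0,0,0,0], [0,1,3,6,0,0,0,0],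
    [0,3,0,0,0,0,0,0], [3,0,0,0,0,0,0,1], [3,0,0,5,0,0,0,0], [6,1,3,0,0,0,0,2],
    [0,0,0,0,1,0,0,0], [3,6,0,2,0,6,0,0], [6,0,5,3,3,6,2,2], [6,0,5,3,3,6,0,0],
    [6,0,5,3,3,0,2,2], [0,0,0,0,2,4,6,0], [3,0,0,0,0,0,0,0], [6,1,3,6,0,0,0,2],
    [0,0,3,0,0,0,0,0], [0,6,4,1,1,0,0,0], [0,0,0,0,0,0,1,0], [1,0,0,4,1,0,6,0],
    [0,3,0,0,5,3,1,0], [0,6,4,0,0,0,0,0], [6,1,3,6,6,0,0,0], [0,0,2,0,4,1,0,0],
    [0,4,6,0,0,0,6,0], [1,0,3,0,0,0,0,0], [4,6,0,2,0,0,0,0], [0,3,1,0,0,0,0,0],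
    [6,0,0,3,6,0,0,0], [3,1,0,5,0,1,0,0], [0,4,0,0,2,4,6,3], [0,4,6,0,0,0,0,0],
    [3,1,0,5,0,1,0,0], [0,4,0,0,2,4,6,0], [0,4,6,0,0,0,0,0], [1,0,0,4,1,0,0,0],
    [4,6,0,2,0,6,0,0], [0,2,4,0,5,3,1,0], [6,0,0,3,6,0,0,0], [4,0,0,4,1,0,6,0],
    [5,0,3,6,6,5,4,4], [0,6,0,0,0,0,0,0], [6,0,0,0,0,0,0,0], [6,0,0,3,0,0,0,0],
    [6,4,4,3,3,0,1,2], [0,0,0,0,2,4,0,0], [1,6,4,1,1,0,0,0], [0,3,0,0,5,3,0,0],
    [6,0,0,3,6,0,1,0], [0,4,0,0,2,4,6,0], [0,0,0,0,0,0,0,0], [0,0,0,0,0,0,0,0],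
    [0,1,3,0,0,0,0,0], [0,0,4,0,1,0,0,0], [0,0,5,0,3,6,0,0], [0,3,1,0,0,0,1,0],
    [0,0,0,0,0,0,6,6], [3,2,6,5,5,0,1,1], [2,0,0,0,1,2,3,0], [0,0,0,1,0,0,0,0],
    [1,0,2,0,4,1,0,0], [1,0,0,4,0,0,5,5], [0,0,1,0,0,0,1,0], [4,0,0,0,0,0,6,6],
    [3,0,0,5,6,0,1,0], [2,0,4,0,1,2,3,3], [0,1,3,0,6,0,0,0], [0,0,0,6,0,0,0,0],
    [0,0,0,4,0,0,0,0], [0,0,2,0,4,0,0,0], [0,0,6,0,5,3,0,0], [0,0,0,0,0,0,1,1],
    [4,5,1,2,2,0,6,6], [5,0,0,0,6,5,4,4]]"

section \<open>Rewrite rules for table lookup and for arithmetic modulo 7\<close>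

definition row :: "'a list \<Rightarrow> int \<Rightarrow> 'a" where "row T i = T ! nat i"

fun rows_from :: "(int \<Rightarrow> 'a) \<Rightarrow> int \<Rightarrow> 'a list \<Rightarrow> bool" where
  "rows_from f i [] = True"
| "rows_from f i (x # xs) = (f i = x \<and> rows_from f (i + 1) xs)"

lemma rows_from_iff: "rows_from f i xs \<longleftrightarrow> (\<forall>k<length xs. f (i + int k) = xs ! k)"
proof (induction xs arbitrary: i)
  case (Cons x xs)
  have "(\<forall>k<length (x # xs). f (i + int k) = (x # xs) ! k) \<longleftrightarrow>
      f i = x \<and> (\<forall>k<length xs. f (i + 1 + int k) = xs ! k)"
    by (auto simp: less_Suc_eq_0_disj algebra_simps)
  with Cons show ?case by simp
qed simp

lemma rows_from_row: "T = xs \<Longrightarrow> rows_from (row T) 0 xs"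
  by (simp add: rows_from_iff row_def)

text \<open>Rewriting a table lookup by one equation per row keeps the ground computations below fast.\<close>

lemmas rows_eval = rows_from.simps add_numeral_special add_num_simps arith_simps numeral_plus_one
  one_plus_numeral one_add_one simp_thms add_0_left

lemmas lns_eval = rows_from_row[OF line_table_def, simplified rows_eval]
lemmas a_eval = rows_from_row[OF a_table_def, simplified rows_eval]
lemmas a_shift_eval = rows_from_row[OF a_shift_table_def, simplified rows_eval]
lemmas b_eval = rows_from_row[OF b_table_def, simplified rows_eval]
lemmas b_slope_eval = rows_from_row[OF b_slope_table_def, simplified rows_eval]
lemmas b_shift_eval = rows_from_row[OF b_shift_table_def, simplified rows_eval]
lemmas o_eval = rows_from_row[OF o_table_def, simplified rows_eval]
lemmas co_eval = rows_from_row[OF co_table_def, simplified rows_eval]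
lemmas seed_eval = rows_from_row[OF seed_table_def, simplified rows_eval]

definition pts :: "int list" where "pts = [0..125]"

lemma pts_eval:
  "pts = [
    0, 1, 2, 3, 4, 5, 6, 7, 8, 9, 10, 11, 12, 13, 14, 15, 16, 17, 18, 19, 20, 21, 22, 23, 24, 25,
    26, 27, 28, 29, 30, 31, 32, 33, 34, 35, 36, 37, 38, 39, 40, 41, 42, 43, 44, 45, 46, 47, 48,
    49, 50, 51, 52, 53, 54, 55, 56, 57, 58, 59, 60, 61, 62, 63, 64, 65, 66, 67, 68, 69, 70, 71,
    72, 73, 74, 75, 76, 77, 78, 79, 80, 81, 82, 83, 84, 85, 86, 87, 88, 89, 90, 91, 92, 93, 94,
    95, 96, 97, 98, 99, 100, 101, 102, 103, 104, 105, 106, 107, 108, 109, 110, 111, 112, 113,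
    114, 115, 116, 117, 118, 119, 120, 121, 122, 123, 124, 125]"
  by (simp add: pts_def upto_rec1)

text \<open>All 49 values of each operation become rewrite rules, so that ground computations stay
  among the representatives 0, ..., 6.\<close>

definition mul7 :: "int \<Rightarrow> int \<Rightarrow> int" where "mul7 a b = a * b mod 7"
definition add7 :: "int \<Rightarrow> int \<Rightarrow> int" where "add7 a b = (a + b) mod 7"

lemma mul7_eval:
    "mul7 0 0 = 0" "mul7 0 1 = 0" "mul7 0 2 = 0" "mul7 0 3 = 0" "mul7 0 4 = 0" "mul7 0 5 = 0" "mul7 0 6 = 0"
    "mul7 1 0 = 0" "mul7 1 1 = 1" "mul7 1 2 = 2" "mul7 1 3 = 3" "mul7 1 4 = 4" "mul7 1 5 = 5" "mul7 1 6 = 6"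
    "mul7 2 0 = 0" "mul7 2 1 = 2" "mul7 2 2 = 4" "mul7 2 3 = 6" "mul7 2 4 = 1" "mul7 2 5 = 3" "mul7 2 6 = 5"
    "mul7 3 0 = 0" "mul7 3 1 = 3" "mul7 3 2 = 6" "mul7 3 3 = 2" "mul7 3 4 = 5" "mul7 3 5 = 1" "mul7 3 6 = 4"
    "mul7 4 0 = 0" "mul7 4 1 = 4" "mul7 4 2 = 1" "mul7 4 3 = 5" "mul7 4 4 = 2" "mul7 4 5 = 6" "mul7 4 6 = 3"
    "mul7 5 0 = 0" "mul7 5 1 = 5" "mul7 5 2 = 3" "mul7 5 3 = 1" "mul7 5 4 = 6" "mul7 5 5 = 4" "mul7 5 6 = 2"
    "mul7 6 0 = 0" "mul7 6 1 = 6" "mul7 6 2 = 5" "mul7 6 3 = 4" "mul7 6 4 = 3" "mul7 6 5 = 2" "mul7 6 6 = 1"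
  by (simp_all add: mul7_def)

lemma add7_eval:
    "add7 0 0 = 0" "add7 0 1 = 1" "add7 0 2 = 2" "add7 0 3 = 3" "add7 0 4 = 4" "add7 0 5 = 5" "add7 0 6 = 6"
    "add7 1 0 = 1" "add7 1 1 = 2" "add7 1 2 = 3" "add7 1 3 = 4" "add7 1 4 = 5" "add7 1 5 = 6" "add7 1 6 = 0"
    "add7 2 0 = 2" "add7 2 1 = 3" "add7 2 2 = 4" "add7 2 3 = 5" "add7 2 4 = 6" "add7 2 5 = 0" "add7 2 6 = 1"
    "add7 3 0 = 3" "add7 3 1 = 4" "add7 3 2 = 5" "add7 3 3 = 6" "add7 3 4 = 0" "add7 3 5 = 1" "add7 3 6 = 2"
    "add7 4 0 = 4" "add7 4 1 = 5" "add7 4 2 = 6" "add7 4 3 = 0" "add7 4 4 = 1" "add7 4 5 = 2" "add7 4 6 = 3"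
    "add7 5 0 = 5" "add7 5 1 = 6" "add7 5 2 = 0" "add7 5 3 = 1" "add7 5 4 = 2" "add7 5 5 = 3" "add7 5 6 = 4"
    "add7 6 0 = 6" "add7 6 1 = 0" "add7 6 2 = 1" "add7 6 3 = 2" "add7 6 4 = 3" "add7 6 5 = 4" "add7 6 6 = 5"
  by (simp_all add: add7_def)

lemmas ground = if_True if_False prod.case fst_conv snd_conv list.pred_inject list.map foldr.simps id_apply o_apply rel_simps simp_thms mul7_eval add7_eval pts_eval

section \<open>Ground computations\<close>

abbreviation lns where "lns \<equiv> row line_table"

text \<open>An entry lists its two points once, so a hit on the second one exchanges the
  coefficients. The default 126 is not a point; a lookup that returns a point therefore certifies
  adjacency.\<close>

fun find_third :: "int \<Rightarrow> (int \<times> int \<times> int \<times> int \<times> int) list \<Rightarrow> int \<times> int \<times> int \<times> int" where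
  "find_third j [] = (126, 0, 0, 0)"
| "find_third j ((j', k, p, q, c) # es) =
     (if j = j' then (k, p, q, c) else if j = k then (j', q, p, c) else find_third j es)"

definition line_eqn :: "int \<Rightarrow> int \<Rightarrow> int \<times> int \<times> int \<times> int" where "line_eqn i j = find_third j (lns i)"
definition thd :: "int \<Rightarrow> int \<Rightarrow> int" where "thd i j = fst (line_eqn i j)"

fun nbrs_of :: "(int \<times> int \<times> int \<times> int \<times> int) list \<Rightarrow> int list" where
  "nbrs_of [] = []"
| "nbrs_of ((j, k, p, q, c) # es) = j # k # nbrs_of es"

datatype gen = Ga | Gb | Go

fun act :: "gen \<Rightarrow> int \<Rightarrow> int" where
  "act Ga = row a_table" | "act Gb = row b_table" | "act Go = row o_table"

fun actw :: "gen list \<Rightarrow> int \<Rightarrow> int" where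
  "actw [] i = i" | "actw (g # w) i = act g (actw w i)"

text \<open>Tests are written with \<open>if\<close> rather than with connectives: under
  \<open>if_weak_cong\<close> a branch is evaluated only after its condition is decided.\<close>

fun memb :: "int \<Rightarrow> int list \<Rightarrow> bool" where
  "memb i [] = False" | "memb i (x # xs) = (if i = x then True else memb i xs)"

fun nodup :: "int list \<Rightarrow> bool" where
  "nodup [] = True" | "nodup (x # xs) = (if memb x xs then False else nodup xs)"

definition adj :: "int \<Rightarrow> int \<Rightarrow> bool" where "adj i j = memb j (nbrs_of (lns i))"

text \<open>\<open>(y, g, x)\<close> records that the generator \<open>g\<close> moves the point \<open>x\<close>, reached before, to \<open>y\<close>. The words in
  \<open>nbr_words\<close> fix 0 and move 9; those in \<open>third_words\<close> fix 0 and 9 and move 10.\<close>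

definition reach_steps :: "(int \<times> gen \<times> int) list" where
  "reach_steps = [
    (1,Ga,0), (3,Gb,0), (2,Ga,1), (59,Gb,1), (4,Ga,3), (5,Gb,3), (125,Gb,2), (60,Ga,59),
    (99,Gb,59), (51,Gb,4), (6,Ga,5), (119,Ga,125), (57,Gb,125), (61,Ga,60), (66,Gb,60),
    (100,Ga,99), (52,Ga,51), (34,Gb,51), (74,Gb,6), (120,Ga,119), (8,Gb,119), (58,Ga,57),
    (62,Ga,61), (105,Gb,61), (67,Ga,66), (25,Gb,66), (101,Ga,100), (33,Gb,100), (53,Ga,52),
    (68,Gb,52), (28,Ga,34), (75,Ga,74), (116,Gb,74), (121,Ga,120), (76,Gb,120), (9,Ga,8),
    (16,Gb,8), (42,Gb,58), (56,Ga,62), (83,Gb,62), (106,Ga,105), (107,Gb,105), (89,Gb,67),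
    (26,Ga,25), (102,Ga,101), (103,Gb,101), (111,Gb,33), (54,Ga,53), (55,Gb,53), (69,Ga,68),
    (115,Gb,68), (29,Ga,28), (36,Gb,28), (124,Gb,75), (117,Ga,116), (122,Ga,121), (123,Gb,121),
    (70,Ga,76), (81,Gb,76), (10,Ga,9), (98,Gb,9), (17,Ga,16), (43,Ga,42), (90,Gb,42), (39,Gb,56),
    (77,Ga,83), (78,Gb,83), (108,Gb,106), (84,Gb,89), (27,Ga,26), (23,Gb,26), (104,Ga,103),
    (72,Gb,103), (49,Ga,55), (63,Ga,69), (48,Gb,69), (30,Ga,29), (37,Ga,36), (79,Gb,124),
    (118,Ga,117), (112,Gb,122), (71,Ga,70), (11,Gb,70), (82,Ga,81), (12,Gb,10), (14,Gb,98),
    (18,Ga,17), (96,Gb,17), (44,Ga,43), (40,Ga,39), (109,Ga,108), (19,Gb,108), (85,Ga,84),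
    (21,Ga,27), (22,Gb,27), (24,Ga,23), (73,Ga,72), (50,Ga,49), (64,Ga,63), (31,Ga,30),
    (38,Ga,37), (80,Ga,79), (91,Gb,118), (113,Ga,112), (114,Gb,112), (13,Ga,12), (7,Gb,12),
    (15,Ga,14), (97,Ga,96), (45,Ga,44), (46,Gb,44), (41,Ga,40), (110,Ga,109), (32,Gb,109),
    (20,Ga,19), (86,Ga,85), (35,Gb,85), (47,Gb,22), (93,Gb,24), (65,Ga,64), (95,Gb,80),
    (92,Ga,91), (87,Gb,15), (88,Gb,86), (94,Ga,93)]"

definition nbr_words :: "(int \<times> gen list) list" where
  "nbr_words = [
    (9,[]), (10,[Gb,Gb,Ga,Ga,Ga]), (16,[Ga,Ga,Gb,Gb]),
    (22,[Gb,Gb,Ga,Ga,Gb,Ga,Gb,Ga,Gb,Ga,Gb,Ga,Ga]), (33,[Gb,Ga,Ga,Gb]),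
    (43,[Ga,Gb,Ga,Gb,Gb,Ga,Gb,Ga,Gb]), (44,[Gb,Ga,Gb,Ga,Gb,Ga,Gb,Gb,Ga]),
    (50,[Ga,Ga,Gb,Gb,Ga,Ga,Ga,Ga,Gb]), (62,[Ga,Gb,Ga,Gb,Gb,Ga,Gb,Ga,Gb,Gb,Ga,Ga,Gb]),
    (66,[Ga,Gb,Ga,Gb,Gb,Ga,Gb,Ga,Ga,Ga,Ga]), (80,[Gb,Gb,Ga,Gb,Gb,Ga,Gb,Ga,Gb,Ga,Ga,Ga,Gb]),
    (90,[Gb,Ga,Gb,Ga,Gb,Ga,Gb,Gb,Ga,Gb,Ga,Ga,Gb]), (92,[Ga,Ga,Ga,Gb,Ga,Gb,Ga,Gb,Gb,Ga]),
    (102,[Ga,Ga,Ga,Ga,Gb]), (108,[Gb,Ga,Ga,Gb,Gb,Ga,Ga,Gb]), (123,[Gb,Ga,Ga,Gb,Ga,Ga,Gb,Gb])]"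

definition third_words :: "(int \<times> gen list) list" where
  "third_words = [
    (10,[]), (16,[Go,Ga,Ga,Gb,Ga,Ga,Ga]), (33,[Ga,Ga,Gb,Ga,Ga,Ga]), (102,[Ga,Ga,Gb,Ga,Ga,Ga,Go]),
    (108,[Go]), (123,[Go,Ga,Ga,Gb,Ga,Ga,Ga,Go])]"

text \<open>Sylow subgroups of orders 64 and 27 of \<open>G\<^sub>2(2)\<close>, as words in generators, each with two points of a line which the
  element preserves if its order divides 2, respectively 3; for other elements the two points are arbitrary.\<close>

abbreviation "x2 \<equiv> [Go]"
abbreviation "y2 \<equiv> [Ga,Gb,Gb,Ga,Go,Ga,Gb]"
abbreviation "z2 \<equiv> [Ga,Go,Ga,Ga,Gb,Ga,Ga]"
definition sylow2 :: "(gen list list \<times> int \<times> int) list" where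
  "sylow2 = [
    ([],0,9), ([x2],0,9), ([y2],0,0), ([z2],1,10), ([y2,x2],0,0), ([z2,x2],0,0), ([x2,y2],0,0),
    ([y2,y2],0,0), ([z2,y2],0,0), ([x2,z2],0,0), ([y2,z2],0,0), ([x2,y2,x2],0,0),
    ([y2,y2,x2],4,26), ([z2,y2,x2],4,77), ([x2,z2,x2],1,23), ([y2,z2,x2],0,0), ([y2,x2,y2],0,9),
    ([z2,x2,y2],0,0), ([x2,y2,y2],3,111), ([z2,y2,y2],3,19), ([x2,z2,y2],3,13),
    ([y2,z2,y2],4,13), ([y2,x2,z2],14,33), ([z2,x2,z2],0,44), ([y2,y2,z2],3,58),
    ([z2,y2,z2],0,0), ([y2,x2,y2,x2],0,9), ([z2,x2,y2,x2],0,0), ([x2,y2,y2,x2],0,0),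
    ([z2,y2,y2,x2],0,0), ([x2,z2,y2,x2],0,0), ([y2,z2,y2,x2],0,0), ([y2,x2,z2,x2],0,0),
    ([z2,x2,z2,x2],0,44), ([y2,y2,z2,x2],0,0), ([z2,y2,z2,x2],0,62), ([y2,y2,x2,y2],0,0),
    ([z2,y2,x2,y2],0,0), ([y2,z2,x2,y2],0,0), ([y2,x2,y2,y2],0,0), ([x2,z2,y2,y2],0,0),
    ([z2,x2,z2,y2],0,22), ([y2,y2,z2,y2],0,0), ([z2,y2,z2,y2],0,0), ([x2,y2,x2,z2],0,0),
    ([y2,z2,x2,z2],3,58), ([y2,z2,y2,z2],0,0), ([y2,y2,x2,y2,x2],0,0), ([z2,y2,x2,y2,x2],4,59),
    ([y2,z2,x2,y2,x2],1,10), ([y2,x2,y2,y2,x2],0,0), ([x2,z2,y2,y2,x2],5,7),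
    ([z2,x2,z2,y2,x2],0,0), ([y2,y2,z2,y2,x2],0,0), ([z2,y2,z2,y2,x2],2,18),
    ([x2,y2,x2,z2,x2],4,20), ([y2,z2,x2,z2,x2],0,0), ([y2,z2,y2,z2,x2],2,18),
    ([y2,z2,y2,x2,y2],0,0), ([z2,y2,z2,x2,y2],2,11), ([y2,z2,y2,z2,y2],0,0),
    ([y2,z2,y2,x2,y2,x2],0,0), ([z2,y2,z2,x2,y2,x2],1,10), ([y2,z2,y2,z2,y2,x2],6,21)]"

abbreviation "x3 \<equiv> [Gb]"
abbreviation "y3 \<equiv> [Ga,Ga,Gb,Ga,Go,Ga,Go,Ga]"
definition sylow3 :: "(gen list list \<times> int \<times> int) list" where
  "sylow3 = [
    ([],0,9), ([x3],23,26), ([y3],29,41), ([x3,x3],23,26), ([y3,x3],23,94), ([x3,y3],23,94),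
    ([y3,y3],29,41), ([y3,x3,x3],29,38), ([x3,y3,x3],29,38), ([y3,y3,x3],29,38),
    ([x3,x3,y3],29,38), ([y3,x3,y3],29,38), ([x3,y3,y3],29,38), ([x3,y3,x3,x3],29,41),
    ([y3,y3,x3,x3],23,94), ([x3,x3,y3,x3],29,41), ([y3,x3,y3,x3],23,94), ([x3,y3,y3,x3],23,94),
    ([y3,y3,x3,y3],23,26), ([y3,x3,y3,y3],23,26), ([x3,x3,y3,x3,x3],23,94),
    ([y3,x3,y3,x3,x3],29,41), ([x3,y3,y3,x3,x3],29,41), ([y3,y3,x3,y3,x3],23,26),
    ([y3,x3,y3,y3,x3],23,26), ([y3,y3,x3,y3,x3,x3],23,26), ([y3,x3,y3,y3,x3,x3],23,26)]"

text \<open>A step \<open>(p, q, us, vs)\<close> shows that an automorphism fixing the points collected so far also fixes one more: the third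
  point of the line \<open>p q\<close> if \<open>us\<close> and \<open>vs\<close> are empty, and otherwise \<open>q\<close>, the only neighbour of \<open>p\<close> adjacent to all of
  \<open>us\<close> and to none of \<open>vs\<close>.\<close>

definition rigid_steps :: "(int \<times> int \<times> int list \<times> int list) list" where
  "rigid_steps = [
    (0,9,[],[]), (0,10,[],[]), (0,22,[50, 102],[]), (0,22,[],[]), (9,43,[],[]), (10,43,[],[]),
    (0,44,[10, 50],[]), (0,44,[],[]), (9,66,[],[]), (10,44,[],[]), (9,31,[27],[0]), (9,31,[],[]),
    (43,56,[],[]), (10,51,[],[]), (44,1,[],[]), (50,23,[],[]), (22,34,[],[]), (102,54,[],[]),
    (0,16,[43],[50, 102]), (0,16,[],[]), (22,33,[],[]), (0,62,[50, 16],[]), (0,62,[],[]),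
    (9,92,[],[]), (16,62,[],[]), (0,80,[10, 33],[]), (0,80,[],[]), (10,80,[],[]), (16,90,[],[]),
    (0,108,[44, 92],[]), (0,108,[],[]), (44,108,[],[]), (62,123,[],[]), (80,123,[],[]),
    (1,11,[33, 44],[]), (44,11,[],[]), (1,11,[],[]), (16,94,[],[]), (66,119,[],[]),
    (31,58,[],[]), (1,45,[58],[44]), (51,45,[],[]), (10,18,[],[]), (62,18,[],[]), (102,85,[],[]),
    (54,72,[],[]), (11,45,[],[]), (33,21,[],[]), (22,53,[],[]), (50,25,[],[]), (62,30,[],[]),
    (16,8,[],[]), (43,65,[],[]), (9,6,[],[]), (1,81,[33],[44]), (1,81,[],[]), (17,84,[],[]),
    (33,81,[],[]), (31,14,[],[]), (27,5,[],[]), (92,14,[],[]), (56,124,[],[]), (93,64,[],[]),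
    (80,81,[],[]), (31,40,[],[]), (26,97,[],[]), (108,124,[],[]), (23,13,[],[]), (26,47,[],[]),
    (90,13,[],[]), (56,83,[],[]), (17,29,[],[]), (16,83,[],[]), (51,28,[],[]), (27,24,[],[]),
    (62,28,[],[]), (34,82,[],[]), (93,15,[],[]), (11,81,[],[]), (94,28,[],[]), (45,109,[],[]),
    (119,116,[],[]), (66,91,[],[]), (102,71,[],[]), (90,100,[],[]), (108,70,[],[]),
    (44,52,[],[]), (10,57,[],[]), (80,32,[],[]), (11,52,[],[]), (84,77,[],[]), (2,12,[34,
    22],[]), (22,12,[],[]), (34,12,[],[]), (108,46,[],[]), (43,114,[],[]), (56,114,[],[]),
    (45,12,[],[]), (66,95,[],[]), (9,111,[],[]), (92,120,[],[]), (108,117,[],[]), (44,112,[],[]),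
    (50,106,[],[]), (62,75,[],[]), (11,106,[],[]), (119,111,[],[]), (81,122,[],[]),
    (50,39,[],[]), (23,98,[],[]), (80,39,[],[]), (9,79,[],[]), (31,79,[],[]), (11,19,[],[]),
    (22,68,[],[]), (102,104,[],[]), (33,68,[],[]), (80,38,[],[]), (10,121,[],[]), (43,105,[],[]),
    (16,118,[],[]), (18,121,[],[]), (85,104,[],[])]"

text \<open>Each pair spans a line along which the formula of \<open>seed_table\<close> passes from
  two points to the third. Starting from the six basis points and the eight seeds, the steps reach
  all 126 points.\<close>

definition basis_steps :: "(int \<times> int) list" where
  "basis_steps = [
    (0,9), (0,10), (0,22), (9,111), (9,43), (10,1), (10,43), (11,1), (11,19), (11,52), (1,23),
    (0,44), (9,66), (10,44), (11,44), (1,93), (9,56), (1,17), (3,19), (3,111), (23,26), (22,68),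
    (19,70), (19,52), (3,46), (22,46), (3,12), (19,56), (9,86), (3,86), (111,66), (3,95),
    (11,58), (0,33), (22,33), (19,58), (111,86), (60,5), (19,97), (11,122), (60,68), (10,121),
    (60,33), (0,80), (10,80), (5,27), (5,31), (60,14), (70,52), (0,108), (70,86), (70,97),
    (70,90), (5,100), (70,87), (52,44), (10,57), (70,57), (111,115), (52,100), (50,25), (50,106),
    (102,54), (102,104), (111,73), (23,55), (60,73), (111,118), (3,47), (23,47), (3,13), (5,55),
    (50,98), (43,114), (43,65), (9,6), (70,101), (120,38), (120,105), (51,28), (52,24), (11,21),
    (1,45), (10,67), (120,67), (103,98), (103,101), (102,72), (2,85), (44,106), (120,112),
    (66,71), (94,65), (2,110), (93,125), (68,125), (111,117), (9,42), (0,92), (5,42), (93,64),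
    (1,109), (31,58), (5,78), (11,88), (1,81), (17,84), (119,91), (104,85), (114,124), (12,69),
    (53,101)]"

text \<open>Search for a function in the six-dimensional space without a line of zeros (\<open>tree0\<close>), respectively without zeros
  (\<open>tree1\<close>). Level \<open>n\<close> lists pairs of points whose values are determined by the values at the first basis points known
  at that level; a branch is closed when both values vanish.\<close>

definition tree0 :: "(int \<times> int) list list" where
  "tree0 = [
    [], [(0,10), (0,16), (0,108)], [(0,44)], [(57,70), (2,11), (94,112), (1,11), (23,94),
    (13,23), (27,32), (23,27), (47,109), (5,27), (1,109), (17,29), (25,29), (11,106), (17,75),
    (5,106), (1,17), (106,115), (48,105), (30,57), (2,57)], [(0,80), (0,62), (0,22), (30,39),
    (15,73), (25,96), (40,51), (15,41), (32,37), (18,45), (93,118), (13,14), (84,87), (38,49),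
    (19,70), (12,82), (60,73), (46,110), (11,81), (18,96), (59,67), (35,53), (14,40), (6,8),
    (35,82), (69,74), (20,47), (8,25), (38,77), (4,7), (68,117), (6,15), (42,111), (14,48),
    (7,77), (46,54), (24,63), (45,109), (61,69), (36,85), (15,93), (70,99), (74,75), (29,38),
    (56,64), (12,45), (4,26), (3,83), (5,8), (2,46), (5,14), (38,87), (26,30), (14,72), (14,58),
    (71,84), (48,49), (7,24), (75,88), (35,77), (3,12), (4,13), (31,40), (61,74), (24,27),
    (68,73), (5,42), (86,89), (69,91), (67,96), (18,76), (13,46), (20,39), (2,12), (8,78)]]"

definition tree1 :: "(int \<times> int) list list" where
  "tree1 = [
    [], [(9,9), (50,50)], [(10,10), (16,16), (33,33), (102,102), (108,108), (123,123)], [(11,11),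
    (17,17), (58,58), (27,27), (44,44), (66,66), (94,94), (115,115), (119,119)]]"

text \<open>The last two conjuncts state that the normalised equations seen from the three points
  agree: the one at \<open>j\<close> multiplied by \<open>p\<close>, and the one at \<open>k\<close>
  multiplied by \<open>q\<close>, is the one at \<open>i\<close>.\<close>

definition row_ok :: "int \<Rightarrow> bool" where
  "row_ok i = (nodup (i # nbrs_of (lns i)) \<and>
     list_all (\<lambda>(j, k, p, q, c). 0 \<le> j \<and> j < 126 \<and> 0 \<le> k \<and> k < 126 \<and> 0 \<le> c \<and> c < 7 \<and>
       (case line_eqn j i of (k', p', q', c') \<Rightarrow> k' = k \<and> mul7 p p' = 1 \<and> mul7 p q' = q \<and> mul7 p c' = c) \<and>
       (case line_eqn k i of (k', p', q', c') \<Rightarrow> k' = j \<and> mul7 q p' = 1 \<and> mul7 q q' = p \<and> mul7 q c' = c)) (lns i))"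
lemma rows_ok: "list_all row_ok pts"
  by (simp only: row_ok_def line_eqn_def find_third.simps nbrs_of.simps memb.simps nodup.simps lns_eval ground cong: if_weak_cong)

definition aut_ok :: "(int \<Rightarrow> int) \<Rightarrow> bool" where
  "aut_ok s = list_all (\<lambda>i. list_all (\<lambda>(j, k, p, q, c). thd (s i) (s j) = s k) (lns i)) pts"

text \<open>Substituting \<open>la i * x + be i\<close> at each point into the equation of the image
  line must give \<open>la i\<close> times the original equation; the conjuncts compare the
  coefficients at \<open>j\<close> and \<open>k\<close> and the constants.\<close>

definition col_ok :: "(int \<Rightarrow> int) \<Rightarrow> (int \<Rightarrow> int) \<Rightarrow> (int \<Rightarrow> int) \<Rightarrow> bool" where
  "col_ok s la be = list_all (\<lambda>i. list_all (\<lambda>(j, k, p, q, c). case line_eqn (s i) (s j) of (k', p', q', c') \<Rightarrow>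
      k' = s k \<and> mul7 p' (la j) = mul7 (la i) p \<and> mul7 q' (la k) = mul7 (la i) q \<and>
      add7 (be i) (add7 (mul7 p' (be j)) (add7 (mul7 q' (be k)) (mul7 (la i) c))) = c') (lns i)) pts"

lemma aut_ok_o: "aut_ok (row o_table)"
  by (simp only: aut_ok_def thd_def line_eqn_def find_third.simps lns_eval o_eval ground cong: if_weak_cong)

lemma col_ok_a: "col_ok (row a_table) (\<lambda>_. 1) (row a_shift_table)"
  by (simp only: col_ok_def line_eqn_def find_third.simps lns_eval a_eval a_shift_eval ground cong: if_weak_cong)

lemma col_ok_b: "col_ok (row b_table) (row b_slope_table) (row b_shift_table)"
  by (simp only: col_ok_def line_eqn_def find_third.simps lns_eval b_eval b_slope_eval b_shift_eval ground cong: if_weak_cong)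

lemma order_a: "list_all (\<lambda>i. actw [Ga,Ga,Ga,Ga,Ga,Ga,Ga] i = i) pts"
  by (simp only: act.simps actw.simps a_eval ground cong: if_weak_cong)
lemma order_b: "list_all (\<lambda>i. actw [Gb,Gb,Gb] i = i) pts"
  by (simp only: act.simps actw.simps b_eval ground cong: if_weak_cong)
lemma order_o: "list_all (\<lambda>i. actw [Go,Go] i = i) pts"
  by (simp only: act.simps actw.simps o_eval ground cong: if_weak_cong)

fun reach_ok :: "int list \<Rightarrow> (int \<times> gen \<times> int) list \<Rightarrow> bool" where
  "reach_ok S [] = list_all (\<lambda>i. memb i S) pts"
| "reach_ok S ((y, g, x) # r) = (memb x S \<and> act g x = y \<and> g \<noteq> Go \<and> reach_ok (y # S) r)"

lemma reach_ok: "reach_ok [0] reach_steps"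
  by (simp only: reach_ok.simps reach_steps_def act.simps memb.simps gen.distinct not_False_eq_True a_eval b_eval ground cong: if_weak_cong)

lemma nbr_words_ok:
  "list_all (\<lambda>(j, w). actw w 0 = 0 \<and> actw w 9 = j \<and> list_all (\<lambda>g. g \<noteq> Go) w) nbr_words"
  by (simp only: nbr_words_def act.simps actw.simps gen.distinct not_False_eq_True a_eval b_eval ground cong: if_weak_cong)

lemma nbr_words_all: "list_all (\<lambda>j. memb j (map fst nbr_words)) (nbrs_of (lns 0))"
  by (simp only: nbr_words_def nbrs_of.simps memb.simps lns_eval ground cong: if_weak_cong)

lemma third_words_ok:
  "list_all (\<lambda>(j, w). actw w 0 = 0 \<and> actw w 9 = 9 \<and> actw w 10 = j) third_words"
  by (simp only: third_words_def act.simps actw.simps a_eval b_eval o_eval ground cong: if_weak_cong)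

text \<open>An invariant of \<open>d\<close> relative to 0 and 9: some line through 9, entered at a
  point other than 0, is joined to the line of 0 and \<open>d\<close> in two places. It helps to cut
  the possible images of 10 down to six.\<close>

definition grid_like :: "int \<Rightarrow> bool" where
  "grid_like d = (\<not> list_all (\<lambda>y. if y = 0 then True else if adj d y then \<not> adj (thd 9 y) (thd 0 d) else True) (nbrs_of (lns 9)))"

lemma third_candidates:
  "list_all (\<lambda>d. d = 9 \<or> d = thd 0 9 \<or> adj 9 d \<or> adj (thd 0 9) d \<or> grid_like d \<or> memb d (map fst third_words)) (nbrs_of (lns 0))"
  "\<not> adj 9 10" "\<not> adj (thd 0 9) 10" "\<not> grid_like 10" "adj 0 10" "adj 0 9"
  by (simp_all only: third_words_def adj_def thd_def line_eqn_def grid_like_def find_third.simps nbrs_of.simps memb.simps lns_eval ground cong: if_weak_cong)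

fun rigid_ok :: "int list \<Rightarrow> (int \<times> int \<times> int list \<times> int list) list \<Rightarrow> bool" where
  "rigid_ok S [] = list_all (\<lambda>i. memb i S) pts"
| "rigid_ok S ((p, q, us, vs) # r) = (memb p S \<and> adj p q \<and>
     (if us @ vs = [] then memb q S \<and> rigid_ok (thd p q # S) r
      else list_all (\<lambda>u. memb u S \<and> adj q u) us \<and> list_all (\<lambda>v. memb v S \<and> \<not> adj q v) vs \<and>
        list_all (\<lambda>y. y = q \<or> \<not> list_all (\<lambda>u. adj y u) us \<or> \<not> list_all (\<lambda>v. \<not> adj y v) vs) (nbrs_of (lns p)) \<and>
        rigid_ok (q # S) r))"

lemma rigid_ok: "rigid_ok [0, 9, 10] rigid_steps"
  by (simp only: rigid_ok.simps rigid_steps_def adj_def thd_def line_eqn_def find_third.simps nbrs_of.simps memb.simps append.simps list.distinct lns_eval ground cong: if_weak_cong)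

text \<open>An automorphism is determined by its values at 0, 9 and 10, so equality of words is
  decided on these three images.\<close>

definition base_image :: "gen list \<Rightarrow> int \<times> int \<times> int" where
  "base_image w = (actw w 0, actw w 9, actw w 10)"

fun memb3 :: "int \<times> int \<times> int \<Rightarrow> (int \<times> int \<times> int) list \<Rightarrow> bool" where
  "memb3 (x, y, z) [] = False"
| "memb3 (x, y, z) ((x', y', z') # r) =
     (if x = x' then if y = y' then if z = z' then True else memb3 (x, y, z) r else memb3 (x, y, z) r else memb3 (x, y, z) r)"

fun nodup3 :: "(int \<times> int \<times> int) list \<Rightarrow> bool" where
  "nodup3 [] = True" | "nodup3 (x # xs) = (if memb3 x xs then False else nodup3 xs)"

text \<open>Left multiplication by the generators keeps the listed elements among themselves, and
  distinct images exclude repetitions in the list, whose length is then the order of the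
  group.\<close>

definition closed_words :: "gen list list \<Rightarrow> (gen list list \<times> int \<times> int) list \<Rightarrow> (int \<times> int \<times> int) list \<Rightarrow> bool" where
  "closed_words gs us bs = (nodup3 bs \<and>
     list_all (\<lambda>(u, p, q). list_all (\<lambda>g. memb3 (base_image (g @ concat u)) bs) gs) us)"

lemma closed_words2: "closed_words [x2, y2, z2] sylow2 (map (\<lambda>(u, p, q). base_image (concat u)) sylow2)"
  by (simp only: closed_words_def nodup3.simps memb3.simps base_image_def sylow2_def concat.simps append.simps act.simps actw.simps a_eval b_eval o_eval ground cong: if_weak_cong)

lemma closed_words3: "closed_words [x3, y3] sylow3 (map (\<lambda>(u, p, q). base_image (concat u)) sylow3)"
  by (simp only: closed_words_def nodup3.simps memb3.simps base_image_def sylow3_def concat.simps append.simps act.simps actw.simps a_eval b_eval o_eval ground cong: if_weak_cong)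

lemma gens2: "list_all (\<lambda>(u, p, q). list_all (\<lambda>g. g = x2 \<or> g = y2 \<or> g = z2) u) sylow2"
  by (simp only: sylow2_def ground gen.distinct list.inject list.distinct)

lemma gens3: "list_all (\<lambda>(u, p, q). list_all (\<lambda>g. g = x3 \<or> g = y3) u) sylow3"
  by (simp only: sylow3_def ground gen.distinct list.inject list.distinct)

definition fixes_line :: "gen list \<Rightarrow> int \<Rightarrow> int \<Rightarrow> bool" where
  "fixes_line w p q = (if adj p q then
     if memb (actw w p) [p, q, thd p q] then memb (actw w q) [p, q, thd p q] else False else False)"

lemma sylow2_ok:
  "list_all (\<lambda>(u, p, q). if fixes_line (concat u) p q then True
     else base_image (concat u @ concat u) \<noteq> (0, 9, 10)) sylow2"
  by (simp only: sylow2_def fixes_line_def adj_def thd_def line_eqn_def find_third.simps nbrs_of.simps memb.simps base_image_def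
      concat.simps append.simps act.simps actw.simps prod.inject not_False_eq_True not_True_eq_False
      lns_eval a_eval b_eval o_eval ground cong: if_weak_cong)

lemma sylow3_ok:
  "list_all (\<lambda>(u, p, q). if fixes_line (concat u) p q then True
     else base_image (concat u @ concat u @ concat u) \<noteq> (0, 9, 10)) sylow3"
  by (simp only: sylow3_def fixes_line_def adj_def thd_def line_eqn_def find_third.simps nbrs_of.simps memb.simps base_image_def
      concat.simps append.simps act.simps actw.simps prod.inject not_False_eq_True not_True_eq_False
      lns_eval a_eval b_eval o_eval ground cong: if_weak_cong)

fun rel3 :: "int \<Rightarrow> int \<Rightarrow> int list \<Rightarrow> int list \<Rightarrow> int list \<Rightarrow> int list" where
  "rel3 p q (x # xs) (y # ys) (z # zs) = add7 x (add7 (mul7 p y) (mul7 q z)) # rel3 p q xs ys zs"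
| "rel3 p q _ _ _ = []"

lemma co_ok: "list_all (\<lambda>i. list_all (\<lambda>(j, k, p, q, c).
    rel3 p q (row co_table i) (row co_table j) (row co_table k) = [0,0,0,0,0,0]) (lns i)) pts"
  by (simp only: rel3.simps lns_eval co_eval ground list.inject cong: if_weak_cong)

lemma co_basis: "row co_table 0 = [1,0,0,0,0,0]" "row co_table 9 = [0,1,0,0,0,0]"
  "row co_table 10 = [0,0,1,0,0,0]" "row co_table 11 = [0,0,0,1,0,0]"
  "row co_table 1 = [0,0,0,0,1,0]" "row co_table 3 = [0,0,0,0,0,1]"
  by (simp_all only: co_eval)

fun basis_ok :: "int list \<Rightarrow> (int \<times> int) list \<Rightarrow> bool" where
  "basis_ok S [] = list_all (\<lambda>i. memb i S) pts"
| "basis_ok S ((i, j) # r) = (memb i S \<and> memb j S \<and> adj i j \<and> (case line_eqn i j of (k, p, q, c) \<Rightarrow>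
     rel3 p q (row seed_table i) (row seed_table j) (row seed_table k) = [0,0,0,0,0,0,0,0] \<and>
     basis_ok (k # S) r))"

lemma basis_ok: "basis_ok [52,70,5,60,111,19,22,23,3,1,11,10,9,0] basis_steps"
  by (simp only: basis_ok.simps basis_steps_def rel3.simps memb.simps adj_def line_eqn_def find_third.simps nbrs_of.simps lns_eval
     seed_eval ground list.inject cong: if_weak_cong)

lemma seed_basis:
  "row seed_table 0 = [0,0,0,0,0,0,0,0]" "row seed_table 9 = [0,0,0,0,0,0,0,0]"
  "row seed_table 10 = [0,0,0,0,0,0,0,0]" "row seed_table 11 = [0,0,0,0,0,0,0,0]"
  "row seed_table 1 = [0,0,0,0,0,0,0,0]" "row seed_table 3 = [0,0,0,0,0,0,0,0]"
  "row seed_table 23 = [1,0,0,0,0,0,0,0]" "row seed_table 22 = [0,1,0,0,0,0,0,0]"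
  "row seed_table 19 = [0,0,1,0,0,0,0,0]" "row seed_table 111 = [0,0,0,1,0,0,0,0]"
  "row seed_table 60 = [0,0,0,0,1,0,0,0]" "row seed_table 5 = [0,0,0,0,0,1,0,0]"
  "row seed_table 70 = [0,0,0,0,0,0,1,0]" "row seed_table 52 = [0,0,0,0,0,0,0,1]"
  by (simp_all only: seed_eval)

definition seed_lines :: "(int \<times> int) list" where
  "seed_lines = [(4,7), (4,48), (4,59), (6,8), (6,15), (6,61), (6,79), (7,29)]"

definition seed_rel :: "int \<times> int \<Rightarrow> int list" where
  "seed_rel = (\<lambda>(i, j). case line_eqn i j of (k, p, q, c) \<Rightarrow>
     rel3 p q (row seed_table i) (row seed_table j) (row seed_table k))"

text \<open>With coefficient 0 at its last list, \<open>rel3\<close> adds the multiple of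
  \<open>v\<close> by \<open>c\<close>.\<close>

fun lincomb :: "int list \<Rightarrow> int list list \<Rightarrow> int list" where
  "lincomb (c # cs) (v # vs) = rel3 c 0 (lincomb cs vs) v v"
| "lincomb _ _ = [0,0,0,0,0,0,0,0]"

text \<open>The eight coefficient lists form a left inverse modulo 7 of the matrix of the relations
  \<open>seed_rel\<close>; so these relations force all eight seed values to vanish.\<close>

lemma seed_lines_ok:
  "list_all (\<lambda>(i, j). adj i j) seed_lines"
  "map (\<lambda>cs. lincomb cs (map seed_rel seed_lines))
     [[1,6,6,6,2,0,2,4], [4,4,1,4,5,4,4,2], [3,3,6,3,2,3,1,5], [1,0,4,1,6,3,1,0], [4,1,3,3,1,0,4,4], [4,6,4,6,6,5,5,4], [3,4,4,4,6,1,6,5], [5,2,4,1,3,5,0,3]] =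
   [[1,0,0,0,0,0,0,0], [0,1,0,0,0,0,0,0], [0,0,1,0,0,0,0,0], [0,0,0,1,0,0,0,0],
    [0,0,0,0,1,0,0,0], [0,0,0,0,0,1,0,0], [0,0,0,0,0,0,1,0], [0,0,0,0,0,0,0,1]]"
  by (simp_all only: seed_rel_def seed_lines_def lincomb.simps rel3.simps adj_def nbrs_of.simps memb.simps line_eqn_def find_third.simps
     seed_eval lns_eval ground list.inject cong: if_weak_cong)

fun dot7 :: "int list \<Rightarrow> int list \<Rightarrow> int" where
  "dot7 (x # xs) (y # ys) = add7 (mul7 x y) (dot7 xs ys)"
| "dot7 _ _ = 0"

fun killed :: "(int \<times> int) list \<Rightarrow> int list \<Rightarrow> bool" where
  "killed [] F = False"
| "killed ((i, j) # r) F =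
     (if dot7 (row co_table i) F = 0 then if dot7 (row co_table j) F = 0 then True else killed r F else killed r F)"

text \<open>\<open>F\<close> is the prefix of values guessed so far. A branch left open when the
  levels run out counts as failure, so success means that every assignment has been closed.\<close>

fun tree_search :: "(int \<times> int) list list \<Rightarrow> int list \<Rightarrow> bool" where
  "tree_search [] F = False"
| "tree_search (L # Ls) F = (if killed L F then True else list_all (\<lambda>v. tree_search Ls (F @ [v])) [0,1,2,3,4,5,6])"

lemma tree_search0: "tree_search tree0 [0, 1]"
  by (simp only: tree_search.simps tree0_def killed.simps dot7.simps append.simps co_eval ground cong: if_weak_cong)

lemma tree_search1: "tree_search tree1 [1]"
  by (simp only: tree_search.simps tree1_def killed.simps dot7.simps append.simps co_eval ground cong: if_weak_cong)

text \<open>Only the first \<open>n\<close> values are known at depth \<open>n\<close>; the points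
  listed there must have no coefficients beyond them.\<close>

fun levels_ok :: "nat \<Rightarrow> (int \<times> int) list list \<Rightarrow> bool" where
  "levels_ok n [] = True"
| "levels_ok n (L # Ls) = (list_all (\<lambda>(i, j). list_all (\<lambda>x. x = 0) (drop n (row co_table i)) \<and>
      list_all (\<lambda>x. x = 0) (drop n (row co_table j))) L \<and> levels_ok (Suc n) Ls)"

lemma levels: "levels_ok 2 tree0" "levels_ok 1 tree1"
  by (simp_all only: levels_ok.simps tree0_def tree1_def drop_Suc_Cons drop_0 numeral_2_eq_2 One_nat_def drop_Nil
      co_eval ground cong: if_weak_cong)

lemma tree_adj: "list_all (list_all (\<lambda>(i, j). adj i j)) tree0" "list_all (list_all (\<lambda>(i, j). i = j)) tree1"
  by (simp_all only: tree0_def tree1_def adj_def nbrs_of.simps memb.simps lns_eval ground cong: if_weak_cong)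

text \<open>The points 0, ..., 6 form one cycle of \<open>a\<close>. Since the functions in the
  module sum to zero over it, changing a lift of \<open>a\<close> by a translation cannot change the
  shift 6 of its seventh power in the fibre over 0. This is the reason that the extension does not
  split.\<close>

lemma orbit_sum: "rel3 1 1 (rel3 1 1 (row co_table 0) (row co_table 1) (row co_table 2))
    (rel3 1 1 (row co_table 3) (row co_table 4) (row co_table 5)) (row co_table 6) = [0,0,0,0,0,0]"
  by (simp only: rel3.simps co_eval ground)

text \<open>Allows a collineation of the cover to recognise fibres by collinearity alone;
  transitivity extends it from 0 to the other points.\<close>

lemma nbr_sets: "list_all (\<lambda>j. if j = 0 then True else \<not> list_all (\<lambda>k. adj j k) (nbrs_of (lns 0))) pts"
  by (simp only: adj_def nbrs_of.simps memb.simps lns_eval ground cong: if_weak_cong)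

lemma a_small: "row a_table 0 = 1" "row a_table 1 = 2" "row a_table 2 = 3" "row a_table 3 = 4"
  "row a_table 4 = 5" "row a_table 5 = 6" "row a_table 6 = 0"
  "row a_shift_table 0 = 0" "row a_shift_table 1 = 0" "row a_shift_table 2 = 0" "row a_shift_table 3 = 0"
  "row a_shift_table 4 = 0" "row a_shift_table 5 = 0" "row a_shift_table 6 = 6"
  by (simp_all only: a_eval a_shift_eval)

definition pts_in :: "(int \<Rightarrow> int) \<Rightarrow> bool" where "pts_in s = list_all (\<lambda>i. 0 \<le> s i \<and> s i < 126) pts"
lemma pts_in: "pts_in (row a_table)" "pts_in (row b_table)" "pts_in (row o_table)"
  by (simp_all only: pts_in_def a_eval b_eval o_eval ground)
lemma b_slopes: "list_all (\<lambda>i. 1 \<le> row b_slope_table i \<and> row b_slope_table i < 7) pts"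
  by (simp only: b_slope_eval ground)

section \<open>From checks on lists to statements about sets\<close>

abbreviation base :: "int set" where "base \<equiv> {0..<126}"

lemma set_pts: "set pts = base"
  unfolding pts_def by auto

lemma all_pts: "list_all P pts \<longleftrightarrow> (\<forall>i\<in>base. P i)"
  by (simp only: list_all_iff set_pts)

lemma memb_iff: "memb i xs \<longleftrightarrow> i \<in> set xs"
  by (induction xs) auto

lemma nodup_iff: "nodup xs \<longleftrightarrow> distinct xs"
  by (induction xs) (auto simp: memb_iff)

lemma find_third_in:
  "find_third j es = (k, p, q, c) \<Longrightarrow> j \<in> set (nbrs_of es) \<Longrightarrow> (j, k, p, q, c) \<in> set es \<or> (k, j, q, p, c) \<in> set es"
  by (induction es rule: nbrs_of.induct) (auto split: if_splits)

lemma find_third_notin: "j \<notin> set (nbrs_of es) \<Longrightarrow> find_third j es = (126, 0, 0, 0)"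
  by (induction es rule: nbrs_of.induct) auto

lemma entry_nbrs: "(j, k, p, q, c) \<in> set es \<Longrightarrow> j \<in> set (nbrs_of es) \<and> k \<in> set (nbrs_of es)"
  by (induction es rule: nbrs_of.induct) auto

lemma find_third_mem:
  "distinct (nbrs_of es) \<Longrightarrow> (j, k, p, q, c) \<in> set es \<Longrightarrow> find_third j es = (k, p, q, c) \<and> find_third k es = (j, q, p, c)"
  by (induction es rule: nbrs_of.induct) (auto dest: entry_nbrs)

section \<open>The base geometry and its cover\<close>

text \<open>Stands for the base line {i, j, k} with its equation x + p y + q z = c, where x, y, z
  are coordinates over \<open>i\<close>, \<open>j\<close>, \<open>k\<close> in this order.\<close>

definition coll :: "int \<Rightarrow> int \<Rightarrow> int \<Rightarrow> int \<Rightarrow> int \<Rightarrow> int \<Rightarrow> bool" where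
  "coll i j k p q c \<longleftrightarrow> i \<in> base \<and> adj i j \<and> line_eqn i j = (k, p, q, c)"

lemma distinct_row: "i \<in> base \<Longrightarrow> distinct (i # nbrs_of (lns i))"
  using rows_ok unfolding all_pts row_ok_def nodup_iff by blast

lemma adj_iff: "adj i j \<longleftrightarrow> j \<in> set (nbrs_of (lns i))"
  by (simp add: adj_def memb_iff)

lemma coll_entry:
  "coll i j k p q c \<longleftrightarrow> i \<in> base \<and> ((j, k, p, q, c) \<in> set (lns i) \<or> (k, j, q, p, c) \<in> set (lns i))"
proof (cases "i \<in> base")
  case True
  then have d: "distinct (nbrs_of (lns i))" using distinct_row by force
  show ?thesis unfolding coll_def line_eqn_def adj_iff
    using find_third_in[of j "lns i" k p q c] find_third_mem[OF d, of j k p q c] find_third_mem[OF d, of k j q p c]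
      entry_nbrs[of j k p q c "lns i"] entry_nbrs[of k j q p c "lns i"] by blast
next
  case False
  then show ?thesis unfolding coll_def by blast
qed

lemma row_entry:
  assumes "i \<in> base" "(j, k, p, q, c) \<in> set (lns i)"
  shows "j \<in> base" "k \<in> base" "0 \<le> c" "c < 7"
    "\<exists>p' q' c'. line_eqn j i = (k, p', q', c') \<and> mul7 p p' = 1 \<and> mul7 p q' = q \<and> mul7 p c' = c"
    "\<exists>p' q' c'. line_eqn k i = (j, p', q', c') \<and> mul7 q p' = 1 \<and> mul7 q q' = p \<and> mul7 q c' = c"
proof -
  have "row_ok i" using rows_ok assms(1) unfolding all_pts by blast
  note this[unfolded row_ok_def list_all_iff, THEN conjunct2, THEN bspec, OF assms(2)]
  then have H: "0 \<le> j \<and> j < 126 \<and> 0 \<le> k \<and> k < 126 \<and> 0 \<le> c \<and> c < 7 \<and>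
       (case line_eqn j i of (k', p', q', c') \<Rightarrow> k' = k \<and> mul7 p p' = 1 \<and> mul7 p q' = q \<and> mul7 p c' = c) \<and>
       (case line_eqn k i of (k', p', q', c') \<Rightarrow> k' = j \<and> mul7 q p' = 1 \<and> mul7 q q' = p \<and> mul7 q c' = c)"
    by (simp only: prod.case)
  obtain k1 p1 q1 c1 where 1: "line_eqn j i = (k1, p1, q1, c1)" by (rule prod_cases4)
  obtain k2 p2 q2 c2 where 2: "line_eqn k i = (k2, p2, q2, c2)" by (rule prod_cases4)
  show "j \<in> base" "k \<in> base" "0 \<le> c" "c < 7" using H by simp_all
  show "\<exists>p' q' c'. line_eqn j i = (k, p', q', c') \<and> mul7 p p' = 1 \<and> mul7 p q' = q \<and> mul7 p c' = c"
    using H 1 by simp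
  show "\<exists>p' q' c'. line_eqn k i = (j, p', q', c') \<and> mul7 q p' = 1 \<and> mul7 q q' = p \<and> mul7 q c' = c"
    using H 2 by simp
qed

lemma coll_swap: "coll i j k p q c \<Longrightarrow> coll i k j q p c"
  unfolding coll_entry by blast

lemma coll_facts:
  assumes "coll i j k p q c"
  shows "i \<in> base" "j \<in> base" "k \<in> base" "i \<noteq> j" "i \<noteq> k" "0 \<le> c" "c < 7"
proof -
  show i: "i \<in> base" using assms unfolding coll_def by blast
  show "j \<in> base" "k \<in> base" "0 \<le> c" "c < 7" using assms row_entry[OF i] unfolding coll_entry by blast+
  have "j \<in> set (nbrs_of (lns i))" "k \<in> set (nbrs_of (lns i))"
    using assms entry_nbrs unfolding coll_entry by blast+
  then show "i \<noteq> j" "i \<noteq> k" using distinct_row[OF i] by auto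
qed

lemma coll_rot:
  assumes "coll i j k p q c"
  shows "\<exists>p' q' c'. coll j i k p' q' c' \<and> mul7 p p' = 1 \<and> mul7 p q' = q \<and> mul7 p c' = c"
proof -
  have i: "i \<in> base" and j: "j \<in> base" and k: "k \<in> base" using coll_facts[OF assms] by blast+
  obtain p' q' c' where l: "line_eqn j i = (k, p', q', c')" "mul7 p p' = 1" "mul7 p q' = q" "mul7 p c' = c"
    using assms row_entry(5)[OF i, of j k p q c] row_entry(6)[OF i, of k j q p c] unfolding coll_entry by blast
  have "adj j i"
  proof (rule ccontr)
    assume "\<not> adj j i"
    \<comment> \<open>An absent neighbour would give the default third point 126, whereas
      \<open>k\<close> is a point of the geometry.\<close>
    then have "line_eqn j i = (126, 0, 0, 0)" unfolding adj_iff line_eqn_def by (rule find_third_notin)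
    with l k show False by simp
  qed
  then have "coll j i k p' q' c'" using j l unfolding coll_def by blast
  with l show ?thesis by blast
qed

lemma coll_neq: "coll i j k p q c \<Longrightarrow> j \<noteq> k"
  using coll_rot coll_facts(5) by blast

lemma coll_det: "coll i j k p q c \<Longrightarrow> coll i j k' p' q' c' \<Longrightarrow> k = k' \<and> p = p' \<and> q = q' \<and> c = c'"
  unfolding coll_def by simp

lemma coll_exists: "i \<in> base \<Longrightarrow> adj i j \<Longrightarrow> \<exists>p q c. coll i j (thd i j) p q c"
  unfolding coll_def thd_def by (cases "line_eqn i j") auto

lemma coll_thd: "coll i j k p q c \<Longrightarrow> adj i j \<and> thd i j = k"
  unfolding coll_def thd_def by simp

lemma adj_props:
  assumes "i \<in> base" "adj i j"
  shows "j \<in> base" "thd i j \<in> base" "adj j i" "thd j i = thd i j" "adj i (thd i j)" "thd i (thd i j) = j"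
    "i \<noteq> j" "thd i j \<noteq> i" "thd i j \<noteq> j"
proof -
  obtain p q c where c: "coll i j (thd i j) p q c" using coll_exists[OF assms] by blast
  obtain p' q' c' where c': "coll j i (thd i j) p' q' c'" using coll_rot[OF c] by blast
  show "j \<in> base" "thd i j \<in> base" "i \<noteq> j" "thd i j \<noteq> i" "thd i j \<noteq> j"
    using coll_facts[OF c] coll_neq[OF c] by auto
  show "adj j i" "thd j i = thd i j" using coll_thd[OF c'] by auto
  show "adj i (thd i j)" "thd i (thd i j) = j" using coll_thd[OF coll_swap[OF c]] by auto
qed

lemma inv7: "p * p' mod 7 = 1 \<Longrightarrow> (7::int) dvd p * x \<longleftrightarrow> 7 dvd x"
proof
  assume p: "p * p' mod 7 = 1" and d: "7 dvd p * x"
  have "7 dvd p * p' - 1" using p by (metis mod_eq_dvd_iff mod_mod_trivial)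
  then have "7 dvd (p * x) * p' - (p * p' - 1) * x" using d by (meson dvd_diff dvd_mult2)
  then show "7 dvd x" by (simp add: algebra_simps)
qed simp

lemma inv7_exists:
  assumes "coll i j k p q c"
  shows "\<exists>p'. p * p' mod 7 = 1" "\<exists>q'. q * q' mod 7 = 1"
proof -
  show "\<exists>p'. p * p' mod 7 = 1" using coll_rot[OF assms] unfolding mul7_def by blast
  show "\<exists>q'. q * q' mod 7 = 1" using coll_rot[OF coll_swap[OF assms]] unfolding mul7_def by blast
qed

text \<open>The equation normalised at the second point, multiplied by \<open>p\<close>, is the one
  normalised at the first; \<open>p\<close> is invertible, so both have the same solutions.\<close>

lemma rot_arith:
  assumes "p * p' mod 7 = 1" "p * q' mod 7 = q" "p * c' mod 7 = (c::int)"
  shows "7 dvd x + p * y + q * z - c \<longleftrightarrow> 7 dvd y + p' * x + q' * z - c'"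
proof -
  have d: "7 dvd p * p' - 1" "7 dvd p * q' - q" "7 dvd p * c' - c"
    using assms by (metis mod_eq_dvd_iff mod_mod_trivial)+
  have eq: "p * (y + p' * x + q' * z - c') = (x + p * y + q * z - c) + ((p * p' - 1) * x + (p * q' - q) * z - (p * c' - c))"
    by (simp add: algebra_simps)
  have "7 dvd (p * p' - 1) * x + (p * q' - q) * z - (p * c' - c)"
    using d by (meson dvd_add dvd_diff dvd_mult2)
  then have "7 dvd p * (y + p' * x + q' * z - c') \<longleftrightarrow> 7 dvd x + p * y + q * z - c"
    unfolding eq by (rule dvd_add_left_iff)
  then show ?thesis using inv7[OF assms(1)] by blast
qed

lemma eq7: "7 dvd x - y \<Longrightarrow> x \<in> {0..<7} \<Longrightarrow> y \<in> {0..<7} \<Longrightarrow> x = (y::int)"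
  by (metis atLeastLessThan_iff mod_eq_dvd_iff mod_pos_pos_trivial)

type_synonym point = "int \<times> int"

definition Pts :: "point set" where "Pts = base \<times> {0..<7}"

text \<open>The coefficients at all three points are invertible, so that any two coordinates
  determine the third. This makes the cover a partial linear space again.\<close>

definition tri :: "point \<Rightarrow> point \<Rightarrow> point \<Rightarrow> bool" where
  "tri P Q R \<longleftrightarrow> P \<in> Pts \<and> Q \<in> Pts \<and> R \<in> Pts \<and>
     (\<exists>p q c. coll (fst P) (fst Q) (fst R) p q c \<and> 7 dvd snd P + p * snd Q + q * snd R - c)"

lemma tri_coll: "tri P Q R \<Longrightarrow> \<exists>p q c. coll (fst P) (fst Q) (fst R) p q c"
  unfolding tri_def by blast

lemma tri_exists:
  assumes P: "P \<in> Pts" and Q: "Q \<in> Pts" and a: "adj (fst P) (fst Q)"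
  shows "\<exists>R. tri P Q R"
proof -
  have i: "fst P \<in> base" using P unfolding Pts_def by auto
  obtain p q c where c: "coll (fst P) (fst Q) (thd (fst P) (fst Q)) p q c" using coll_exists[OF i a] by blast
  obtain q' where q': "q * q' mod 7 = 1" using inv7_exists[OF c] by blast
  \<comment> \<open>The equation is solved for the third coordinate, \<open>- (q' * s)\<close>, with
    \<open>q'\<close> the inverse of \<open>q\<close>.\<close>
  define s where "s = snd P + p * snd Q - c"
  have "7 dvd q * q' - 1" using q' by (metis mod_eq_dvd_iff mod_mod_trivial)
  moreover have "7 dvd (- (q' * s)) mod 7 - (- (q' * s))" by (metis mod_eq_dvd_iff mod_mod_trivial)
  ultimately have "7 dvd (- s) * (q * q' - 1) + q * ((- (q' * s)) mod 7 - (- (q' * s)))"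
    by (intro dvd_add dvd_mult)
  then have "7 dvd s + q * ((- (q' * s)) mod 7)" by (simp add: algebra_simps)
  then have "tri P Q (thd (fst P) (fst Q), (- (q' * s)) mod 7)"
    using P Q c coll_facts[OF c] unfolding tri_def Pts_def s_def by (auto simp: algebra_simps)
  then show ?thesis by blast
qed

interpretation geo: three_point_lines Pts tri
proof
  show "finite Pts" unfolding Pts_def by simp
  show "P \<in> Pts" if "tri P Q R" for P Q R using that unfolding tri_def by blast
  show "P \<noteq> Q" if "tri P Q R" for P Q R using tri_coll[OF that] coll_facts(4) by blast
  show "tri P R Q" if t: "tri P Q R" for P Q R
  proof -
    obtain p q c where c: "coll (fst P) (fst Q) (fst R) p q c" "7 dvd snd P + p * snd Q + q * snd R - c"
      using t unfolding tri_def by blast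
    then have "7 dvd snd P + q * snd R + p * snd Q - c" by (simp add: algebra_simps)
    then show ?thesis using coll_swap[OF c(1)] t unfolding tri_def by blast
  qed
  show "tri Q P R" if t: "tri P Q R" for P Q R
  proof -
    obtain p q c where c: "coll (fst P) (fst Q) (fst R) p q c" "7 dvd snd P + p * snd Q + q * snd R - c"
      using t unfolding tri_def by blast
    obtain p' q' c' where r: "coll (fst Q) (fst P) (fst R) p' q' c'" "mul7 p p' = 1" "mul7 p q' = q" "mul7 p c' = c"
      using coll_rot[OF c(1)] by blast
    then have "7 dvd snd Q + p' * snd P + q' * snd R - c'" using c(2) rot_arith unfolding mul7_def by blast
    then show ?thesis using r(1) t unfolding tri_def by blast
  qed
  show "R = R'" if t: "tri P Q R" "tri P Q R'" for P Q R R'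
  proof -
    obtain p q c where c: "coll (fst P) (fst Q) (fst R) p q c" "7 dvd snd P + p * snd Q + q * snd R - c"
      using t unfolding tri_def by blast
    obtain p' q' c' where c': "coll (fst P) (fst Q) (fst R') p' q' c'" "7 dvd snd P + p' * snd Q + q' * snd R' - c'"
      using t unfolding tri_def by blast
    have e: "fst R = fst R'" "p' = p" "q' = q" "c' = c" using coll_det[OF c(1) c'(1)] by auto
    have "7 dvd (snd P + p * snd Q + q * snd R - c) - (snd P + p * snd Q + q * snd R' - c)"
      using c c' unfolding e by (meson dvd_diff)
    then have "7 dvd q * (snd R - snd R')" by (simp add: algebra_simps)
    then have "7 dvd snd R - snd R'" using inv7_exists[OF c(1)] inv7 by blast
    moreover have "snd R \<in> {0..<7}" "snd R' \<in> {0..<7}" using t unfolding tri_def Pts_def by auto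
    ultimately show ?thesis using e(1) eq7 by (simp add: prod_eq_iff)
  qed
qed

lemma length_nbrs: "list_all (\<lambda>i. length (nbrs_of (lns i)) = 16) pts"
  by (simp add: pts_eval lns_eval)

lemma card_nbrs: "i \<in> base \<Longrightarrow> card {j. adj i j} = 16"
  using distinct_row[of i] length_nbrs distinct_card[of "nbrs_of (lns i)"]
  unfolding all_pts by (simp add: adj_iff)

text \<open>The points collinear with \<open>P\<close> are those in the sixteen adjacent fibres, 112
  in all, and the lines through \<open>P\<close> partition them into pairs.\<close>

lemma card_star:
  assumes P: "P \<in> Pts"
  shows "card (geo.star P) = 56"
proof -
  have i: "fst P \<in> base" using P unfolding Pts_def by auto
  let ?N = "{j. adj (fst P) j} \<times> {0..<7::int}"
  have N: "(\<Union>l\<in>geo.star P. l - {P}) = ?N"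
  proof
    show "(\<Union>l\<in>geo.star P. l - {P}) \<subseteq> ?N"
    proof
      fix Q assume "Q \<in> (\<Union>l\<in>geo.star P. l - {P})"
      then obtain l where l: "l \<in> geo.Lines" "P \<in> l" "Q \<in> l" "P \<noteq> Q" unfolding geo.star_def by blast
      obtain R where "tri P Q R" using geo.line_through[OF l] by blast
      then show "Q \<in> ?N" unfolding tri_def coll_def Pts_def by (cases Q) auto
    qed
    show "?N \<subseteq> (\<Union>l\<in>geo.star P. l - {P})"
    proof
      fix Q assume Q: "Q \<in> ?N"
      then have "Q \<in> Pts" using adj_props(1)[OF i] unfolding Pts_def by (cases Q) auto
      moreover have "adj (fst P) (fst Q)" using Q by auto
      ultimately obtain R where R: "tri P Q R" using tri_exists[OF P] by blast
      then have "{P, Q, R} \<in> geo.star P" unfolding geo.star_def geo.Lines_def by blast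
      moreover have "Q \<in> {P, Q, R} - {P}" using geo.tri_neq[OF R] by blast
      ultimately show "Q \<in> (\<Union>l\<in>geo.star P. l - {P})" by blast
    qed
  qed
  have "card ?N = (\<Sum>l\<in>geo.star P. card (l - {P}))"
    unfolding N[symmetric]
  proof (rule card_UN_disjoint[OF geo.finite_star])
    show "\<forall>l\<in>geo.star P. finite (l - {P})"
      using geo.Lines_Pt geo.finite_Pt finite_subset unfolding geo.star_def by blast
    show "\<forall>l\<in>geo.star P. \<forall>m\<in>geo.star P. l \<noteq> m \<longrightarrow> (l - {P}) \<inter> (m - {P}) = {}"
      using geo.line_eq unfolding geo.star_def by blast
  qed
  also have "\<dots> = (\<Sum>l\<in>geo.star P. 2)"
  proof (rule sum.cong[OF refl])
    fix l assume "l \<in> geo.star P"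
    then have "card l = 3" "P \<in> l" using geo.card_line unfolding geo.star_def by auto
    then show "card (l - {P}) = 2" by simp
  qed
  finally show ?thesis using card_nbrs[OF i] by (simp add: card_cartesian_product)
qed

interpretation geo: thick_lines Pts tri
  by unfold_locales (simp add: card_star)

text \<open>Incident pairs are counted twice: 882 points with 56 lines each, and three points on
  every line.\<close>

lemma card_Lines: "card geo.Lines = 16464"
proof -
  have "(\<Sum>P\<in>Pts. card {l \<in> geo.Lines. P \<in> l}) = 3 * card geo.Lines"
  proof (rule sum_multicount)
    show "\<forall>l\<in>geo.Lines. card {P \<in> Pts. P \<in> l} = 3"
    proof
      fix l assume l: "l \<in> geo.Lines"
      then have "{P \<in> Pts. P \<in> l} = l" using geo.Lines_Pt by blast
      then show "card {P \<in> Pts. P \<in> l} = 3" using geo.card_line[OF l] by simp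
    qed
  qed (rule geo.finite_Pt geo.finite_Lines)+
  moreover have "(\<Sum>P\<in>Pts. card {l \<in> geo.Lines. P \<in> l}) = (\<Sum>P\<in>Pts. 56)"
    by (rule sum.cong[OF refl]) (simp add: card_star[unfolded geo.star_def])
  moreover have "card Pts = 882" unfolding Pts_def by (simp add: card_cartesian_product)
  ultimately show ?thesis by simp
qed

section \<open>Automorphisms of the base geometry\<close>

lemma perm_group_stabilizer:
  assumes "perm_group S G"
  shows "perm_group S {g \<in> G. g x = x}"
proof -
  interpret perm_group S G by (rule assms)
  show ?thesis
  proof
    show "inv g \<in> {g \<in> G. g x = x}" if "g \<in> {g \<in> G. g x = x}" for g
      using that inv_mem bij by (metis (mono_tags, lifting) bij_inv_eq_iff mem_Collect_eq)
  qed (auto simp: finG id_mem comp_mem permutes)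
qed

definition auts :: "(int \<Rightarrow> int) set" where
  "auts = {s. s permutes base \<and> (\<forall>i\<in>base. \<forall>j. adj i j \<longrightarrow> adj (s i) (s j) \<and> thd (s i) (s j) = s (thd i j))}"

lemma auts_permutes: "s \<in> auts \<Longrightarrow> s permutes base"
  unfolding auts_def by blast

lemma auts_base: "s \<in> auts \<Longrightarrow> s i \<in> base \<longleftrightarrow> i \<in> base"
  using auts_permutes permutes_in_image by metis

lemma auts_inj: "s \<in> auts \<Longrightarrow> s i = s j \<longleftrightarrow> i = j"
  using auts_permutes permutes_inj by (metis injD)

lemma auts_adj: "s \<in> auts \<Longrightarrow> i \<in> base \<Longrightarrow> adj i j \<Longrightarrow> adj (s i) (s j)"
  and auts_thd: "s \<in> auts \<Longrightarrow> i \<in> base \<Longrightarrow> adj i j \<Longrightarrow> thd (s i) (s j) = s (thd i j)"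
  unfolding auts_def by blast+

text \<open>\<open>auts\<close> asks only that adjacency be preserved; an injection of the finite
  set of adjacent pairs into itself is onto, which gives the converse.\<close>

lemma auts_adj_iff:
  assumes s: "s \<in> auts" and i: "i \<in> base" and j: "j \<in> base"
  shows "adj (s i) (s j) \<longleftrightarrow> adj i j"
proof
  let ?A = "{(i, j). i \<in> base \<and> adj i j}"
  assume a: "adj (s i) (s j)"
  have "?A \<subseteq> base \<times> base"
  proof
    fix x assume "x \<in> ?A"
    then obtain u v where "x = (u, v)" "u \<in> base" "adj u v" by blast
    then show "x \<in> base \<times> base" using adj_props(1)[of u v] by (simp only: mem_Sigma_iff)
  qed
  then have fin: "finite ?A" by (rule finite_subset) simp
  have "inj_on (map_prod s s) ?A" using auts_inj[OF s] by (auto simp: inj_on_def)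
  moreover have "map_prod s s ` ?A \<subseteq> ?A" using auts_adj[OF s] auts_base[OF s] by auto
  ultimately have "map_prod s s ` ?A = ?A" using endo_inj_surj[OF fin] by blast
  moreover have "(s i, s j) \<in> ?A" using a i auts_base[OF s] by simp
  ultimately have "(s i, s j) \<in> map_prod s s ` ?A" by simp
  then obtain u v where "s i = s u" "s j = s v" "adj u v" by blast
  then show "adj i j" by (simp only: auts_inj[OF s])
qed (rule auts_adj[OF s i])

interpretation auts: perm_group base auts
proof
  show "finite auts" by (rule finite_subset[OF _ finite_permutations[of base]]) (auto simp: auts_def)
  show "g permutes base" if "g \<in> auts" for g by (rule auts_permutes[OF that])
  show "id \<in> auts" by (simp add: auts_def permutes_id)
  show "g \<circ> h \<in> auts" if g: "g \<in> auts" and h: "h \<in> auts" for g h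
    using permutes_compose[OF auts_permutes[OF h] auts_permutes[OF g]] auts_base[OF h]
      auts_adj[OF g] auts_adj[OF h] auts_thd[OF g] auts_thd[OF h]
    unfolding auts_def by auto
  show "inv s \<in> auts" if s: "s \<in> auts" for s
  proof -
    have si: "s (inv s x) = x" for x using permutes_inverses(1)[OF auts_permutes[OF s]] .
    have b: "inv s x \<in> base" if "x \<in> base" for x using that auts_base[OF s, of "inv s x"] si by simp
    have "adj (inv s i) (inv s j) \<and> thd (inv s i) (inv s j) = inv s (thd i j)" if i: "i \<in> base" and a: "adj i j" for i j
    proof -
      have 1: "adj (inv s i) (inv s j)"
        using auts_adj_iff[OF s b[OF i] b[OF adj_props(1)[OF i a]]] a si by simp
      have "s (thd (inv s i) (inv s j)) = thd i j" using auts_thd[OF s b[OF i] 1] si by simp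
      then have "thd (inv s i) (inv s j) = inv s (thd i j)"
        by (metis permutes_inverses(2)[OF auts_permutes[OF s]])
      with 1 show ?thesis by blast
    qed
    then show ?thesis using permutes_inv[OF auts_permutes[OF s]] unfolding auts_def by blast
  qed
qed

text \<open>The tables carry no meaning outside the 126 points; extension by the identity there
  gives a permutation in the sense of \<open>permutes\<close>.\<close>

definition gperm :: "gen \<Rightarrow> int \<Rightarrow> int" where "gperm g i = (if i \<in> base then act g i else i)"

fun wperm :: "gen list \<Rightarrow> int \<Rightarrow> int" where
  "wperm [] = id" | "wperm (g # w) = gperm g \<circ> wperm w"

lemma act_base: "i \<in> base \<Longrightarrow> act g i \<in> base"
  using pts_in unfolding pts_in_def all_pts by (cases g) auto

text \<open>Some power of each generator is the identity on the points.\<close>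

lemma act_inj:
  assumes "i \<in> base" "j \<in> base" "act g i = act g j"
  shows "i = j"
proof (cases g)
  case Ga
  have "actw [Ga,Ga,Ga,Ga,Ga,Ga,Ga] i = actw [Ga,Ga,Ga,Ga,Ga,Ga,Ga] j" using assms(3) Ga by simp
  then show ?thesis using order_a assms unfolding all_pts by (simp only:)
next
  case Gb
  have "actw [Gb,Gb,Gb] i = actw [Gb,Gb,Gb] j" using assms(3) Gb by simp
  then show ?thesis using order_b assms unfolding all_pts by (simp only:)
next
  case Go
  have "actw [Go,Go] i = actw [Go,Go] j" using assms(3) Go by simp
  then show ?thesis using order_o assms unfolding all_pts by (simp only:)
qed

lemma aut_ok_act: "aut_ok (act g)"
proof -
  have col: "aut_ok s" if c: "col_ok s la be" for s la be
    unfolding aut_ok_def list_all_iff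
  proof (intro ballI)
    fix i e assume i: "i \<in> set pts" and e: "e \<in> set (lns i)"
    obtain j k p q c where E: "e = (j, k, p, q, c)" by (rule prod_cases5)
    note c[unfolded col_ok_def list_all_iff, THEN bspec, OF i, THEN bspec, OF e, unfolded E prod.case]
    then have "fst (line_eqn (s i) (s j)) = s k" by (cases "line_eqn (s i) (s j)") simp
    then show "case e of (j, k, p, q, c) \<Rightarrow> thd (s i) (s j) = s k" unfolding E thd_def by simp
  qed
  show ?thesis using col[OF col_ok_a] col[OF col_ok_b] aut_ok_o by (cases g) simp_all
qed

lemma adj_if_thd_base: "thd i j \<in> base \<Longrightarrow> adj i j"
  using find_third_notin[of j "lns i"] unfolding thd_def line_eqn_def adj_iff by (cases "j \<in> set (nbrs_of (lns i))") auto

lemma gperm_auts: "gperm g \<in> auts"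
proof -
  have "inj_on (gperm g) base" using act_inj by (auto simp: inj_on_def gperm_def)
  moreover have "gperm g ` base \<subseteq> base" using act_base by (auto simp: gperm_def)
  ultimately have "bij_betw (gperm g) base base" by (simp add: bij_betw_def endo_inj_surj)
  then have perm: "gperm g permutes base" by (rule bij_imp_permutes) (simp only: gperm_def if_False)
  have "adj (gperm g i) (gperm g j) \<and> thd (gperm g i) (gperm g j) = gperm g (thd i j)"
    if i: "i \<in> base" and a: "adj i j" for i j
  proof -
    have e: "thd (act g i) (act g j) = act g k" if "(j, k, p, q, c) \<in> set (lns i)" for j k p q c
      using aut_ok_act[of g, unfolded aut_ok_def all_pts, THEN bspec, OF i, unfolded list_all_iff, THEN bspec, OF that]
      by (simp only: prod.case)
    obtain p q c where c: "coll i j (thd i j) p q c" using coll_exists[OF i a] by blast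
    have b: "j \<in> base" "thd i j \<in> base" using adj_props[OF i a] by auto
    from c consider "(j, thd i j, p, q, c) \<in> set (lns i)" | "(thd i j, j, q, p, c) \<in> set (lns i)"
      unfolding coll_entry by blast
    then have "adj (act g i) (act g j) \<and> thd (act g i) (act g j) = act g (thd i j)"
    proof cases
      case 1
      then show ?thesis using e[OF 1] adj_if_thd_base act_base[OF b(2)] by metis
    next
      case 2
      have t: "thd (act g i) (act g (thd i j)) = act g j" by (rule e[OF 2])
      then have "adj (act g i) (act g (thd i j))" using adj_if_thd_base act_base[OF b(1)] by metis
      then show ?thesis using adj_props(5,6)[OF act_base[OF i]] t by metis
    qed
    then show ?thesis using i b by (simp add: gperm_def)
  qed
  with perm show ?thesis unfolding auts_def by blast
qed

lemma wperm_auts: "wperm w \<in> auts"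
proof (induction w)
  case Nil
  show ?case unfolding wperm.simps by (rule auts.id_mem)
next
  case (Cons g w)
  then show ?case unfolding wperm.simps by (rule auts.comp_mem[OF gperm_auts])
qed

lemma wperm_actw: "i \<in> base \<Longrightarrow> wperm w i = actw w i"
proof (induction w)
  case (Cons g w)
  then show ?case using auts_base[OF wperm_auts, of w i] by (simp add: gperm_def)
qed simp

lemma wperm_append: "wperm (v @ w) = wperm v \<circ> wperm w"
  by (induction v) (simp_all add: comp_assoc)

section \<open>Rigidity and the order of the automorphism group\<close>

lemma rigid_steps_fix:
  assumes s: "s \<in> auts"
  shows "rigid_ok S steps \<Longrightarrow> \<forall>x\<in>set S. x \<in> base \<and> s x = x \<Longrightarrow> \<forall>i\<in>base. s i = i"
proof (induction S steps rule: rigid_ok.induct)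
  case (1 S)
  then show ?case by (simp only: rigid_ok.simps all_pts memb_iff) blast
next
  case (2 S p q us vs r)
  have m: "memb p S" "adj p q"
    and br: "if us @ vs = [] then memb q S \<and> rigid_ok (thd p q # S) r
      else list_all (\<lambda>u. memb u S \<and> adj q u) us \<and> list_all (\<lambda>v. memb v S \<and> \<not> adj q v) vs \<and>
        list_all (\<lambda>y. y = q \<or> \<not> list_all (\<lambda>u. adj y u) us \<or> \<not> list_all (\<lambda>v. \<not> adj y v) vs) (nbrs_of (lns p)) \<and>
        rigid_ok (q # S) r"
    using 2(3) unfolding rigid_ok.simps by blast+
  have fixS: "x \<in> base" "s x = x" if "x \<in> set S" for x using 2(4) that by blast+
  have p: "p \<in> base" "s p = p" "adj p q" using m fixS unfolding memb_iff by blast+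
  have qb: "q \<in> base" using adj_props(1) p by blast
  show ?case
  proof (cases "us @ vs = []")
    case True
    then have q: "q \<in> set S" and ok: "rigid_ok (thd p q # S) r"
      using br unfolding memb_iff by (simp_all only: if_True)
    have "s (thd p q) = thd p q" using auts_thd[OF s p(1,3)] p(2) fixS(2)[OF q] by simp
    then have "\<forall>x\<in>set (thd p q # S). x \<in> base \<and> s x = x"
      using 2(4) adj_props(2)[OF p(1,3)] by (simp only: list.set ball_simps simp_thms)
    then show ?thesis by (rule 2(1)[OF True ok])
  next
    case False
    note H0 = br[unfolded if_not_P[OF False] list_all_iff memb_iff]
    have H: "\<forall>u\<in>set us. u \<in> set S \<and> adj q u" "\<forall>v\<in>set vs. v \<in> set S \<and> \<not> adj q v"
      "\<forall>y\<in>set (nbrs_of (lns p)). y = q \<or> \<not> (\<forall>u\<in>set us. adj y u) \<or> \<not> (\<forall>v\<in>set vs. \<not> adj y v)"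
      "rigid_ok (q # S) r"
      using H0 by blast+
    have "adj p (s q)" using auts_adj[OF s p(1,3)] p by simp
    moreover have "adj (s q) u" if "u \<in> set us" for u
      using auts_adj_iff[OF s qb, of u] H(1) fixS that by metis
    moreover have "\<not> adj (s q) v" if "v \<in> set vs" for v
      using auts_adj_iff[OF s qb, of v] H(2) fixS that by metis
    ultimately have "s q = q" using H(3) unfolding adj_iff by blast
    then have "\<forall>x\<in>set (q # S). x \<in> base \<and> s x = x"
      using 2(4) qb by (simp only: list.set ball_simps simp_thms)
    then show ?thesis by (rule 2(2)[OF False H(4)])
  qed
qed

text \<open>The certificate is applied to \<open>inv t \<circ> s\<close>, which fixes 0, 9 and
  10.\<close>

lemma rigid:
  assumes s: "s \<in> auts" and t: "t \<in> auts" and eq: "s 0 = t 0" "s 9 = t 9" "s 10 = t 10"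
  shows "s = t"
proof -
  have it: "inv t \<circ> s \<in> auts" using s t auts.inv_mem auts.comp_mem by blast
  have "(inv t \<circ> s) x = x" if "s x = t x" for x
    using that permutes_inverses(2)[OF auts_permutes[OF t]] by simp
  then have "\<forall>i\<in>base. (inv t \<circ> s) i = i"
    using rigid_steps_fix[OF it rigid_ok] eq by simp
  then have "s i = t i" if "i \<in> base" for i
    using that permutes_inverses(1)[OF auts_permutes[OF t]] by (metis comp_apply)
  moreover have "s i = t i" if "i \<notin> base" for i
    using that auts_permutes[OF s] auts_permutes[OF t] by (simp add: permutes_def)
  ultimately show ?thesis by blast
qed

text \<open>\<open>Go\<close> is excluded because these words are later lifted to the cover, and
  slopes and shifts are given for \<open>Ga\<close> and \<open>Gb\<close> alone.\<close>

lemma reach_word: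
  assumes "i \<in> base"
  shows "\<exists>w. list_all (\<lambda>g. g \<noteq> Go) w \<and> actw w 0 = i"
proof -
  have "reach_ok S steps \<Longrightarrow> \<forall>x\<in>set S. \<exists>w. list_all (\<lambda>g. g \<noteq> Go) w \<and> actw w 0 = x \<Longrightarrow>
    \<forall>i\<in>base. \<exists>w. list_all (\<lambda>g. g \<noteq> Go) w \<and> actw w 0 = i" for S steps
  proof (induction S steps rule: reach_ok.induct)
    case (1 S)
    then show ?case by (simp only: reach_ok.simps all_pts memb_iff) blast
  next
    case (2 S y g x r)
    have m: "x \<in> set S" "act g x = y" "g \<noteq> Go" "reach_ok (y # S) r"
      using 2(2) unfolding reach_ok.simps memb_iff by blast+
    obtain w where w: "list_all (\<lambda>g. g \<noteq> Go) w" "actw w 0 = x" using 2(3) m(1) by blast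
    then have "list_all (\<lambda>g. g \<noteq> Go) (g # w)" "actw (g # w) 0 = y" using m by simp_all
    then have "\<exists>w. list_all (\<lambda>g. g \<noteq> Go) w \<and> actw w 0 = y" by blast
    then have "\<forall>x\<in>set (y # S). \<exists>w. list_all (\<lambda>g. g \<noteq> Go) w \<and> actw w 0 = x"
      using 2(3) by (simp only: list.set ball_simps simp_thms)
    then show ?case by (rule 2(1)[OF m(4)])
  qed
  moreover have "\<forall>x\<in>set [0]. \<exists>w. list_all (\<lambda>g. g \<noteq> Go) w \<and> actw w 0 = x"
    by (auto intro!: exI[of _ "[]"])
  ultimately show ?thesis using reach_ok assms by blast
qed

lemma nbr_word:
  assumes "adj 0 j"
  shows "\<exists>w. list_all (\<lambda>g. g \<noteq> Go) w \<and> actw w 0 = 0 \<and> actw w 9 = j"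
proof -
  have "j \<in> set (map fst nbr_words)"
    using nbr_words_all assms unfolding list_all_iff memb_iff adj_iff by blast
  then obtain w where "(j, w) \<in> set nbr_words" by auto
  then show ?thesis using nbr_words_ok unfolding list_all_iff by fastforce
qed

text \<open>All properties by which \<open>third_candidates\<close> discards a neighbour of 0 are
  invariant under automorphisms fixing 0 and 9, and 10 has none of them; six candidates
  remain.\<close>

lemma third_image:
  assumes s: "s \<in> auts" "s 0 = 0" "s 9 = 9"
  shows "s 10 \<in> set (map fst third_words)"
proof -
  note tc = third_candidates
  have b: "(0::int) \<in> base" "(9::int) \<in> base" "(10::int) \<in> base" by auto
  have t9: "s (thd 0 9) = thd 0 9" using auts_thd[OF s(1) b(1) tc(6)] s by simp
  have t9b: "thd 0 9 \<in> base" by (rule adj_props(2)[OF b(1) tc(6)])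
  have 0: "adj 0 (s 10)" using auts_adj[OF s(1) b(1) tc(5)] s by simp
  have 1: "s 10 \<noteq> 9" using auts_inj[OF s(1), of 10 9] s by auto
  have "(10::int) \<noteq> thd 0 9" using tc(2) adj_props(5)[OF b(2)] adj_props(3,4)[OF b(1) tc(6)] by metis
  then have 2: "s 10 \<noteq> thd 0 9" using auts_inj[OF s(1), of 10 "thd 0 9"] t9 by metis
  have 3: "\<not> adj 9 (s 10)" using auts_adj_iff[OF s(1) b(2,3)] s(3) tc(2) by simp
  have 4: "\<not> adj (thd 0 9) (s 10)" using auts_adj_iff[OF s(1) t9b b(3)] t9 tc(3) by simp
  \<comment> \<open>A witness for \<open>s 10\<close> is pulled back by the inverse of
    \<open>s\<close> to a witness for 10.\<close>
  have "\<not> grid_like (s 10)"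
  proof
    assume "grid_like (s 10)"
    then obtain y where y: "adj 9 y" "y \<noteq> 0" "adj (s 10) y" "adj (thd 9 y) (thd 0 (s 10))"
      unfolding grid_like_def list_all_iff adj_iff by (auto split: if_splits)
    have yb: "y \<in> base" by (rule adj_props(1)[OF b(2) y(1)])
    define x where "x = inv s y"
    have sx: "s x = y" unfolding x_def by (rule permutes_inverses(1)[OF auts_permutes[OF s(1)]])
    have xb: "x \<in> base" using yb auts_base[OF s(1), of x] sx by simp
    have x9: "adj 9 x" using auts_adj_iff[OF s(1) b(2) xb] s(3) sx y(1) by simp
    have "adj 10 x" using auts_adj_iff[OF s(1) b(3) xb] sx y(3) by simp
    moreover have "x \<noteq> 0" using sx s(2) y(2) by auto
    moreover have "adj (thd 9 x) (thd 0 10)"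
    proof -
      have "s (thd 9 x) = thd 9 y" using auts_thd[OF s(1) b(2) x9] s(3) sx by simp
      moreover have "s (thd 0 10) = thd 0 (s 10)" using auts_thd[OF s(1) b(1) tc(5)] s(2) by simp
      ultimately show ?thesis
        using auts_adj_iff[OF s(1) adj_props(2)[OF b(2) x9] adj_props(2)[OF b(1) tc(5)]] y(4) by simp
    qed
    ultimately have "grid_like 10" using x9 unfolding grid_like_def list_all_iff adj_iff by auto
    with tc(4) show False by blast
  qed
  then show ?thesis using tc(1) 0 1 2 3 4 unfolding list_all_iff memb_iff adj_iff by blast
qed

text \<open>Orbit and stabiliser along the chain 0, 9, 10: the words give orbits of lengths at least
  126, 16 and 6, the sixteen neighbours of a point and \<open>third_image\<close> bound the last
  two, and rigidity makes the final stabiliser trivial. The product 12096 is the order of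
  \<open>G\<^sub>2(2)\<close>.\<close>

lemma card_auts: "card auts = 126 * (16 * 6)"
proof -
  have b: "(0::int) \<in> base" "(9::int) \<in> base" "(10::int) \<in> base" by auto
  let ?A = "{g \<in> auts. g 0 = 0}"
  let ?B = "{g \<in> ?A. g 9 = 9}"
  let ?C = "{g \<in> ?B. g 10 = 10}"
  have pA: "perm_group base ?A" by (rule perm_group_stabilizer[OF auts.perm_group_axioms])
  have pB: "perm_group base ?B" by (rule perm_group_stabilizer[OF pA])
  have "(\<lambda>g. g 0) ` auts = base"
  proof
    show "(\<lambda>g. g 0) ` auts \<subseteq> base" using auts_base b(1) by blast
    show "base \<subseteq> (\<lambda>g. g 0) ` auts"
    proof
      fix i assume "i \<in> base"
      then obtain w where "actw w 0 = i" using reach_word by blast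
      then show "i \<in> (\<lambda>g. g 0) ` auts" using wperm_actw[OF b(1), of w] wperm_auts[of w] by (metis image_eqI)
    qed
  qed
  then have 1: "card auts = 126 * card ?A" using auts.orbit_stabilizer[of 0] by simp
  have "(\<lambda>g. g 9) ` ?A = {j. adj 0 j}"
  proof
    show "(\<lambda>g. g 9) ` ?A \<subseteq> {j. adj 0 j}" using auts_adj[OF _ b(1) third_candidates(6)] by force
    show "{j. adj 0 j} \<subseteq> (\<lambda>g. g 9) ` ?A"
    proof
      fix j assume "j \<in> {j. adj 0 j}"
      then obtain w where "actw w 0 = 0" "actw w 9 = j" using nbr_word by blast
      then show "j \<in> (\<lambda>g. g 9) ` ?A" using wperm_actw[of _ w] b wperm_auts[of w] by (intro image_eqI[of _ _ "wperm w"]) auto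
    qed
  qed
  then have 2: "card ?A = 16 * card ?B"
    using perm_group.orbit_stabilizer[OF pA, of 9] card_nbrs[OF b(1)] by simp
  have "(\<lambda>g. g 10) ` ?B = set (map fst third_words)"
  proof
    show "(\<lambda>g. g 10) ` ?B \<subseteq> set (map fst third_words)" using third_image by blast
    show "set (map fst third_words) \<subseteq> (\<lambda>g. g 10) ` ?B"
    proof
      fix j assume "j \<in> set (map fst third_words)"
      then obtain w where "(j, w) \<in> set third_words" by auto
      then have "actw w 0 = 0" "actw w 9 = 9" "actw w 10 = j"
        using third_words_ok unfolding list_all_iff by fastforce+
      then show "j \<in> (\<lambda>g. g 10) ` ?B" using wperm_actw[of _ w] b wperm_auts[of w] by (intro image_eqI[of _ _ "wperm w"]) auto
    qed
  qed
  moreover have "card (set (map fst third_words)) = 6" by (simp add: third_words_def)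
  moreover have "?C = {id}"
  proof -
    have "g = id" if "g \<in> auts" "g 0 = 0" "g 9 = 9" "g 10 = 10" for g
      using rigid[OF that(1) auts.id_mem] that by simp
    then show ?thesis using auts.id_mem by auto
  qed
  ultimately have "card ?B = 6" using perm_group.orbit_stabilizer[OF pB, of 10] by simp
  then show ?thesis using 1 2 by simp
qed

section \<open>Sylow subgroups for the primes 2 and 3\<close>

lemma memb3_iff: "memb3 t bs \<longleftrightarrow> t \<in> set bs"
  by (cases t) (induction bs, auto split: if_splits)

lemma dist3_iff: "nodup3 bs \<longleftrightarrow> distinct bs"
  by (induction bs) (auto simp: memb3_iff)

definition word_group :: "(gen list list \<times> int \<times> int) list \<Rightarrow> (int \<Rightarrow> int) set" where
  "word_group us = (\<lambda>(u, p, q). wperm (concat u)) ` set us"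

text \<open>Rigidity turns equality of base images into equality of permutations. So the listed
  elements are closed under the generators, hence under products with one another, and a finite set
  of permutations closed under products is a group.\<close>

lemma word_group:
  assumes cl: "closed_words gs us (map (\<lambda>(u, p, q). base_image (concat u)) us)"
    and gens: "list_all (\<lambda>(u, p, q). list_all (\<lambda>g. g \<in> set gs) u) us"
    and nil: "([], p0, q0) \<in> set us"
  shows "perm_group base (word_group us)" "word_group us \<subseteq> auts" "card (word_group us) = length us"
proof -
  let ?P = "word_group us" and ?f = "\<lambda>(u, p :: int, q :: int). wperm (concat u)"
  have b: "(0::int) \<in> base" "(9::int) \<in> base" "(10::int) \<in> base" by auto
  show sub: "?P \<subseteq> auts" unfolding word_group_def using wperm_auts by auto
  have img: "base_image w = (wperm w 0, wperm w 9, wperm w 10)" for w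
    using b by (simp add: base_image_def wperm_actw)
  have eqI: "wperm v = wperm w" if "base_image v = base_image w" for v w
    using rigid[OF wperm_auts wperm_auts, of v w] that unfolding img by simp
  have "distinct (map (\<lambda>(u, p, q). base_image (concat u)) us)"
    using cl unfolding closed_words_def dist3_iff by blast
  then have "distinct us" and inj: "inj_on (\<lambda>(u, p, q). base_image (concat u)) (set us)"
    by (auto simp: distinct_map)
  have "inj_on ?f (set us)"
  proof (rule inj_onI)
    fix x y assume "x \<in> set us" "y \<in> set us" "?f x = ?f y"
    then show "x = y" using inj_onD[OF inj, of x y] by (auto simp: img split: prod.splits)
  qed
  then show "card ?P = length us"
    unfolding word_group_def using card_image distinct_card[OF \<open>distinct us\<close>] by metis
  have gen: "wperm g \<circ> x \<in> ?P" if g: "g \<in> set gs" and x: "x \<in> ?P" for g x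
  proof -
    obtain u p q where u: "(u, p, q) \<in> set us" "x = wperm (concat u)" using x unfolding word_group_def by auto
    have "base_image (g @ concat u) \<in> set (map (\<lambda>(u, p, q). base_image (concat u)) us)"
      using cl u(1) g unfolding closed_words_def memb3_iff list_all_iff by fastforce
    then obtain v p' q' where v: "(v, p', q') \<in> set us" "base_image (g @ concat u) = base_image (concat v)" by auto
    have "wperm g \<circ> x = wperm (concat v)" using eqI[OF v(2)] u(2) by (simp add: wperm_append)
    then show ?thesis using v(1) unfolding word_group_def by force
  qed
  have words: "wperm (concat u) \<circ> x \<in> ?P" if "list_all (\<lambda>g. g \<in> set gs) u" "x \<in> ?P" for u x
    using that(1)
  proof (induction u)
    case (Cons g u)
    have "g \<in> set gs" using Cons(2) by simp
    moreover have "wperm (concat u) \<circ> x \<in> ?P" by (rule Cons(1)) (use Cons(2) in simp)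
    ultimately have "g \<in> set gs" "wperm (concat u) \<circ> x \<in> ?P" by blast+
    from gen[OF this] show ?case by (simp only: concat.simps wperm_append comp_assoc)
  qed (use that(2) in simp)
  have comp: "x \<circ> y \<in> ?P" if x: "x \<in> ?P" and y: "y \<in> ?P" for x y
  proof -
    obtain u p q where u: "(u, p, q) \<in> set us" "x = wperm (concat u)" using x unfolding word_group_def by auto
    have "list_all (\<lambda>g. g \<in> set gs) u" using gens u(1) unfolding list_all_iff by fastforce
    then show ?thesis unfolding u(2) by (rule words[OF _ y])
  qed
  have idm: "id \<in> ?P" unfolding word_group_def using nil by force
  have fin: "finite ?P" unfolding word_group_def by simp
  show "perm_group base ?P"
  proof
    show "inv x \<in> ?P" if x: "x \<in> ?P" for x
    proof -
      have xa: "x \<in> auts" using x sub by blast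
      \<comment> \<open>Left multiplication by \<open>x\<close> is injective on the finite set
        \<open>?P\<close>, hence onto, and so reaches \<open>id\<close>; the preimage is the
        inverse.\<close>
      have "inj_on ((\<circ>) x) ?P"
      proof (rule inj_onI)
        fix y z assume "x \<circ> y = x \<circ> z"
        then show "y = z" using auts_inj[OF xa] by (auto simp: fun_eq_iff)
      qed
      moreover have "(\<circ>) x ` ?P \<subseteq> ?P" using comp[OF x] by blast
      ultimately have "(\<circ>) x ` ?P = ?P" using endo_inj_surj[OF fin] by blast
      then obtain y where y: "y \<in> ?P" "x \<circ> y = id" using idm by (metis imageE)
      have "inv x = inv x \<circ> (x \<circ> y)" using y by simp
      also have "\<dots> = y" using auts.inv_comp[OF xa] by (simp add: comp_assoc[symmetric])
      finally show ?thesis using y by simp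
    qed
    show "x permutes base" if "x \<in> ?P" for x using that sub auts_permutes by blast
  qed (use fin idm comp in auto)
qed

definition fixes_base_line :: "(int \<Rightarrow> int) \<Rightarrow> bool" where
  "fixes_base_line s \<longleftrightarrow> (\<exists>i\<in>base. \<exists>j. adj i j \<and> s ` {i, j, thd i j} = {i, j, thd i j})"

lemma fixes_lineD:
  assumes "fixes_line w p q" and p: "p \<in> base"
  shows "fixes_base_line (wperm w)"
proof -
  have a: "adj p q" and P: "actw w p \<in> {p, q, thd p q}" and Q: "actw w q \<in> {p, q, thd p q}"
    using assms(1) unfolding fixes_line_def by (auto simp: memb_iff split: if_splits)
  note ap = adj_props[OF p a]
  let ?t = "wperm w" and ?l = "{p, q, thd p q}"
  have tp: "?t p \<in> ?l" "?t q \<in> ?l" using P Q wperm_actw[OF p] wperm_actw[OF ap(1)] by auto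
  have "?t (thd p q) = thd (?t p) (?t q)" using auts_thd[OF wperm_auts p a] by simp
  moreover have "?t p \<noteq> ?t q" using auts_inj[OF wperm_auts] ap(7) by blast
  moreover have "thd x y \<in> ?l" if "x \<in> ?l" "y \<in> ?l" "x \<noteq> y" for x y
  proof -
    have "thd q p = thd p q" "thd q (thd p q) = p" "thd (thd p q) p = q" "thd (thd p q) q = p"
      using ap adj_props(6)[OF ap(1,3)] adj_props(4)[OF p ap(5)] adj_props(4)[OF ap(1), of "thd p q"]
        adj_props(5)[OF ap(1,3)] by simp_all
    with ap(6) that show ?thesis by auto
  qed
  ultimately have "?t ` ?l \<subseteq> ?l" using tp by simp
  moreover have "inj_on ?t ?l" using auts_inj[OF wperm_auts] by (simp add: inj_on_def)
  moreover have "finite ?l" by simp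
  ultimately have "?t ` ?l = ?l" using endo_inj_surj[of ?l ?t] by blast
  then show ?thesis unfolding fixes_base_line_def using p a by blast
qed

text \<open>If the conjugate preserves a line, then \<open>s\<close> preserves the image of that
  line under \<open>g\<close>.\<close>

lemma fixes_base_line_conj:
  assumes s: "s \<in> auts" and g: "g \<in> auts" and f: "fixes_base_line (inv g \<circ> s \<circ> g)"
  shows "fixes_base_line s"
proof -
  obtain i j where ij: "i \<in> base" "adj i j" "(inv g \<circ> s \<circ> g) ` {i, j, thd i j} = {i, j, thd i j}"
    using f unfolding fixes_base_line_def by blast
  have gi: "g \<circ> inv g = id" by (rule auts.comp_inv[OF g])
  have "g ` (inv g \<circ> s \<circ> g) ` {i, j, thd i j} = (g \<circ> inv g \<circ> s) ` g ` {i, j, thd i j}"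
    by (simp only: image_comp comp_assoc)
  then have "s ` g ` {i, j, thd i j} = g ` {i, j, thd i j}" unfolding ij(3) gi id_comp by (rule sym)
  moreover have "g ` {i, j, thd i j} = {g i, g j, thd (g i) (g j)}"
    unfolding auts_thd[OF g ij(1,2)] by (simp only: image_insert image_empty)
  ultimately have "s ` {g i, g j, thd (g i) (g j)} = {g i, g j, thd (g i) (g j)}" by (simp only:)
  moreover have "g i \<in> base" using auts_base[OF g] ij(1) by blast
  ultimately show ?thesis
    unfolding fixes_base_line_def using auts_adj[OF g ij(1,2)] by blast
qed

lemma conj_funpow:
  assumes g: "g \<in> auts"
  shows "(inv g \<circ> s \<circ> g) ^^ n = inv g \<circ> s ^^ n \<circ> g"
proof (induction n)
  case (Suc n)
  have "(inv g \<circ> s \<circ> g) \<circ> (inv g \<circ> s ^^ n \<circ> g) = inv g \<circ> s \<circ> (g \<circ> inv g) \<circ> s ^^ n \<circ> g"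
    by (simp only: comp_assoc)
  then show ?case unfolding funpow.simps Suc auts.comp_inv[OF g] by (simp only: comp_id comp_assoc)
qed (simp add: auts.inv_comp[OF g])

lemma order_two_fixes_base_line:
  assumes s: "s \<in> auts" and s2: "s ^^ 2 = id"
  shows "fixes_base_line s"
proof -
  have gens: "list_all (\<lambda>(u, p, q). list_all (\<lambda>g. g \<in> set [x2, y2, z2]) u) sylow2"
    using gens2 by (simp add: list_all_iff case_prod_beta)
  have nil: "([], 0, 9) \<in> set sylow2" by (simp add: sylow2_def)
  note W = word_group[OF closed_words2 gens nil]
  have len: "length sylow2 = 64" by (simp add: sylow2_def)
  \<comment> \<open>The index 189 = 12096 / 64 is odd.\<close>
  have "card auts = card (word_group sylow2) * 189" using W(3) len card_auts by simp
  from auts.conj_into_subgroup[OF W(1,2) _ this _ s s2]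
  obtain g where g: "g \<in> auts" "inv g \<circ> s \<circ> g \<in> word_group sylow2" by auto
  then obtain u p q where u: "(u, p, q) \<in> set sylow2" "inv g \<circ> s \<circ> g = wperm (concat u)"
    unfolding word_group_def by auto
  have "wperm (concat u @ concat u) = (inv g \<circ> s \<circ> g) ^^ 2"
    unfolding wperm_append u(2)[symmetric] by (simp add: numeral_2_eq_2)
  also have "\<dots> = id" unfolding conj_funpow[OF g(1)] s2 using auts.inv_comp[OF g(1)] by simp
  finally have w: "wperm (concat u @ concat u) = id" .
  have "base_image (concat u @ concat u) = (0, 9, 10)"
    unfolding base_image_def using wperm_actw[of _ "concat u @ concat u"] w by auto
  then have f: "fixes_line (concat u) p q" 
    using sylow2_ok[unfolded list_all_iff, THEN bspec, OF u(1), unfolded prod.case] by (metis (full_types))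
  have "list_all (\<lambda>(u, p, q). p \<in> base) sylow2" by (simp add: sylow2_def)
  then have "p \<in> base" using u(1) unfolding list_all_iff by fastforce
  then have "fixes_base_line (inv g \<circ> s \<circ> g)" unfolding u(2) using fixes_lineD[OF f] by blast
  then show ?thesis by (rule fixes_base_line_conj[OF s g(1)])
qed

lemma order_three_fixes_base_line:
  assumes s: "s \<in> auts" and s3: "s ^^ 3 = id"
  shows "fixes_base_line s"
proof -
  have gens: "list_all (\<lambda>(u, p, q). list_all (\<lambda>g. g \<in> set [x3, y3]) u) sylow3"
    using gens3 by (simp add: list_all_iff case_prod_beta)
  have nil: "([], 0, 9) \<in> set sylow3" by (simp add: sylow3_def)
  note W = word_group[OF closed_words3 gens nil]
  have len: "length sylow3 = 27" by (simp add: sylow3_def)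
  \<comment> \<open>The index 448 = 12096 / 27 is prime to 3.\<close>
  have "card auts = card (word_group sylow3) * 448" using W(3) len card_auts by simp
  from auts.conj_into_subgroup[OF W(1,2) _ this _ s s3]
  obtain g where g: "g \<in> auts" "inv g \<circ> s \<circ> g \<in> word_group sylow3" by auto
  then obtain u p q where u: "(u, p, q) \<in> set sylow3" "inv g \<circ> s \<circ> g = wperm (concat u)"
    unfolding word_group_def by auto
  have "wperm (concat u @ concat u @ concat u) = (inv g \<circ> s \<circ> g) ^^ 3"
    unfolding wperm_append u(2)[symmetric] by (simp add: numeral_3_eq_3)
  also have "\<dots> = id" unfolding conj_funpow[OF g(1)] s3 using auts.inv_comp[OF g(1)] by simp
  finally have w: "wperm (concat u @ concat u @ concat u) = id" .
  have "base_image (concat u @ concat u @ concat u) = (0, 9, 10)"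
    unfolding base_image_def using wperm_actw[of _ "concat u @ concat u @ concat u"] w by auto
  then have f: "fixes_line (concat u) p q" 
    using sylow3_ok[unfolded list_all_iff, THEN bspec, OF u(1), unfolded prod.case] by (metis (full_types))
  have "list_all (\<lambda>(u, p, q). p \<in> base) sylow3" by (simp add: sylow3_def)
  then have "p \<in> base" using u(1) unfolding list_all_iff by fastforce
  then have "fixes_base_line (inv g \<circ> s \<circ> g)" unfolding u(2) using fixes_lineD[OF f] by blast
  then show ?thesis by (rule fixes_base_line_conj[OF s g(1)])
qed

section \<open>Functions vanishing on a line\<close>

lemma mod7_dvd: "(7::int) dvd x mod 7 - x"
  by (metis mod_eq_dvd_iff mod_mod_trivial)

lemma dvd7_mod: "(7::int) dvd x mod 7 \<longleftrightarrow> 7 dvd x"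
  by (simp add: dvd_eq_mod_eq_0)

text \<open>Fermat's little theorem makes \<open>x ^ 5\<close> the inverse of \<open>x\<close>
  modulo 7.\<close>

lemma inverse7:
  assumes "\<not> (7::int) dvd x"
  shows "x ^ 5 * x mod 7 = 1"
proof -
  have "x mod 7 \<in> {1, 2, 3, 4, 5, 6}"
    using assms by (auto simp: dvd_eq_mod_eq_0)
  then have "(x mod 7) ^ 6 mod 7 = 1" by auto
  then have "x ^ 6 mod 7 = 1" by (simp only: power_mod)
  then show ?thesis by (simp add: power_Suc2[symmetric] del: power_Suc2 power_Suc)
qed

lemma lin_mod7: "(a mod 7 + p * (b mod 7) + q * (c mod 7)) mod 7 = (a + p * b + q * c) mod (7::int)"
  by (intro mod_add_cong mod_mult_cong mod_mod_trivial refl)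

text \<open>The six-dimensional module over F_7 in coordinates, with integers read modulo 7: adding
  \<open>f i\<close> to the coordinate over \<open>i\<close> preserves all line equations exactly
  for these \<open>f\<close>.\<close>

definition potential :: "(int \<Rightarrow> int) \<Rightarrow> bool" where
  "potential f \<longleftrightarrow> (\<forall>i j k p q c. coll i j k p q c \<longrightarrow> 7 dvd f i + p * f j + q * f k)"

lemma potentialD: "potential f \<Longrightarrow> coll i j k p q c \<Longrightarrow> 7 dvd f i + p * f j + q * f k"
  unfolding potential_def by blast

lemma potential_lin:
  assumes f: "potential f" and g: "potential g"
  shows "potential (\<lambda>i. u * f i + v * g i)"
  unfolding potential_def
proof (intro allI impI)
  fix i j k p q c assume c: "coll i j k p q c"
  have "7 dvd u * (f i + p * f j + q * f k) + v * (g i + p * g j + q * g k)"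
    by (rule dvd_add[OF dvd_mult[OF potentialD[OF f c]] dvd_mult[OF potentialD[OF g c]]])
  then show "7 dvd (u * f i + v * g i) + p * (u * f j + v * g j) + q * (u * f k + v * g k)"
    by (simp add: algebra_simps)
qed

lemma potential_entry:
  assumes e: "\<And>i j k p q c. i \<in> base \<Longrightarrow> (j, k, p, q, c) \<in> set (lns i) \<Longrightarrow> 7 dvd f i + p * f j + q * f k"
  shows "potential f"
  unfolding potential_def
proof (intro allI impI)
  fix i j k p q c assume c: "coll i j k p q c"
  then consider "i \<in> base" "(j, k, p, q, c) \<in> set (lns i)" | "i \<in> base" "(k, j, q, p, c) \<in> set (lns i)"
    unfolding coll_entry by blast
  then show "7 dvd f i + p * f j + q * f k"
  proof cases
    case 1
    then show ?thesis by (rule e)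
  next
    case 2
    from e[OF 2] show ?thesis by (simp only: ac_simps)
  qed
qed

section \<open>Linear algebra over the field with seven elements\<close>

lemma length_rel3: "length (rel3 p q xs ys zs) = min (length xs) (min (length ys) (length zs))"
  by (induction p q xs ys zs rule: rel3.induct) auto

text \<open>\<open>dot7\<close> is linear modulo 7 in its first argument; the bound on the lengths
  keeps \<open>rel3\<close> from cutting off coordinates that \<open>S\<close> still uses.\<close>

lemma dot7_rel3:
  "length S \<le> length (rel3 p q xs ys zs) \<Longrightarrow> 7 dvd dot7 (rel3 p q xs ys zs) S - (dot7 xs S + p * dot7 ys S + q * dot7 zs S)"
proof (induction p q xs ys zs arbitrary: S rule: rel3.induct)
  case (1 p q x xs y ys z zs)
  show ?case
  proof (cases S)
    case (Cons s S')
    let ?r = "dot7 (rel3 p q xs ys zs) S'" and ?x = "dot7 xs S'" and ?y = "dot7 ys S'" and ?z = "dot7 zs S'"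
    have IH: "7 dvd ?r - (?x + p * ?y + q * ?z)" using 1 Cons by simp
    have "7 dvd (((x + p * y + q * z) * s + ?r) - ((x * s + ?x) + p * (y * s + ?y) + q * (z * s + ?z)))"
      using IH by (simp add: algebra_simps)
    then have eq: "((x + p * y + q * z) * s + ?r) mod 7 = ((x * s + ?x) + p * (y * s + ?y) + q * (z * s + ?z)) mod 7"
      by (simp add: mod_eq_dvd_iff)
    have "dot7 (rel3 p q (x # xs) (y # ys) (z # zs)) S mod 7 = ((x + p * y + q * z) * s + ?r) mod 7"
      unfolding Cons by (simp add: add7_def mul7_def mod_simps add.assoc)
    moreover have "(dot7 (x # xs) S + p * dot7 (y # ys) S + q * dot7 (z # zs) S) mod 7 =
        ((x * s + ?x) + p * (y * s + ?y) + q * (z * s + ?z)) mod 7"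
      unfolding Cons dot7.simps add7_def mul7_def lin_mod7 by (intro mod_add_cong mod_mult_cong mod_mod_trivial refl)
    ultimately have "dot7 (rel3 p q (x # xs) (y # ys) (z # zs)) S mod 7 =
        (dot7 (x # xs) S + p * dot7 (y # ys) S + q * dot7 (z # zs) S) mod 7" using eq by (simp only:)
    then show ?thesis by (simp only: mod_eq_dvd_iff)
  qed simp
qed simp_all

lemma dot7_zero: "list_all (\<lambda>x. x = 0) xs \<Longrightarrow> dot7 xs S = 0"
  by (induction xs S rule: dot7.induct) (simp_all add: add7_def mul7_def)

lemma dot7_dvd: "list_all (\<lambda>s. 7 dvd s) S \<Longrightarrow> 7 dvd dot7 xs S"
  by (induction xs S rule: dot7.induct) (simp_all add: add7_def mul7_def dvd7_mod)

text \<open>Values with coefficient zero may be forgotten, so a prefix already decides the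
  product.\<close>

lemma dot7_take: "list_all (\<lambda>x. x = 0) (drop n xs) \<Longrightarrow> dot7 xs (take n S) = dot7 xs S"
proof (induction xs S arbitrary: n rule: dot7.induct)
  case (1 x xs y ys)
  show ?case
  proof (cases n)
    case 0
    then show ?thesis using 1(2) dot7_zero[of "x # xs" "y # ys"] by simp
  next
    case (Suc m)
    then show ?thesis using 1 by simp
  qed
qed simp_all

lemma dot7_lincomb:
  assumes "length S \<le> length (lincomb cs vs)" "\<And>v. v \<in> set vs \<Longrightarrow> length S \<le> length v \<Longrightarrow> 7 dvd dot7 v S"
  shows "7 dvd dot7 (lincomb cs vs) S"
  using assms
proof (induction cs vs rule: lincomb.induct)
  case (1 c cs v vs)
  have l: "length S \<le> length (lincomb cs vs)" "length S \<le> length v" using 1(2) by (simp_all add: length_rel3)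
  have a: "7 dvd dot7 (lincomb cs vs) S" using 1(1)[OF l(1)] 1(3) by simp
  have b: "7 dvd dot7 v S" using 1(3) l(2) by simp
  have "7 dvd dot7 (lincomb (c # cs) (v # vs)) S - (dot7 (lincomb cs vs) S + c * dot7 v S + 0 * dot7 v S)"
    using dot7_rel3[of S c 0 "lincomb cs vs" v v] 1(2) by simp
  moreover have "7 dvd dot7 (lincomb cs vs) S + c * dot7 v S + 0 * dot7 v S" using a b by simp
  ultimately show ?case by (metis dvd_add diff_add_cancel)
qed (simp_all add: dot7_zero)

lemma basis_ok_closure:
  assumes step: "\<And>i j k p q c. coll i j k p q c \<Longrightarrow>
      rel3 p q (row seed_table i) (row seed_table j) (row seed_table k) = [0,0,0,0,0,0,0,0] \<Longrightarrow> Q i \<Longrightarrow> Q j \<Longrightarrow> Q k"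
  shows "basis_ok S steps \<Longrightarrow> \<forall>x\<in>set S. x \<in> base \<and> Q x \<Longrightarrow> \<forall>i\<in>base. Q i"
proof (induction S steps rule: basis_ok.induct)
  case (1 S)
  then show ?case by (simp only: basis_ok.simps all_pts memb_iff) blast
next
  case (2 S i j r)
  obtain k p q c where l: "line_eqn i j = (k, p, q, c)" by (rule prod_cases4)
  have m: "i \<in> set S" "j \<in> set S" "adj i j"
      "rel3 p q (row seed_table i) (row seed_table j) (row seed_table k) = [0,0,0,0,0,0,0,0]" "basis_ok (k # S) r"
    using 2(2) unfolding basis_ok.simps memb_iff l prod.case by blast+
  have ij: "i \<in> base" "Q i" "Q j" using 2(3) m(1,2) by blast+
  have c: "coll i j k p q c" unfolding coll_def using ij m l by blast
  have "Q k" by (rule step[OF c m(4) ij(2,3)])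
  then have "\<forall>x\<in>set (k # S). x \<in> base \<and> Q x"
    using 2(3) coll_facts(3)[OF c] by (simp only: list.set ball_simps simp_thms)
  from 2(1)[OF l[symmetric] refl refl m(5) this] show ?case .
qed

text \<open>The values of a potential at eight further points determine all others by propagation along
  lines; eight more lines give an invertible homogeneous linear system for them.\<close>

lemma potential_determined:
  assumes g: "potential g" and z: "7 dvd g 0" "7 dvd g 9" "7 dvd g 10" "7 dvd g 11" "7 dvd g 1" "7 dvd g 3"
    and i: "i \<in> base"
  shows "7 dvd g i"
proof -
  define S where "S = map g [23,22,19,111,60,5,70,52]"
  have S: "length S = 8" by (simp add: S_def)
  let ?Q = "\<lambda>i. 7 dvd g i - dot7 (row seed_table i) S"
  \<comment> \<open>Let \<open>i\<close> and \<open>j\<close> obey the seed formula. If the seed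
    relation of the line is zero, then \<open>k\<close> obeys it too; if \<open>k\<close> is already
    known to obey it, the relation becomes a linear condition on \<open>S\<close>. Both uses
    follow.\<close>
  have rel: "7 dvd dot7 (rel3 p q (row seed_table i) (row seed_table j) (row seed_table k)) S +
      q * (g k - dot7 (row seed_table k) S)"
    if c: "coll i j k p q c" and len: "8 \<le> length (rel3 p q (row seed_table i) (row seed_table j) (row seed_table k))"
      and Q: "?Q i" "?Q j" for i j k p q c
  proof -
    let ?d = "\<lambda>i. dot7 (row seed_table i) S"
    let ?r = "dot7 (rel3 p q (row seed_table i) (row seed_table j) (row seed_table k)) S"
    have 1: "7 dvd ?r - (?d i + p * ?d j + q * ?d k)" by (rule dot7_rel3) (simp only: S len)
    have "7 dvd (?r - (?d i + p * ?d j + q * ?d k)) + (g i + p * g j + q * g k) - ((g i - ?d i) + p * (g j - ?d j))"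
      by (intro dvd_diff dvd_add 1 potentialD[OF g c] Q dvd_mult)
    moreover have "(?r - (?d i + p * ?d j + q * ?d k)) + (g i + p * g j + q * g k) - ((g i - ?d i) + p * (g j - ?d j)) =
        ?r + q * (g k - ?d k)" by (simp add: algebra_simps)
    ultimately show ?thesis by (simp only:)
  qed
  have all: "\<forall>i\<in>base. ?Q i"
  proof (rule basis_ok_closure[OF _ basis_ok])
    fix i j k p q c
    assume c: "coll i j k p q c"
      and r: "rel3 p q (row seed_table i) (row seed_table j) (row seed_table k) = [0,0,0,0,0,0,0,0]" and Q: "?Q i" "?Q j"
    have "7 dvd dot7 [0,0,0,0,0,0,0,0] S + q * (g k - dot7 (row seed_table k) S)"
      using rel[OF c _ Q] unfolding r by simp
    then have "7 dvd q * (g k - dot7 (row seed_table k) S)" by (simp add: dot7_zero)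
    then show "?Q k" using inv7_exists(2)[OF c] inv7 by blast
  next
    show "\<forall>x\<in>set [52,70,5,60,111,19,22,23,3,1,11,10,9,0]. x \<in> base \<and> ?Q x"
      using z by (simp add: seed_basis dot7_zero S_def add7_def mul7_def mod_simps mod_eq_dvd_iff[symmetric])
  qed
  \<comment> \<open>On the seed lines all three points obey the formula, so the relation itself must
    annihilate \<open>S\<close>.\<close>
  have seed: "7 dvd dot7 v S" if v: "v \<in> set (map seed_rel seed_lines)" "length S \<le> length v" for v
  proof -
    obtain i j where ij: "(i, j) \<in> set seed_lines" "v = seed_rel (i, j)" using v(1) by auto
    obtain k p q c where l: "line_eqn i j = (k, p, q, c)" by (rule prod_cases4)
    have vr: "v = rel3 p q (row seed_table i) (row seed_table j) (row seed_table k)"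
      unfolding ij(2) seed_rel_def prod.case l by (rule refl)
    have "i \<in> base" using ij(1) by (auto simp: seed_lines_def)
    moreover have "adj i j" using seed_lines_ok(1) ij(1) unfolding list_all_iff by blast
    ultimately have c: "coll i j k p q c" unfolding coll_def using l by blast
    note f = coll_facts(1-3)[OF c]
    have "7 dvd dot7 v S + q * (g k - dot7 (row seed_table k) S)"
      unfolding vr by (rule rel[OF c]) (use v(2) S vr all f in simp_all)
    moreover have "7 dvd q * (g k - dot7 (row seed_table k) S)" using all f(3) by simp
    ultimately show ?thesis by (simp only: dvd_add_left_iff)
  qed
  have "\<forall>w\<in>set (map (\<lambda>cs. lincomb cs (map seed_rel seed_lines))
     [[1,6,6,6,2,0,2,4], [4,4,1,4,5,4,4,2], [3,3,6,3,2,3,1,5], [1,0,4,1,6,3,1,0], [4,1,3,3,1,0,4,4], [4,6,4,6,6,5,5,4], [3,4,4,4,6,1,6,5], [5,2,4,1,3,5,0,3]]).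
     length S \<le> length w \<longrightarrow> 7 dvd dot7 w S"
    by (auto intro: dot7_lincomb[OF _ seed] simp only: set_map)
  then have "list_all (\<lambda>s. 7 dvd s) S"
    unfolding seed_lines_ok(2) by (simp add: S_def add7_def mul7_def dvd7_mod mod_simps)
  then have "7 dvd dot7 (row seed_table i) S" by (rule dot7_dvd)
  moreover have "7 dvd g i - dot7 (row seed_table i) S" using all i by blast
  ultimately show ?thesis using dvd_add[of 7 "g i - dot7 (row seed_table i) S"] by fastforce
qed

lemma potential_dot7:
  assumes F: "length F = 6"
  shows "potential (\<lambda>i. dot7 (row co_table i) F)"
proof (rule potential_entry)
  fix i j k p q c assume i: "i \<in> base" and e: "(j, k, p, q, c) \<in> set (lns i)"
  have r: "rel3 p q (row co_table i) (row co_table j) (row co_table k) = [0,0,0,0,0,0]"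
    using co_ok[unfolded all_pts, THEN bspec, OF i, unfolded list_all_iff, THEN bspec, OF e] by (simp only: prod.case)
  have "7 dvd dot7 [0,0,0,0,0,0] F - (dot7 (row co_table i) F + p * dot7 (row co_table j) F + q * dot7 (row co_table k) F)"
    using dot7_rel3[of F p q "row co_table i" "row co_table j" "row co_table k"] unfolding r by (simp add: F)
  then have "7 dvd - (dot7 (row co_table i) F + p * dot7 (row co_table j) F + q * dot7 (row co_table k) F)"
    by (simp add: dot7_zero)
  then show "7 dvd dot7 (row co_table i) F + p * dot7 (row co_table j) F + q * dot7 (row co_table k) F"
    by (simp only: dvd_minus_iff)
qed

text \<open>The difference of \<open>f\<close> and the function interpolated from its six basis
  values is a potential vanishing at the basis points, hence everywhere. Together with
  \<open>potential_dot7\<close> this shows that the dimension is six.\<close>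

lemma potential_expand:
  assumes f: "potential f" and i: "i \<in> base"
  shows "7 dvd f i - dot7 (row co_table i) [f 0, f 9, f 10, f 11, f 1, f 3]"
proof -
  let ?F = "[f 0, f 9, f 10, f 11, f 1, f 3]"
  have p: "potential (\<lambda>i. 1 * f i + (-1) * dot7 (row co_table i) ?F)"
    by (rule potential_lin[OF f potential_dot7]) simp
  show ?thesis
    using potential_determined[OF p _ _ _ _ _ _ i]
    by (simp add: co_basis add7_def mul7_def mod_simps mod_eq_dvd_iff[symmetric])
qed

section \<open>The search for zeros of a potential\<close>

lemma killed_sound:
  "killed L S \<Longrightarrow> \<exists>(i, j)\<in>set L. dot7 (row co_table i) S = 0 \<and> dot7 (row co_table j) S = 0"
  by (induction L S rule: killed.induct) (auto split: if_splits)

text \<open>\<open>levels_ok\<close> makes each test exact although only a prefix of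
  \<open>F\<close> is known. The bound 7 lets the depth run from \<open>n\<close> to at most 6, the
  length of \<open>F\<close>.\<close>

lemma tree_search_sound:
  assumes "length F = 6" "set F \<subseteq> {0..6}"
  shows "tree_search Ls (take n F) \<Longrightarrow> levels_ok n Ls \<Longrightarrow> n + length Ls \<le> 7 \<Longrightarrow>
    \<exists>L\<in>set Ls. \<exists>(i, j)\<in>set L. dot7 (row co_table i) F = 0 \<and> dot7 (row co_table j) F = 0"
proof (induction Ls arbitrary: n)
  case (Cons L Ls)
  show ?case
  proof (cases "killed L (take n F)")
    case True
    then obtain i j where ij: "(i, j) \<in> set L" "dot7 (row co_table i) (take n F) = 0" "dot7 (row co_table j) (take n F) = 0"
      using killed_sound by blast
    have "list_all (\<lambda>x. x = 0) (drop n (row co_table i))" "list_all (\<lambda>x. x = 0) (drop n (row co_table j))"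
      using Cons(3) ij(1) unfolding levels_ok.simps list_all_iff[of _ L] by fast+
    then have "dot7 (row co_table i) F = 0" "dot7 (row co_table j) F = 0" using ij dot7_take by simp_all
    with ij(1) show ?thesis by auto
  next
    case False
    then have all: "list_all (\<lambda>v. tree_search Ls (take n F @ [v])) [0,1,2,3,4,5,6]" using Cons(2) by (simp only: tree_search.simps if_False)
    then have "Ls \<noteq> []" by auto
    then have n: "n < length F" using Cons(4) assms(1) by (cases Ls) auto
    then have "F ! n \<in> {0..6}" using assms(2) nth_mem by blast
    then have "F ! n \<in> set [0,1,2,3,4,5,6]" by auto
    then have "tree_search Ls (take (Suc n) F)" using all n unfolding list_all_iff take_Suc_conv_app_nth[OF n] by blast
    moreover have "levels_ok (Suc n) Ls" using Cons(3) by (simp only: levels_ok.simps)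
    ultimately show ?thesis using Cons(1)[of "Suc n"] Cons(4) by auto
  qed
qed simp

lemma potential_mod: "potential f \<Longrightarrow> potential (\<lambda>i. u * f i mod 7)"
  unfolding potential_def
proof (intro allI impI)
  fix i j k p q c assume "\<forall>i j k p q c. coll i j k p q c \<longrightarrow> 7 dvd f i + p * f j + q * f k" "coll i j k p q c"
  then have "7 dvd u * (f i + p * f j + q * f k)" by (intro dvd_mult) blast
  then have "u * (f i + p * f j + q * f k) mod 7 = 0" by (simp only: dvd_eq_mod_eq_0)
  then have "(u * f i mod 7 + p * (u * f j mod 7) + q * (u * f k mod 7)) mod 7 = 0"
    unfolding lin_mod7 by (simp add: algebra_simps)
  then show "7 dvd u * f i mod 7 + p * (u * f j mod 7) + q * (u * f k mod 7)" by (simp only: dvd_eq_mod_eq_0)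
qed

lemma potential_tree_search:
  assumes f: "potential f" and u: "u * u' mod 7 = 1"
    and s: "tree_search Ls (take n (map (\<lambda>i. u * f i mod 7) [0, 9, 10, 11, 1, 3]))"
    and l: "levels_ok n Ls" "n + length Ls \<le> 7" and b: "list_all (list_all (\<lambda>(i, j). i \<in> base \<and> j \<in> base)) Ls"
  shows "\<exists>L\<in>set Ls. \<exists>(i, j)\<in>set L. i \<in> base \<and> 7 dvd f i \<and> 7 dvd f j"
proof -
  let ?g = "\<lambda>i. u * f i mod 7"
  let ?F = "map ?g [0, 9, 10, 11, 1, 3]"
  have "x mod 7 \<in> {0..6}" for x :: int
    using pos_mod_bound[of 7 x] pos_mod_sign[of 7 x] by simp
  then have sub: "set ?F \<subseteq> {0..6}" by (simp only: list.set list.map insert_subset) blast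
  have "length ?F = 6" by simp
  from tree_search_sound[OF this sub s l] obtain L z where L0: "L \<in> set Ls" "z \<in> set L"
    "case z of (i, j) \<Rightarrow> dot7 (row co_table i) ?F = 0 \<and> dot7 (row co_table j) ?F = 0" by blast
  obtain i j where z: "z = (i, j)" by (rule prod.exhaust)
  note L = L0[unfolded z prod.case]
  have ij: "i \<in> base" "j \<in> base"
    using b[unfolded list_all_iff, THEN bspec, OF L(1), THEN bspec, OF L(2), unfolded prod.case] by blast+
  have "7 dvd f x" if "x \<in> base" "dot7 (row co_table x) ?F = 0" for x
  proof -
    have "7 dvd ?g x - dot7 (row co_table x) ?F"
      using potential_expand[OF potential_mod[OF f, of u] that(1)] by simp
    then have "7 dvd ?g x" unfolding that(2) by simp
    then show ?thesis using inv7[OF u] by (simp only: dvd7_mod)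
  qed
  then have "7 dvd f i" "7 dvd f j" using ij L(3) by blast+
  then show ?thesis using L(1,2) ij by (intro bexI[of _ L] bexI[of _ "(i, j)"]) simp_all
qed

lemma adj_0_9: "adj 0 9"
  by (rule third_candidates)

text \<open>If \<open>f\<close> is not zero at 9, scaling makes its value there 1; hence the single
  starting prefix [0, 1] for the values at 0 and 9.\<close>

lemma potential_zero_at_0:
  assumes f: "potential f" and f0: "7 dvd f 0"
  shows "\<exists>i\<in>base. \<exists>j. adj i j \<and> 7 dvd f i \<and> 7 dvd f j"
proof (cases "7 dvd f 9")
  case True
  then show ?thesis using f0 adj_0_9 by (intro bexI[of _ 0] exI[of _ 9]) auto
next
  case False
  define u where "u = f 9 ^ 5"
  have u: "u * f 9 mod 7 = 1" unfolding u_def by (rule inverse7[OF False])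
  have "u * f 0 mod 7 = 0" using f0 by simp
  then have "take 2 (map (\<lambda>i. u * f i mod 7) [0, 9, 10, 11, 1, 3]) = [0, 1]"
    using u by (simp add: numeral_2_eq_2)
  then have s: "tree_search tree0 (take 2 (map (\<lambda>i. u * f i mod 7) [0, 9, 10, 11, 1, 3]))" using tree_search0 by (simp only:)
  have b: "list_all (list_all (\<lambda>(i, j). i \<in> base \<and> j \<in> base)) tree0" "2 + length tree0 \<le> 7"
    by (simp_all add: tree0_def)
  obtain L i j where "L \<in> set tree0" "(i, j) \<in> set L" "i \<in> base" "7 dvd f i" "7 dvd f j"
    using potential_tree_search[OF f u s levels(1) b(2,1)] by auto
  then show ?thesis using tree_adj(1) unfolding list_all_iff by fast
qed

text \<open>A counterexample could be scaled to the value 1 at the point 0, the starting prefix of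
  the second search; the diagonal pairs in \<open>tree1\<close> close a branch at a single
  zero.\<close>

lemma potential_has_zero:
  assumes f: "potential f"
  shows "\<exists>i\<in>base. 7 dvd f i"
proof (rule ccontr)
  assume no: "\<not> ?thesis"
  then have f0: "\<not> 7 dvd f 0" by auto
  define u where "u = f 0 ^ 5"
  have u: "u * f 0 mod 7 = 1" unfolding u_def by (rule inverse7[OF f0])
  then have "take 1 (map (\<lambda>i. u * f i mod 7) [0, 9, 10, 11, 1, 3]) = [1]" by simp
  then have s: "tree_search tree1 (take 1 (map (\<lambda>i. u * f i mod 7) [0, 9, 10, 11, 1, 3]))" using tree_search1 by (simp only:)
  have b: "list_all (list_all (\<lambda>(i, j). i \<in> base \<and> j \<in> base)) tree1" "1 + length tree1 \<le> 7"
    by (simp_all add: tree1_def)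
  show False using potential_tree_search[OF f u s levels(2) b(2,1)] no by auto
qed

section \<open>Collineations of the cover\<close>

lemma cancel7: "\<not> 7 dvd p \<Longrightarrow> (7::int) dvd p * x \<longleftrightarrow> 7 dvd x"
  by (rule inv7[of _ "p ^ 5"]) (subst mult.commute, rule inverse7)

lemma Pts_iff: "P \<in> Pts \<longleftrightarrow> fst P \<in> base \<and> snd P \<in> {0..<7}"
  unfolding Pts_def by (rule mem_Times_iff)

lemma Pts_pair: "i \<in> base \<Longrightarrow> (i, x mod 7) \<in> Pts"
  unfolding Pts_iff by simp

lemma actw_base: "i \<in> base \<Longrightarrow> actw w i \<in> base"
  by (induction w) (simp_all only: actw.simps act_base)

definition lift :: "(int \<Rightarrow> int) \<Rightarrow> (int \<Rightarrow> int) \<Rightarrow> (int \<Rightarrow> int) \<Rightarrow> point \<Rightarrow> point" where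
  "lift s la be P = (s (fst P), (la (fst P) * snd P + be (fst P)) mod 7)"

definition line_rescaling :: "(int \<Rightarrow> int) \<Rightarrow> (int \<Rightarrow> int) \<Rightarrow> (int \<Rightarrow> int) \<Rightarrow> bool" where
  "line_rescaling s la be \<longleftrightarrow> (\<forall>i\<in>base. \<not> 7 dvd la i) \<and> (\<forall>i j k p q c. coll i j k p q c \<longrightarrow>
     (\<exists>p' q' c'. coll (s i) (s j) (s k) p' q' c' \<and> 7 dvd p' * la j - la i * p \<and> 7 dvd q' * la k - la i * q \<and>
        7 dvd be i + p' * be j + q' * be k + la i * c - c'))"

lemma lift_collineation:
  assumes s: "s \<in> auts" and r: "line_rescaling s la be"
  shows "geo.collineation (lift s la be)"
proof -
  let ?a = "lift s la be"
  have sub: "?a ` Pts \<subseteq> Pts"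
  proof (rule image_subsetI)
    fix P assume "P \<in> Pts"
    then have "s (fst P) \<in> base" using auts_base[OF s] unfolding Pts_iff by blast
    then show "?a P \<in> Pts" unfolding lift_def by (rule Pts_pair)
  qed
  have inj: "inj_on ?a Pts"
  proof (rule inj_onI)
    fix P Q assume PQ: "P \<in> Pts" "Q \<in> Pts" and eq: "?a P = ?a Q"
    have f: "fst P = fst Q" using eq auts_inj[OF s] unfolding lift_def by blast
    have "(la (fst P) * snd P + be (fst P)) mod 7 = (la (fst P) * snd Q + be (fst P)) mod 7"
      using eq f unfolding lift_def by simp
    then have "7 dvd (la (fst P) * snd P + be (fst P)) - (la (fst P) * snd Q + be (fst P))"
      by (simp only: mod_eq_dvd_iff)
    then have "7 dvd la (fst P) * (snd P - snd Q)" by (simp add: algebra_simps)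
    moreover have "\<not> 7 dvd la (fst P)" using r PQ(1) unfolding line_rescaling_def Pts_iff by blast
    ultimately have "7 dvd snd P - snd Q" using cancel7 by blast
    then have "snd P = snd Q" using eq7 PQ unfolding Pts_iff by blast
    with f show "P = Q" by (rule prod_eqI)
  qed
  have bij: "bij_betw ?a Pts Pts" using inj endo_inj_surj[OF geo.finite_Pt sub inj] unfolding bij_betw_def by blast
  have "tri (?a P) (?a Q) (?a R)" if t: "tri P Q R" for P Q R
  proof -
    obtain i x j y k z where PQR: "P = (i, x)" "Q = (j, y)" "R = (k, z)" by (metis surj_pair)
    obtain p q c where c: "coll i j k p q c" "7 dvd x + p * y + q * z - c"
      using t unfolding tri_def PQR fst_conv snd_conv by blast
    obtain p' q' c' where c': "coll (s i) (s j) (s k) p' q' c'" and d: "7 dvd p' * la j - la i * p"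
        "7 dvd q' * la k - la i * q" "7 dvd be i + p' * be j + q' * be k + la i * c - c'"
      using r c(1) unfolding line_rescaling_def by blast
    let ?X = "la i * x + be i" and ?Y = "la j * y + be j" and ?Z = "la k * z + be k"
    \<comment> \<open>The equation of the image is \<open>la i\<close> times the original one plus
      multiples of the three congruences in \<open>line_rescaling\<close>.\<close>
    have "7 dvd la i * (x + p * y + q * z - c) + (p' * la j - la i * p) * y + (q' * la k - la i * q) * z +
        (be i + p' * be j + q' * be k + la i * c - c')"
      using c(2) d by (meson dvd_add dvd_mult dvd_mult2)
    then have "7 dvd (?X + p' * ?Y + q' * ?Z) - c'" by (simp add: algebra_simps)
    then have "7 dvd ?X mod 7 + p' * (?Y mod 7) + q' * (?Z mod 7) - c'"
      unfolding mod_eq_dvd_iff[symmetric] lin_mod7 .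
    moreover have "?a P \<in> Pts" "?a Q \<in> Pts" "?a R \<in> Pts" using t sub unfolding tri_def by blast+
    ultimately show ?thesis using c' unfolding tri_def PQR lift_def fst_conv snd_conv by blast
  qed
  with bij show ?thesis unfolding geo.collineation_def by blast
qed

text \<open>With slope 1 a line equation changes only by the homogeneous sum of the shifts, which
  vanishes for a potential.\<close>

lemma lift_translation:
  assumes "potential f"
  shows "geo.collineation (lift id (\<lambda>_. 1) f)"
proof (rule lift_collineation[OF auts.id_mem], unfold line_rescaling_def, intro conjI ballI allI impI)
  fix i j k p q c assume c: "coll i j k p q c"
  have "7 dvd f i + p * f j + q * f k + 1 * c - c" using potentialD[OF assms c] by simp
  then show "\<exists>p' q' c'. coll (id i) (id j) (id k) p' q' c' \<and> 7 dvd p' * 1 - 1 * p \<and> 7 dvd q' * 1 - 1 * q \<and>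
      7 dvd f i + p' * f j + q' * f k + 1 * c - c'"
    using c by (intro exI[of _ p] exI[of _ q] exI[of _ c]) simp
qed simp

lemma col_ok_rescaling:
  assumes c: "col_ok s la be" and b: "\<And>i. i \<in> base \<Longrightarrow> s i \<in> base" and la: "\<forall>i\<in>base. \<not> 7 dvd la i"
  shows "line_rescaling s la be"
  unfolding line_rescaling_def
proof (intro conjI allI impI la)
  fix i j k p q c' assume l: "coll i j k p q c'"
  let ?G = "\<lambda>j k p q p' q' c''. 7 dvd p' * la j - la i * p \<and> 7 dvd q' * la k - la i * q \<and>
    7 dvd be i + p' * be j + q' * be k + la i * c' - c''"
  have i: "i \<in> base" by (rule coll_facts(1)[OF l])
  have e: "\<exists>p' q' c''. coll (s i) (s j) (s k) p' q' c'' \<and> ?G j k p q p' q' c''"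
    if m: "(j, k, p, q, c') \<in> set (lns i)" for j k p q
  proof -
    obtain k' p' q' c'' where L: "line_eqn (s i) (s j) = (k', p', q', c'')" by (rule prod_cases4)
    note c[unfolded col_ok_def all_pts, THEN bspec, OF i, unfolded list_all_iff, THEN bspec, OF m, unfolded prod.case L prod.case]
    then have H: "k' = s k" "mul7 p' (la j) = mul7 (la i) p" "mul7 q' (la k) = mul7 (la i) q"
      "add7 (be i) (add7 (mul7 p' (be j)) (add7 (mul7 q' (be k)) (mul7 (la i) c'))) = c''" by blast+
    have "thd (s i) (s j) \<in> base" unfolding thd_def L H(1) fst_conv by (rule b[OF row_entry(2)[OF i m]])
    then have "coll (s i) (s j) (s k) p' q' c''"
      using adj_if_thd_base b[OF i] L H(1) unfolding coll_def by blast
    moreover have "7 dvd p' * la j - la i * p" "7 dvd q' * la k - la i * q"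
      using H(2,3) unfolding mul7_def mod_eq_dvd_iff .
    moreover have "(be i + p' * be j + q' * be k + la i * c') mod 7 = c''"
      using H(4) by (simp add: add7_def mul7_def mod_simps add.assoc)
    then have "7 dvd be i + p' * be j + q' * be k + la i * c' - c''"
      using mod7_dvd[of "be i + p' * be j + q' * be k + la i * c'"] by (simp only: dvd_diff_commute)
    ultimately show ?thesis by blast
  qed
  from l consider "(j, k, p, q, c') \<in> set (lns i)" | "(k, j, q, p, c') \<in> set (lns i)" unfolding coll_entry by blast
  then show "\<exists>p' q' c''. coll (s i) (s j) (s k) p' q' c'' \<and> ?G j k p q p' q' c''"
  proof cases
    case 1
    then show ?thesis by (rule e)
  next
    case 2
    from e[OF this] obtain q' p' c'' where h: "coll (s i) (s k) (s j) q' p' c''" "?G k j q p q' p' c''" by blast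
    have "be i + q' * be k + p' * be j + la i * c' - c'' = be i + p' * be j + q' * be k + la i * c' - c''" by simp
    then have "?G j k p q p' q' c''" using h(2) by (simp only: simp_thms)
    then show ?thesis using coll_swap[OF h(1)] by blast
  qed
qed

lemma gen_rescaling:
  assumes "g \<noteq> Go"
  obtains la be where "line_rescaling (act g) la be"
proof (cases g)
  case Ga
  have "line_rescaling (act g) (\<lambda>_. 1) (row a_shift_table)"
    by (rule col_ok_rescaling) (simp_all only: Ga act.simps col_ok_a act_base[of _ Ga, unfolded act.simps], simp)
  then show thesis by (rule that)
next
  case Gb
  have sl: "\<forall>i\<in>base. \<not> 7 dvd row b_slope_table i"
  proof
    fix i assume "i \<in> base"
    then have "1 \<le> row b_slope_table i" "row b_slope_table i < 7" using b_slopes unfolding all_pts by blast+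
    then show "\<not> 7 dvd row b_slope_table i" by (intro zdvd_not_zless) simp_all
  qed
  have "line_rescaling (act g) (row b_slope_table) (row b_shift_table)"
    by (rule col_ok_rescaling[OF _ _ sl]) (simp_all only: Gb act.simps col_ok_b act_base[of _ Gb, unfolded act.simps])
  then show thesis by (rule that)
qed (use assms in simp)

lemma gperm_rescaling:
  assumes r: "line_rescaling (act g) la be"
  shows "line_rescaling (gperm g) la be"
  unfolding line_rescaling_def
proof (intro conjI allI impI)
  show "\<forall>i\<in>base. \<not> 7 dvd la i" using r unfolding line_rescaling_def by blast
  fix i j k p q c assume c: "coll i j k p q c"
  have "gperm g i = act g i" "gperm g j = act g j" "gperm g k = act g k"
    using coll_facts(1-3)[OF c] by (simp_all only: gperm_def if_True)
  then show "\<exists>p' q' c'. coll (gperm g i) (gperm g j) (gperm g k) p' q' c' \<and> 7 dvd p' * la j - la i * p \<and>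
      7 dvd q' * la k - la i * q \<and> 7 dvd be i + p' * be j + q' * be k + la i * c - c'"
    using r c unfolding line_rescaling_def by (simp only:)
qed

lemma word_lift:
  "list_all (\<lambda>g. g \<noteq> Go) w \<Longrightarrow> \<exists>a. geo.collineation a \<and> (\<forall>P\<in>Pts. fst (a P) = actw w (fst P))"
proof (induction w)
  case Nil
  have "\<forall>P\<in>Pts. fst (id P) = actw [] (fst P)" by simp
  then show ?case using geo.collineation_id by blast
next
  case (Cons g w)
  then obtain a where a: "geo.collineation a" "\<forall>P\<in>Pts. fst (a P) = actw w (fst P)" by auto
  obtain la be where r: "line_rescaling (act g) la be" using Cons(2) gen_rescaling[of g] by auto
  have "fst ((lift (gperm g) la be \<circ> a) P) = actw (g # w) (fst P)" if P: "P \<in> Pts" for P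
  proof -
    have e: "fst (a P) = actw w (fst P)" using a(2) P by blast
    have "actw w (fst P) \<in> base" using P actw_base unfolding Pts_iff by blast
    then show ?thesis by (simp only: comp_apply lift_def fst_conv e gperm_def if_True actw.simps)
  qed
  then show ?case
    using geo.collineation_comp[OF lift_collineation[OF gperm_auts gperm_rescaling[OF r]] a(1)] by blast
qed

text \<open>This is the conjugate of the translation by \<open>f\<close> under a lift of
  \<open>s\<close>: the shift \<open>f (s i)\<close> is divided by the slope, and
  \<open>la i ^ 5\<close> is the inverse slope.\<close>

lemma potential_pullback:
  assumes f: "potential f" and r: "line_rescaling s la be"
  shows "potential (\<lambda>i. la i ^ 5 * f (s i))"
  unfolding potential_def
proof (intro allI impI)
  fix i j k p q c assume c: "coll i j k p q c"
  obtain p' q' c' where c': "coll (s i) (s j) (s k) p' q' c'" and d: "7 dvd p' * la j - la i * p" "7 dvd q' * la k - la i * q"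
    using r c unfolding line_rescaling_def by blast
  have n: "\<not> 7 dvd la i" "\<not> 7 dvd la j" "\<not> 7 dvd la k" using r coll_facts(1-3)[OF c] unfolding line_rescaling_def by blast+
  have inv: "7 dvd x ^ 5 * x - 1" if "\<not> 7 dvd x" for x :: int
    using inverse7[OF that] mod_eq_dvd_iff[of "x ^ 5 * x" 7 1] by simp
  have eq: "A * (u * F + p * (v * G) + q * (w * H)) = (F + p' * G + q' * H) + (u * A - 1) * F +
      p' * ((v * B - 1) * G) + q' * ((w * C - 1) * H) - (p' * B - A * p) * (v * G) - (q' * C - A * q) * (w * H)"
    for A B C u v w F G H :: int by (simp add: algebra_simps)
  have "7 dvd la i * (la i ^ 5 * f (s i) + p * (la j ^ 5 * f (s j)) + q * (la k ^ 5 * f (s k)))"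
    unfolding eq[where B = "la j" and C = "la k"]
    by (intro dvd_diff dvd_add potentialD[OF f c'] dvd_mult[OF dvd_mult2] dvd_mult2 inv n d)
  then show "7 dvd la i ^ 5 * f (s i) + p * (la j ^ 5 * f (s j)) + q * (la k ^ 5 * f (s k))"
    using cancel7[OF n(1)] by blast
qed

lemma potential_word:
  "list_all (\<lambda>g. g \<noteq> Go) w \<Longrightarrow> potential f \<Longrightarrow> \<exists>f'. potential f' \<and> (\<forall>i\<in>base. 7 dvd f' i \<longleftrightarrow> 7 dvd f (actw w i))"
proof (induction w arbitrary: f)
  case Nil
  then show ?case by auto
next
  case (Cons g w)
  obtain la be where r: "line_rescaling (act g) la be" using Cons(2) gen_rescaling[of g] by auto
  obtain f' where f': "potential f'" "\<forall>i\<in>base. 7 dvd f' i \<longleftrightarrow> 7 dvd la (actw w i) ^ 5 * f (act g (actw w i))"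
    using Cons(1)[OF _ potential_pullback[OF Cons(3) r]] Cons(2) by auto
  have "7 dvd la i ^ 5 * x \<longleftrightarrow> 7 dvd x" if "i \<in> base" for i x
    using r that inv7[OF inverse7[of "la i"]] unfolding line_rescaling_def by blast
  then have "\<forall>i\<in>base. 7 dvd f' i \<longleftrightarrow> 7 dvd f (actw (g # w) i)"
    using f'(2) actw_base unfolding actw.simps by blast
  with f'(1) show ?case by blast
qed

text \<open>Some zero exists, and a lifted word moves it to the point 0, so the search for a line
  has to cover only potentials vanishing there. Zeros at two collinear points suffice, as the line
  equation forces the third.\<close>

lemma potential_vanishes_on_line:
  assumes f: "potential f"
  shows "\<exists>i\<in>base. \<exists>j. adj i j \<and> 7 dvd f i \<and> 7 dvd f j"
proof -
  obtain z where z: "z \<in> base" "7 dvd f z" using potential_has_zero[OF f] by blast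
  obtain w where w: "list_all (\<lambda>g. g \<noteq> Go) w" "actw w 0 = z" using reach_word[OF z(1)] by blast
  obtain f' where f': "potential f'" "\<forall>i\<in>base. 7 dvd f' i \<longleftrightarrow> 7 dvd f (actw w i)"
    using potential_word[OF w(1) f] by blast
  have "(0::int) \<in> base" by simp
  then have "7 dvd f' 0" using f'(2) w(2) z(2) by blast
  then obtain i j where ij: "i \<in> base" "adj i j" "7 dvd f' i" "7 dvd f' j" using potential_zero_at_0[OF f'(1)] by blast
  have j: "j \<in> base" by (rule adj_props(1)[OF ij(1,2)])
  have "adj (actw w i) (actw w j)"
    using auts_adj[OF wperm_auts ij(1,2), of w] by (simp only: wperm_actw[OF ij(1)] wperm_actw[OF j])
  then show ?thesis using f'(2) ij j actw_base by blast
qed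

section \<open>The automorphism of the base induced by a collineation\<close>

lemma collineation_Pts: "geo.collineation a \<Longrightarrow> P \<in> Pts \<Longrightarrow> a P \<in> Pts"
  unfolding geo.collineation_def by (rule bij_betwE[THEN bspec]) blast

lemma collineation_surj: "geo.collineation a \<Longrightarrow> Q \<in> Pts \<Longrightarrow> \<exists>P\<in>Pts. Q = a P"
  unfolding geo.collineation_def bij_betw_def by blast

lemma collineation_tri: "geo.collineation a \<Longrightarrow> tri P Q R \<Longrightarrow> tri (a P) (a Q) (a R)"
  unfolding geo.collineation_def by blast

lemma adj_iff_tri:
  assumes "P \<in> Pts" "Q \<in> Pts"
  shows "adj (fst P) (fst Q) \<longleftrightarrow> (\<exists>R. tri P Q R)"
  using tri_exists[OF assms] tri_coll coll_thd by blast

lemma collineation_adj: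
  assumes a: "geo.collineation a" and P: "P \<in> Pts" and Q: "Q \<in> Pts"
  shows "adj (fst (a P)) (fst (a Q)) \<longleftrightarrow> adj (fst P) (fst Q)"
  unfolding adj_iff_tri[OF P Q] adj_iff_tri[OF collineation_Pts[OF a P] collineation_Pts[OF a Q]]
proof
  assume "\<exists>R. tri (a P) (a Q) R"
  then obtain R where R: "tri (a P) (a Q) R" by blast
  then have "R \<in> Pts" unfolding tri_def by blast
  then obtain R' where "R' \<in> Pts" "R = a R'" using collineation_surj[OF a] by blast
  then show "\<exists>R. tri P Q R" using R geo.collineation_tri_iff[OF a P Q] by blast
qed (use collineation_tri[OF a] in blast)

text \<open>Transitivity moves \<open>i\<close> to the point 0, for which \<open>nbr_sets\<close>
  supplies a neighbour that \<open>j\<close> lacks.\<close>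

lemma nbrs_inj:
  assumes i: "i \<in> base" and j: "j \<in> base" and sub: "\<And>k. k \<in> base \<Longrightarrow> adj i k \<Longrightarrow> adj j k"
  shows "i = j"
proof (rule ccontr)
  assume ne: "i \<noteq> j"
  obtain w where w: "actw w 0 = i" using reach_word[OF i] by blast
  let ?s = "wperm w"
  have z: "(0::int) \<in> base" by simp
  have s0: "?s 0 = i" using wperm_actw[OF z] w by simp
  define j' where "j' = inv ?s j"
  have sj: "?s j' = j" unfolding j'_def by (rule permutes_inverses(1)[OF auts_permutes[OF wperm_auts]])
  have j': "j' \<in> base" using auts_base[OF wperm_auts, of w j'] sj j by simp
  have "j' \<noteq> 0" using sj s0 ne by blast
  from nbr_sets[unfolded all_pts, THEN bspec, OF j', unfolded if_not_P[OF this]]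
  obtain k where k: "adj 0 k" "\<not> adj j' k" unfolding list_all_iff adj_iff[of 0] by blast
  have kb: "k \<in> base" by (rule adj_props(1)[OF z k(1)])
  have "adj i (?s k)" using auts_adj[OF wperm_auts z k(1), of w] s0 by (simp only:)
  then have "adj j (?s k)" using sub auts_base[OF wperm_auts] kb by blast
  then show False using auts_adj_iff[OF wperm_auts j' kb, of w] k(2) sj by simp
qed

definition proj :: "(point \<Rightarrow> point) \<Rightarrow> int \<Rightarrow> int" where
  "proj a i = (if i \<in> base then fst (a (i, 0)) else i)"

text \<open>Two points lie in the same fibre iff they are collinear with the same points.\<close>

lemma proj_fst:
  assumes a: "geo.collineation a" and P: "P \<in> Pts"
  shows "fst (a P) = proj a (fst P)"
proof -
  have i: "fst P \<in> base" using P unfolding Pts_iff by blast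
  let ?Q = "(fst P, 0 mod 7) :: point"
  have Q: "?Q \<in> Pts" by (rule Pts_pair[OF i])
  have b: "fst (a P) \<in> base" "fst (a ?Q) \<in> base"
    using collineation_Pts[OF a P] collineation_Pts[OF a Q] unfolding Pts_iff by blast+
  have "fst (a P) = fst (a ?Q)"
  proof (rule nbrs_inj[OF b])
    fix k assume k: "k \<in> base" "adj (fst (a P)) k"
    have R: "(k, 0 mod 7) \<in> Pts" by (rule Pts_pair[OF k(1)])
    obtain R' where R': "R' \<in> Pts" "(k, 0 mod 7) = a R'" using collineation_surj[OF a R] by blast
    have fk: "fst (a R') = k" unfolding R'(2)[symmetric] by simp
    have "adj (fst P) (fst R')" using collineation_adj[OF a P R'(1)] k(2) unfolding fk by blast
    then show "adj (fst (a ?Q)) k" using collineation_adj[OF a Q R'(1)] unfolding fk fst_conv by blast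
  qed
  then show ?thesis unfolding proj_def using i by simp
qed

lemma proj_auts:
  assumes a: "geo.collineation a"
  shows "proj a \<in> auts"
proof -
  have P: "(i, 0) \<in> Pts" if "i \<in> base" for i using Pts_pair[OF that, of 0] by simp
  have sub: "proj a ` base \<subseteq> base"
  proof (rule image_subsetI)
    fix i assume i: "i \<in> base"
    show "proj a i \<in> base" using proj_fst[OF a P[OF i]] collineation_Pts[OF a P[OF i]] unfolding Pts_iff by simp
  qed
  have "base \<subseteq> proj a ` base"
  proof
    fix i assume i: "i \<in> base"
    obtain Q where Q: "Q \<in> Pts" "(i, 0) = a Q" using collineation_surj[OF a P[OF i]] by blast
    have "i = proj a (fst Q)" using proj_fst[OF a Q(1)] unfolding Q(2)[symmetric] by simp
    then show "i \<in> proj a ` base" using Q(1) unfolding Pts_iff by blast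
  qed
  then have "proj a ` base = base" using sub by blast
  then have "bij_betw (proj a) base base" by (simp add: bij_betw_def eq_card_imp_inj_on)
  then have perm: "proj a permutes base" by (rule bij_imp_permutes) (simp only: proj_def if_False)
  have "adj (proj a i) (proj a j) \<and> thd (proj a i) (proj a j) = proj a (thd i j)"
    if i: "i \<in> base" and ij: "adj i j" for i j
  proof -
    have j: "j \<in> base" by (rule adj_props(1)[OF i ij])
    have "adj (fst (i, 0)) (fst (j, 0))" using ij by simp
    then obtain R where R: "tri (i, 0) (j, 0) R" using tri_exists[OF P[OF i] P[OF j]] by blast
    have RP: "R \<in> Pts" using R unfolding tri_def by blast
    have t: "thd i j = fst R" using tri_coll[OF R] coll_thd by fastforce
    have "fst (a (i, 0)) = proj a i" "fst (a (j, 0)) = proj a j" "fst (a R) = proj a (thd i j)"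
      using proj_fst[OF a P[OF i]] proj_fst[OF a P[OF j]] proj_fst[OF a RP] t by simp_all
    then show ?thesis using tri_coll[OF collineation_tri[OF a R]] coll_thd by metis
  qed
  with perm show ?thesis unfolding auts_def by blast
qed

lemma proj_eqI:
  assumes "s permutes base" "\<And>P. P \<in> Pts \<Longrightarrow> fst (a P) = s (fst P)"
  shows "proj a = s"
proof
  fix i
  show "proj a i = s i"
  proof (cases "i \<in> base")
    case True
    have "(i, 0) \<in> Pts" using Pts_pair[OF True, of 0] by simp
    then show ?thesis using assms(2)[of "(i, 0)"] True by (simp only: proj_def if_True fst_conv)
  next
    case False
    then show ?thesis unfolding permutes_not_in[OF assms(1) False] by (simp only: proj_def if_False)
  qed
qed

lemma proj_comp:
  assumes a: "geo.collineation a" and b: "geo.collineation b"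
  shows "proj (a \<circ> b) = proj a \<circ> proj b"
proof (rule proj_eqI)
  show "proj a \<circ> proj b permutes base" using auts_permutes proj_auts a b permutes_compose by blast
  show "fst ((a \<circ> b) P) = (proj a \<circ> proj b) (fst P)" if "P \<in> Pts" for P
    using proj_fst[OF a collineation_Pts[OF b that]] proj_fst[OF b that] by simp
qed

lemma proj_trivial: "(\<And>P. P \<in> Pts \<Longrightarrow> a P = P) \<Longrightarrow> proj a = id"
  by (rule proj_eqI[OF permutes_id]) simp

lemma proj_funpow:
  assumes a: "geo.collineation a"
  shows "proj (a ^^ n) = proj a ^^ n"
proof (induction n)
  case 0
  show ?case by (simp add: proj_trivial)
next
  case (Suc n)
  then show ?case by (simp only: funpow.simps proj_comp[OF a geo.collineation_funpow[OF a]])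
qed

text \<open>The rigidity certificate doubles as a proof of connectedness: every step yields a point
  adjacent to one reached before.\<close>

lemma connected:
  assumes Q0: "Q 0" and Q: "\<And>i j. i \<in> base \<Longrightarrow> adj i j \<Longrightarrow> Q i \<Longrightarrow> Q j" and i: "i \<in> base"
  shows "Q i"
proof -
  have "rigid_ok S steps \<Longrightarrow> \<forall>x\<in>set S. x \<in> base \<and> Q x \<Longrightarrow> \<forall>i\<in>base. Q i" for S steps
  proof (induction S steps rule: rigid_ok.induct)
    case (1 S)
    then show ?case by (simp only: rigid_ok.simps all_pts memb_iff) blast
  next
    case (2 S p q us vs r)
    have m: "p \<in> set S" "adj p q" using 2(3) unfolding rigid_ok.simps memb_iff by blast+
    have p: "p \<in> base" "Q p" using 2(4) m(1) by blast+
    note ap = adj_props[OF p(1) m(2)]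
    show ?case
    proof (cases "us @ vs = []")
      case True
      then have ok: "rigid_ok (thd p q # S) r" using 2(3) unfolding rigid_ok.simps by (simp only: if_True)
      have "\<forall>x\<in>set (thd p q # S). x \<in> base \<and> Q x"
        using 2(4) ap(2) Q[OF p(1) ap(5) p(2)] by (simp only: list.set ball_simps simp_thms)
      then show ?thesis by (rule 2(1)[OF True ok])
    next
      case False
      then have ok: "rigid_ok (q # S) r" using 2(3) unfolding rigid_ok.simps by (simp only: if_False)
      have "\<forall>x\<in>set (q # S). x \<in> base \<and> Q x"
        using 2(4) ap(1) Q[OF p(1) m(2) p(2)] by (simp only: list.set ball_simps simp_thms)
      then show ?thesis by (rule 2(2)[OF False ok])
    qed
  qed
  moreover have "\<forall>x\<in>set [0, 9, 10]. x \<in> base \<and> Q x"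
    using Q0 Q[of 0 9] Q[of 0 10] third_candidates(5,6) by simp
  ultimately show ?thesis using rigid_ok i by blast
qed

text \<open>On a line \<open>x + p * y + q * z = c\<close> one can move \<open>x\<close> and \<open>y\<close> against each other with \<open>z\<close> fixed; so increments in one fibre
  do not depend on the base point, and adjacent fibres have the same slope.\<close>

lemma affine_on_fibres:
  assumes a: "geo.collineation a" and fib: "\<And>P. P \<in> Pts \<Longrightarrow> fst (a P) = fst P"
  obtains m f where "\<And>P. P \<in> Pts \<Longrightarrow> a P = (fst P, (m * snd P + f (fst P)) mod 7)" "7 dvd m - 1 \<Longrightarrow> potential f"
proof -
  define h where "h i x = snd (a (i, x mod 7))" for i x
  have line: "7 dvd h i x + p * h j y + q * h k z - c"
    if c: "coll i j k p q c" and e: "7 dvd x + p * y + q * z - c" for i j k p q c x y z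
  proof -
    note f = coll_facts(1-3)[OF c]
    have P: "(i, x mod 7) \<in> Pts" "(j, y mod 7) \<in> Pts" "(k, z mod 7) \<in> Pts" by (rule Pts_pair, rule f)+
    have "7 dvd x mod 7 + p * (y mod 7) + q * (z mod 7) - c"
      using e unfolding mod_eq_dvd_iff[symmetric] lin_mod7 .
    then have "tri (i, x mod 7) (j, y mod 7) (k, z mod 7)" using P c unfolding tri_def fst_conv snd_conv by blast
    then have "tri (a (i, x mod 7)) (a (j, y mod 7)) (a (k, z mod 7))" by (rule collineation_tri[OF a])
    then obtain p' q' c' where "coll i j k p' q' c'" "7 dvd h i x + p' * h j y + q' * h k z - c'"
      unfolding tri_def fib[OF P(1)] fib[OF P(2)] fib[OF P(3)] fst_conv h_def by blast
    then show ?thesis using coll_det[OF c] by blast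
  qed
  have step: "7 dvd (h i (x + p * t) - h i x) + p * (h j (y - t) - h j y)"
    if c: "coll i j k p q c" for i j k p q c x y t
  proof -
    obtain q' where q': "q * q' mod 7 = 1" using inv7_exists[OF c] by blast
    then have "7 dvd q * q' - 1" using mod_eq_dvd_iff[of "q * q'" 7 1] by simp
    then have "7 dvd (c - x - p * y) * (q * q' - 1)" by (rule dvd_mult)
    then have z: "7 dvd x + p * y + q * (q' * (c - x - p * y)) - c" by (simp add: algebra_simps)
    let ?z = "q' * (c - x - p * y)"
    have "7 dvd (x + p * t) + p * (y - t) + q * ?z - c" using z by (simp add: algebra_simps)
    from dvd_diff[OF line[OF c this] line[OF c z]] show ?thesis by (simp add: algebra_simps)
  qed
  have per: "h i (x mod 7) = h i x" for i x unfolding h_def by simp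
  define m where "m i = h i 1 - h i 0" for i
  have succ: "7 dvd (h i (x + 1) - h i x) - m i" if i: "i \<in> base" for i x
  proof -
    have "card {j. adj i j} \<noteq> 0" using card_nbrs[OF i] by simp
    then obtain j where "adj i j" by (metis (no_types) card.empty empty_Collect_eq)
    then obtain p q c where c: "coll i j (thd i j) p q c" using coll_exists[OF i] by blast
    obtain p' where p': "p * p' mod 7 = 1" using inv7_exists[OF c] by blast
    have hp: "h i (y + p * p') = h i (y + 1)" for y
      unfolding per[of i "y + p * p'", symmetric] per[of i "y + 1", symmetric] by (metis mod_add_right_eq p')
    \<comment> \<open>Both instances move the first coordinate by \<open>p * p'\<close>, which is 1
      modulo 7, and the second from 0 to \<open>- p'\<close>; the contribution of the second fibre
      cancels.\<close>
    from dvd_diff[OF step[OF c, of x p' 0] step[OF c, of 0 p' 0]] show ?thesis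
      unfolding hp m_def by (simp add: algebra_simps)
  qed
  have lin_nat: "7 dvd h i (int n) - (h i 0 + int n * m i)" if i: "i \<in> base" for i n
  proof (induction n)
    case (Suc n)
    from dvd_add[OF Suc succ[OF i, of "int n"]] show ?case by (simp add: algebra_simps)
  qed simp
  have line_eqn: "7 dvd h i x - (h i 0 + x * m i)" if i: "i \<in> base" for i x
  proof -
    have n: "int (nat (x mod 7)) = x mod 7" by simp
    have "7 dvd h i x - (h i 0 + (x mod 7) * m i)" using lin_nat[OF i, of "nat (x mod 7)"] unfolding n per .
    moreover have "7 dvd (x mod 7 - x) * m i" by (rule dvd_mult2[OF mod7_dvd])
    ultimately have "7 dvd (h i x - (h i 0 + (x mod 7) * m i)) + (x mod 7 - x) * m i" by (rule dvd_add)
    then show ?thesis by (simp add: algebra_simps)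
  qed
  have slope: "7 dvd m j - m i" if i: "i \<in> base" and ij: "adj i j" for i j
  proof -
    obtain p q c where c: "coll i j (thd i j) p q c" using coll_exists[OF i ij] by blast
    obtain p' where p': "p * p' mod 7 = 1" using inv7_exists[OF c] by blast
    \<comment> \<open>The second coordinate moves by 1 and the first by \<open>- p\<close>, so the
      two increments balance as \<open>p * m j\<close> against \<open>p * m i\<close>.\<close>
    from dvd_diff[OF step[OF c, of 0 "-1" 0] line_eqn[OF i, of "-p"]]
    have "7 dvd p * (m j - m i)" unfolding m_def by (simp add: algebra_simps)
    then show ?thesis using inv7[OF p'] by blast
  qed
  have m0: "7 dvd m i - m 0" if i: "i \<in> base" for i
  proof (rule connected[OF _ _ i])
    show "7 dvd m j - m 0" if "i \<in> base" "adj i j" "7 dvd m i - m 0" for i j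
      using dvd_add[OF slope[OF that(1,2)] that(3)] by simp
  qed simp
  have val: "7 dvd h i x - (m 0 * x + h i 0)" if i: "i \<in> base" for i x
    using dvd_add[OF line_eqn[OF i, of x] dvd_mult[OF m0[OF i], of x]] by (simp add: algebra_simps)
  show thesis
  proof (rule that)
    fix P assume P: "P \<in> Pts"
    then have i: "fst P \<in> base" and x: "snd P \<in> {0..<7}" unfolding Pts_iff by blast+
    have "(fst P, snd P mod 7) = P" using x by (simp add: prod_eq_iff)
    then have h: "h (fst P) (snd P) = snd (a P)" unfolding h_def by (simp only:)
    have "7 dvd (m 0 * snd P + h (fst P) 0) mod 7 - snd (a P)"
      using dvd_diff[OF mod7_dvd[of "m 0 * snd P + h (fst P) 0"] val[OF i, of "snd P"]] unfolding h by simp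
    moreover have "snd (a P) \<in> {0..<7}" using collineation_Pts[OF a P] unfolding Pts_iff by blast
    ultimately have "(m 0 * snd P + h (fst P) 0) mod 7 = snd (a P)" by (intro eq7) simp_all
    then show "a P = (fst P, (m 0 * snd P + h (fst P) 0) mod 7)" using fib[OF P] by (simp add: prod_eq_iff)
  next
    assume one: "7 dvd m 0 - 1"
    show "potential (\<lambda>i. h i 0)"
      unfolding potential_def
    proof (intro allI impI)
      fix i j k p q c assume c: "coll i j k p q c"
      \<comment> \<open>The coordinates c, 0, 0 solve the line equation; with slope 1 their images
        leave just the homogeneous equation for the shifts.\<close>
      have "7 dvd h i c + p * h j 0 + q * h k 0 - c" by (rule line[OF c]) simp
      from dvd_diff[OF dvd_diff[OF this val[OF coll_facts(1)[OF c], of c]] dvd_mult2[OF one, of c]]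
      show "7 dvd h i 0 + p * h j 0 + q * h k 0" by (simp add: algebra_simps)
    qed
  qed
qed

section \<open>Collineations of prime order\<close>

lemma affine_mod7: "(m * (x mod 7) + b) mod 7 = (m * x + b) mod (7::int)"
  by (intro mod_add_cong mod_mult_cong mod_mod_trivial refl)

lemma affine_funpow:
  assumes a: "\<And>i y. i \<in> base \<Longrightarrow> a (i, y mod 7) = (s i, (m * y + g i) mod 7)"
    and s: "\<And>i. i \<in> base \<Longrightarrow> s i \<in> base" and i: "i \<in> base"
  shows "(s ^^ n) i \<in> base \<and> (\<exists>t. \<forall>y. (a ^^ n) (i, y mod 7) = ((s ^^ n) i, (m ^ n * y + t) mod (7::int)))"
proof (induction n)
  case 0
  show ?case using i by (auto intro: exI[of _ 0])
next
  case (Suc n)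
  then obtain t where t: "(s ^^ n) i \<in> base" "\<And>y. (a ^^ n) (i, y mod 7) = ((s ^^ n) i, (m ^ n * y + t) mod 7)" by blast
  have "(a ^^ Suc n) (i, y mod 7) = ((s ^^ Suc n) i, (m ^ Suc n * y + (m * t + g ((s ^^ n) i))) mod 7)" for y
    by (simp add: t(2) a[OF t(1)] algebra_simps)
  then show ?case using s[OF t(1)] by auto
qed

text \<open>The seventh power has slope \<open>m ^ 7\<close>, which must be 1 modulo 7; by Fermat it
  is congruent to \<open>m\<close>.\<close>

lemma affine_order_seven:
  assumes a: "\<And>i y. i \<in> base \<Longrightarrow> a (i, y mod 7) = (s i, (m * y + g i) mod 7)"
    and s: "\<And>i. i \<in> base \<Longrightarrow> s i \<in> base" and i: "i \<in> base"
    and id: "\<And>P. P \<in> Pts \<Longrightarrow> (a ^^ 7) P = P"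
  shows "7 dvd m - 1"
proof -
  obtain t where t: "\<And>y. (a ^^ 7) (i, y mod 7) = ((s ^^ 7) i, (m ^ 7 * y + t) mod 7)"
    using affine_funpow[OF a s i, of 7] by blast
  have *: "(m ^ 7 * y + t) mod 7 = y mod 7" for y
    using t[of y] id[OF Pts_pair[OF i, of y]] by simp
  have "7 dvd (m ^ 7 * 1 + t) - 1" "7 dvd (m ^ 7 * 0 + t) - 0" using *[of 1] *[of 0] by (simp_all only: mod_eq_dvd_iff)
  from dvd_diff[OF this] have "7 dvd m ^ 7 - 1" by simp
  then have mul7: "m ^ 7 mod 7 = 1 mod 7" by (simp only: mod_eq_dvd_iff)
  have "m mod 7 \<in> {0..6}" using pos_mod_bound[of 7 m] pos_mod_sign[of 7 m] by simp
  then have "m mod 7 \<in> {0, 1, 2, 3, 4, 5, 6}" by auto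
  then have "(m mod 7) ^ 7 mod 7 = m mod 7" by auto
  then have "m ^ 7 mod 7 = m mod 7" by (simp only: power_mod)
  then have "m mod 7 = 1 mod 7" using mul7 by (simp only:)
  then show ?thesis by (simp only: mod_eq_dvd_iff)
qed

lemma translation_funpow:
  assumes a: "\<And>i y. i \<in> base \<Longrightarrow> a (i, y mod 7) = (s i, (y + g i) mod (7::int))"
    and s: "\<And>i. i \<in> base \<Longrightarrow> s i \<in> base" and i: "i \<in> base"
  shows "(s ^^ n) i \<in> base \<and> (a ^^ n) (i, y mod 7) = ((s ^^ n) i, (y + (\<Sum>r<n. g ((s ^^ r) i))) mod 7)"
proof (induction n)
  case (Suc n)
  then show ?case using s a[of "(s ^^ n) i"] by (simp add: add.assoc)
qed (use i in simp)

text \<open>Order 7 forces slope 1, so the shifts form a potential. Over a base line on which it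
  vanishes, the points with coordinate 0 over \<open>i\<close> and \<open>j\<close> are fixed, and
  with them the line that joins them.\<close>

lemma translation_fixes_line:
  assumes a: "geo.collineation a" and fib: "\<And>P. P \<in> Pts \<Longrightarrow> fst (a P) = fst P"
    and id: "\<And>P. P \<in> Pts \<Longrightarrow> (a ^^ 7) P = P"
  shows "\<exists>l\<in>geo.Lines. a ` l = l"
proof -
  obtain m f where af: "\<And>P. P \<in> Pts \<Longrightarrow> a P = (fst P, (m * snd P + f (fst P)) mod 7)"
      and pot: "7 dvd m - 1 \<Longrightarrow> potential f"
    using affine_on_fibres[OF a fib] by blast
  have aff: "a (i, y mod 7) = (id i, (m * y + f i) mod 7)" if "i \<in> base" for i y
    using af[OF Pts_pair[OF that]] by (simp add: affine_mod7)
  have "7 dvd m - 1" by (rule affine_order_seven[OF aff _ _ id, of 0]) simp_all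
  then obtain i j where ij: "i \<in> base" "adj i j" "7 dvd f i" "7 dvd f j"
    using potential_vanishes_on_line[OF pot] by blast
  have j: "j \<in> base" by (rule adj_props(1)[OF ij(1,2)])
  let ?P = "(i, 0) :: point" and ?Q = "(j, 0) :: point"
  have PQ: "?P \<in> Pts" "?Q \<in> Pts" using Pts_pair[OF ij(1), of 0] Pts_pair[OF j, of 0] by simp_all
  have fx: "a ?P = ?P" "a ?Q = ?Q" unfolding af[OF PQ(1)] af[OF PQ(2)] using ij(3,4) by simp_all
  have "adj (fst ?P) (fst ?Q)" using ij(2) by (simp only: fst_conv)
  then obtain R where R: "tri ?P ?Q R" using tri_exists[OF PQ] by blast
  have t: "tri ?P ?Q (a R)" using collineation_tri[OF a R] unfolding fx .
  have "a R = R" by (rule geo.tri_det[OF t R])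
  then have "a ` {?P, ?Q, R} = {?P, ?Q, R}" by (simp only: image_insert image_empty fx)
  moreover have "{?P, ?Q, R} \<in> geo.Lines" using R unfolding geo.Lines_def by blast
  ultimately show ?thesis by blast
qed

section \<open>Lifts of the elements of order 7\<close>

lemma inv_into_Pts: "geo.collineation a \<Longrightarrow> P \<in> Pts \<Longrightarrow> inv_into Pts a (a P) = P \<and> a (inv_into Pts a P) = P"
  unfolding geo.collineation_def using bij_betw_inv_into_left bij_betw_inv_into_right by metis

lemma proj_inv:
  assumes a: "geo.collineation a"
  shows "proj (inv_into Pts a) = inv (proj a)"
proof -
  have "proj (inv_into Pts a \<circ> a) = id" by (rule proj_trivial) (simp add: inv_into_Pts[OF a])
  then have "proj (inv_into Pts a) \<circ> proj a = id" unfolding proj_comp[OF geo.collineation_inv[OF a] a] .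
  then have "inv (proj a) = (proj (inv_into Pts a) \<circ> proj a) \<circ> inv (proj a)" by simp
  also have "\<dots> = proj (inv_into Pts a)" unfolding comp_assoc auts.comp_inv[OF proj_auts[OF a]] by simp
  finally show ?thesis by simp
qed

text \<open>The image of the collineation group in \<open>auts\<close>. The Sylow argument for 7 is
  carried out inside it because the conjugating element must itself lift to the cover.\<close>

definition liftable :: "(int \<Rightarrow> int) set" where "liftable = proj ` {a. geo.collineation a}"

lemma liftableI: "geo.collineation a \<Longrightarrow> proj a \<in> liftable"
  unfolding liftable_def by blast

interpretation liftable: perm_group base liftable
proof
  have sub: "liftable \<subseteq> auts" using proj_auts unfolding liftable_def by blast
  show "finite liftable" by (rule finite_subset[OF sub auts.finG])
  show "g permutes base" if "g \<in> liftable" for g using that sub auts_permutes by blast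
  show "id \<in> liftable"
    using liftableI[OF geo.collineation_id] unfolding proj_trivial[of id, OF id_apply] .
  show "g \<circ> h \<in> liftable" if gh: "g \<in> liftable" "h \<in> liftable" for g h
  proof -
    obtain a b where "geo.collineation a" "g = proj a" "geo.collineation b" "h = proj b"
      using gh unfolding liftable_def by blast
    then show ?thesis using liftableI[OF geo.collineation_comp[of a b]] by (simp only: proj_comp)
  qed
  show "inv g \<in> liftable" if g: "g \<in> liftable" for g
  proof -
    obtain a where "geo.collineation a" "g = proj a" using g unfolding liftable_def by blast
    then show ?thesis using liftableI[OF geo.collineation_inv[of a]] by (simp only: proj_inv)
  qed
qed

lemma gperm_a_7: "gperm Ga ^^ 7 = id"
proof
  fix i
  show "(gperm Ga ^^ 7) i = id i"
  proof (cases "i \<in> base")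
    case True
    have "gperm Ga ^^ 7 = wperm [Ga,Ga,Ga,Ga,Ga,Ga,Ga]" by (simp add: eval_nat_numeral)
    then show ?thesis
      using order_a[unfolded all_pts, THEN bspec, OF True] by (simp only: wperm_actw[OF True] id_apply)
  next
    case False
    have "gperm Ga i = i" using False by (simp only: gperm_def if_False)
    then have "(gperm Ga ^^ n) i = i" for n by (induction n) simp_all
    then show ?thesis by simp
  qed
qed

lemma gperm_a_funpow: "(gperm Ga ^^ n) 0 = int (n mod 7)"
proof -
  have s: "gperm Ga 0 = 1" "gperm Ga 1 = 2" "gperm Ga 2 = 3" "gperm Ga 3 = 4" "gperm Ga 4 = 5" "gperm Ga 5 = 6" "gperm Ga 6 = 0"
    by (simp_all add: gperm_def a_small)
  show ?thesis
  proof (induction n)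
    case (Suc n)
    have "n mod 7 < 7" by simp
    then consider "n mod 7 = 0" | "n mod 7 = 1" | "n mod 7 = 2" | "n mod 7 = 3" | "n mod 7 = 4" | "n mod 7 = 5" | "n mod 7 = 6"
      by linarith
    then show ?case by cases (use Suc in \<open>simp_all add: s mod_Suc\<close>)
  qed simp
qed

lemma gperm_a_mod: "gperm Ga ^^ (n mod 7) = gperm Ga ^^ n"
proof
  fix i show "(gperm Ga ^^ (n mod 7)) i = (gperm Ga ^^ n) i" by (rule funpow_mod_eq) (simp add: gperm_a_7)
qed

definition a_powers :: "(int \<Rightarrow> int) set" where "a_powers = (\<lambda>n. gperm Ga ^^ n) ` {..<7}"

lemma a_powers_mem: "gperm Ga ^^ n \<in> a_powers"
  unfolding a_powers_def gperm_a_mod[of n, symmetric] by (rule imageI) simp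

lemma a_powers:
  "perm_group base a_powers" "a_powers \<subseteq> liftable" "card a_powers = 7"
proof -
  obtain la be where r: "line_rescaling (act Ga) la be" using gen_rescaling[of Ga] by blast
  have "proj (lift (gperm Ga) la be) = gperm Ga"
    by (rule proj_eqI) (simp_all add: auts_permutes[OF gperm_auts] lift_def)
  then have "gperm Ga \<in> liftable"
    using liftableI[OF lift_collineation[OF gperm_auts gperm_rescaling[OF r]]] by simp
  then show sub: "a_powers \<subseteq> liftable" unfolding a_powers_def using liftable.funpow_mem by blast
  have "inj_on (\<lambda>n. gperm Ga ^^ n) {..<7}"
  proof (rule inj_onI)
    fix m n :: nat assume mn: "m \<in> {..<7}" "n \<in> {..<7}" "gperm Ga ^^ m = gperm Ga ^^ n"
    then have "int (m mod 7) = int (n mod 7)" using gperm_a_funpow by metis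
    then show "m = n" using mn by simp
  qed
  then show "card a_powers = 7" unfolding a_powers_def by (simp add: card_image)
  show "perm_group base a_powers"
  proof
    show "finite a_powers" unfolding a_powers_def by simp
    show "g permutes base" if "g \<in> a_powers" for g using that sub liftable.permutes by blast
    show "id \<in> a_powers" using a_powers_mem[of 0] by simp
    show "g \<circ> h \<in> a_powers" if gh: "g \<in> a_powers" "h \<in> a_powers" for g h
    proof -
      obtain m n where mn: "g = gperm Ga ^^ m" "h = gperm Ga ^^ n" using gh unfolding a_powers_def by blast
      show ?thesis unfolding mn funpow_add[symmetric] by (rule a_powers_mem)
    qed
    show "inv g \<in> a_powers" if g: "g \<in> a_powers" for g
    proof -
      obtain n where n: "g = gperm Ga ^^ n" "n < 7" using g unfolding a_powers_def by blast
      have "gperm Ga ^^ (7 - n) \<circ> g = id" unfolding n(1) funpow_add[symmetric] using n(2) gperm_a_7 by simp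
      then have "inv g = gperm Ga ^^ (7 - n) \<circ> (g \<circ> inv g)" by (simp add: comp_assoc[symmetric])
      also have "g \<circ> inv g = id" using g sub liftable.comp_inv by blast
      finally show ?thesis using a_powers_mem by simp
    qed
  qed
qed

text \<open>Expanding each value through the six basis values reduces the sum to the vanishing
  combination of rows in \<open>orbit_sum\<close>.\<close>

lemma potential_orbit_sum:
  assumes f: "potential f"
  shows "7 dvd f 0 + f 1 + f 2 + f 3 + f 4 + f 5 + f 6"
proof -
  let ?F = "[f 0, f 9, f 10, f 11, f 1, f 3]" and ?r = "row co_table"
  let ?A = "rel3 1 1 (?r 0) (?r 1) (?r 2)" and ?B = "rel3 1 1 (?r 3) (?r 4) (?r 5)"
  have len: "length (rel3 1 1 ?A ?B (?r 6)) = 6" unfolding orbit_sum by simp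
  then have l: "length ?F \<le> length ?A" "length ?F \<le> length ?B" unfolding length_rel3[of 1 1 ?A] by simp_all
  have e: "7 dvd f i - dot7 (?r i) ?F" if "i \<in> base" for i by (rule potential_expand[OF f that])
  have A: "7 dvd dot7 ?A ?F - (dot7 (?r 0) ?F + 1 * dot7 (?r 1) ?F + 1 * dot7 (?r 2) ?F)" by (rule dot7_rel3[OF l(1)])
  have B: "7 dvd dot7 ?B ?F - (dot7 (?r 3) ?F + 1 * dot7 (?r 4) ?F + 1 * dot7 (?r 5) ?F)" by (rule dot7_rel3[OF l(2)])
  have C: "7 dvd dot7 [0,0,0,0,0,0] ?F - (dot7 ?A ?F + 1 * dot7 ?B ?F + 1 * dot7 (?r 6) ?F)"
    using dot7_rel3[of ?F 1 1 ?A ?B "?r 6"] len unfolding orbit_sum by simp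
  have z: "dot7 [0,0,0,0,0,0] ?F = 0" by (rule dot7_zero) simp
  have ab: "7 dvd dot7 ?A ?F + dot7 ?B ?F + dot7 (?r 6) ?F"
    using C unfolding z by (simp only: diff_0 dvd_minus_iff mult_1)
  have "7 dvd (f 0 - dot7 (?r 0) ?F) + (f 1 - dot7 (?r 1) ?F) + (f 2 - dot7 (?r 2) ?F) + (f 3 - dot7 (?r 3) ?F) +
      (f 4 - dot7 (?r 4) ?F) + (f 5 - dot7 (?r 5) ?F) + (f 6 - dot7 (?r 6) ?F)"
    by (intro dvd_add e) simp_all
  from dvd_add[OF dvd_diff[OF dvd_diff[OF this A] B] ab] show ?thesis by (simp add: algebra_simps)
qed

text \<open>The extension is not split: a lift of an element of order 7 has order 49.\<close>

lemma no_lift_of_order_seven: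
  assumes a: "geo.collineation a" and pa: "proj a = gperm Ga" and id: "\<And>P. P \<in> Pts \<Longrightarrow> (a ^^ 7) P = P"
  shows False
proof -
  let ?s = "row a_table" and ?sh = "row a_shift_table"
  define b where "b = lift (gperm Ga) (\<lambda>_. 1) ?sh"
  have r: "line_rescaling (act Ga) (\<lambda>_. 1) ?sh"
    by (rule col_ok_rescaling) (simp_all only: act.simps col_ok_a act_base[of _ Ga, unfolded act.simps], simp)
  have b: "geo.collineation b" unfolding b_def by (rule lift_collineation[OF gperm_auts gperm_rescaling[OF r]])
  have pb: "proj b = gperm Ga" unfolding b_def
    by (rule proj_eqI) (simp_all add: auts_permutes[OF gperm_auts] lift_def)
  \<comment> \<open>Dividing \<open>a\<close> by the table lift \<open>b\<close> of the same
    automorphism leaves a collineation that preserves all fibres, and hence acts on them by affine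
    maps.\<close>
  define h where "h = a \<circ> inv_into Pts b"
  have h: "geo.collineation h" unfolding h_def by (rule geo.collineation_comp[OF a geo.collineation_inv[OF b]])
  have "proj h = id" unfolding h_def proj_comp[OF a geo.collineation_inv[OF b]] proj_inv[OF b] pa pb
    by (rule auts.comp_inv[OF gperm_auts])
  then have fib: "fst (h P) = fst P" if "P \<in> Pts" for P using proj_fst[OF h that] by simp
  obtain m f where af: "\<And>P. P \<in> Pts \<Longrightarrow> h P = (fst P, (m * snd P + f (fst P)) mod 7)"
      and pot: "7 dvd m - 1 \<Longrightarrow> potential f"
    using affine_on_fibres[OF h fib] by blast
  have s: "?s i \<in> base" if "i \<in> base" for i using act_base[OF that, of Ga] by (simp only: act.simps)
  have bv: "b (i, y mod 7) = (?s i, (y + ?sh i) mod 7)" if "i \<in> base" for i y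
    using that by (simp add: b_def lift_def gperm_def mod_simps del: atLeastLessThan_iff)
  have aff: "a (i, y mod 7) = (?s i, (m * y + (m * ?sh i + f (?s i))) mod 7)" if i: "i \<in> base" for i y
  proof -
    have "a (i, y mod 7) = h (b (i, y mod 7))" unfolding h_def using inv_into_Pts[OF b Pts_pair[OF i, of y]] by simp
    also have "\<dots> = (?s i, (m * (y + ?sh i) + f (?s i)) mod 7)"
      unfolding bv[OF i] af[OF Pts_pair[OF s[OF i]]] by (simp only: fst_conv snd_conv affine_mod7)
    finally show ?thesis by (simp only: distrib_left add.assoc)
  qed
  have z: "(0::int) \<in> base" by simp
  have m: "7 dvd m - 1" by (rule affine_order_seven[OF aff s z id])
  have tr: "a (i, y mod 7) = (?s i, (y + (?sh i + f (?s i))) mod 7)" if i: "i \<in> base" for i y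
  proof -
    from dvd_mult2[OF m, of "y + ?sh i"]
    have "(m * y + (m * ?sh i + f (?s i))) mod 7 = (y + (?sh i + f (?s i))) mod 7"
      unfolding mod_eq_dvd_iff by (simp add: algebra_simps)
    then show ?thesis using aff[OF i] by simp
  qed
  have tf: "(?s ^^ 7) 0 \<in> base \<and> (a ^^ 7) (0, 0 mod 7) =
      ((?s ^^ 7) 0, (0 + (\<Sum>r<7. ?sh ((?s ^^ r) 0) + f (?s ((?s ^^ r) 0)))) mod 7)"
    by (rule translation_funpow[OF tr s z])
  from conjunct2[OF tf] have "(0 + (\<Sum>r<7. ?sh ((?s ^^ r) 0) + f (?s ((?s ^^ r) 0)))) mod 7 = 0 mod 7"
    unfolding id[OF Pts_pair[OF z]] prod.inject by (elim conjE) (rule sym)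
  \<comment> \<open>The table shifts are 0 at the points 0, ..., 5 and 6 at the point 6, while
    \<open>f\<close> is summed once over the whole cycle. The sum of \<open>f\<close> vanishes
    modulo 7, so the total shift is 6.\<close>
  moreover have "(\<Sum>r<7. ?sh ((?s ^^ r) 0) + f (?s ((?s ^^ r) 0))) = 6 + (f 0 + f 1 + f 2 + f 3 + f 4 + f 5 + f 6)"
    by (simp add: eval_nat_numeral lessThan_Suc a_small)
  ultimately have "(6 + (f 0 + f 1 + f 2 + f 3 + f 4 + f 5 + f 6)) mod 7 = 0 mod 7" by simp
  then have "7 dvd (6 + (f 0 + f 1 + f 2 + f 3 + f 4 + f 5 + f 6)) - 0" by (simp only: mod_eq_dvd_iff)
  from dvd_diff[OF this potential_orbit_sum[OF pot[OF m]]] show False by simp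
qed

lemma order_seven_fixes_line:
  assumes a: "geo.collineation a" and id: "\<And>P. P \<in> Pts \<Longrightarrow> (a ^^ 7) P = P"
  shows "\<exists>l\<in>geo.Lines. a ` l = l"
proof (cases "proj a = id")
  case True
  then show ?thesis using translation_fixes_line[OF a _ id] proj_fst[OF a] by simp
next
  case False
  have s7: "proj a ^^ 7 = id" unfolding proj_funpow[OF a, symmetric] by (rule proj_trivial[OF id])
  have s: "proj a \<in> liftable" using a unfolding liftable_def by blast
  have sub: "liftable \<subseteq> auts" using proj_auts unfolding liftable_def by blast
  let ?c = "card ((\<lambda>g. (\<circ>) g ` a_powers) ` liftable)"
  have cT: "card liftable = card a_powers * ?c" by (rule liftable.card_cosets[OF a_powers(1,2)])
  \<comment> \<open>Since 49 does not divide 12096, \<open>a_powers\<close> is a Sylow subgroup of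
    \<open>liftable\<close>.\<close>
  have nd: "\<not> 7 dvd ?c"
  proof
    assume "7 dvd ?c"
    then have "7 * 7 dvd card liftable" unfolding cT a_powers(3) by (rule mult_dvd_mono[OF dvd_refl])
    moreover have "card liftable dvd card auts" using auts.card_cosets[OF liftable.perm_group_axioms sub] by simp
    ultimately have "7 * 7 dvd (126 * (16 * 6) :: nat)" unfolding card_auts[symmetric] by (rule dvd_trans)
    then show False by simp
  qed
  have p7: "prime (7::nat)" by simp
  obtain g where g: "g \<in> liftable" "inv g \<circ> proj a \<circ> g \<in> a_powers"
    using liftable.conj_into_subgroup[OF a_powers(1,2) p7 cT nd s s7] by blast
  obtain n where n: "inv g \<circ> proj a \<circ> g = gperm Ga ^^ n" "n < 7" using g(2) unfolding a_powers_def by blast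
  obtain b where b: "geo.collineation b" "g = proj b" using g(1) unfolding liftable_def by blast
  have n0: "n \<noteq> 0"
  proof
    assume "n = 0"
    then have "inv g \<circ> proj a \<circ> g = id" using n(1) by simp
    then have "g \<circ> (inv g \<circ> proj a \<circ> g) \<circ> inv g = g \<circ> inv g" by simp
    then have "(g \<circ> inv g) \<circ> proj a \<circ> (g \<circ> inv g) = g \<circ> inv g" by (simp only: comp_assoc)
    then show False using False unfolding liftable.comp_inv[OF g(1)] by simp
  qed
  let ?b = "inv_into Pts b"
  define a1 where "a1 = ?b \<circ> a \<circ> b"
  have bi: "geo.collineation ?b" by (rule geo.collineation_inv[OF b(1)])
  have a1: "geo.collineation a1" unfolding a1_def
    by (rule geo.collineation_comp[OF geo.collineation_comp[OF bi a] b(1)])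
  have pa1: "proj a1 = gperm Ga ^^ n"
    unfolding a1_def proj_comp[OF geo.collineation_comp[OF bi a] b(1)] proj_comp[OF bi a] proj_inv[OF b(1)] b(2)[symmetric] by (rule n(1))
  have a1k: "(a1 ^^ k) P = ?b ((a ^^ k) (b P))" if P: "P \<in> Pts" for k P
  proof (induction k)
    case 0
    show ?case using inv_into_Pts[OF b(1) P] by simp
  next
    case (Suc k)
    have "(a ^^ k) (b P) \<in> Pts" by (rule collineation_Pts[OF geo.collineation_funpow[OF a] collineation_Pts[OF b(1) P]])
    then show ?case using Suc inv_into_Pts[OF b(1)] by (simp add: a1_def)
  qed
  have a17: "(a1 ^^ 7) P = P" if P: "P \<in> Pts" for P
    using a1k[OF P] id[OF collineation_Pts[OF b(1) P]] inv_into_Pts[OF b(1) P] by simp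
  \<comment> \<open>By Fermat \<open>n ^ 5\<close> inverts \<open>n\<close> modulo 7, so some power
    of \<open>a1\<close> projects to \<open>gperm Ga\<close> itself.\<close>
  have "n \<in> {1, 2, 3, 4, 5, 6}" using n0 n(2) by auto
  then have "n * n ^ 5 mod 7 = 1" by auto
  then obtain k where k: "n * k mod 7 = 1" by blast
  have "proj (a1 ^^ k) = gperm Ga ^^ (n * k)" unfolding proj_funpow[OF a1] pa1 by (simp only: funpow_mult mult.commute)
  also have "\<dots> = gperm Ga" using gperm_a_mod[of "n * k"] unfolding k by simp
  finally have p: "proj (a1 ^^ k) = gperm Ga" .
  have "((a1 ^^ k) ^^ 7) P = P" if P: "P \<in> Pts" for P
  proof -
    have "((a1 ^^ 7) ^^ j) P = P" for j by (induction j) (simp_all only: funpow.simps id_apply comp_apply a17[OF P])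
    then show ?thesis by (simp only: funpow_mult mult.commute)
  qed
  then show ?thesis using no_lift_of_order_seven[OF geo.collineation_funpow[OF a1] p] by blast
qed

text \<open>The coordinates over \<open>i\<close> and \<open>j\<close> can be chosen freely and
  determine the line, which leaves 7 * 7 possibilities.\<close>

lemma lines_over_base_line:
  assumes i: "i \<in> base" and ij: "adj i j"
  shows "card {l \<in> geo.Lines. fst ` l = {i, j, thd i j}} = 49"
proof -
  let ?X = "{l \<in> geo.Lines. fst ` l = {i, j, thd i j}}" and ?Z = "{0..<7::int} \<times> {0..<7::int}"
  note ap = adj_props[OF i ij]
  define t where "t x y = (SOME R. tri (i, x) (j, y) R)" for x y
  have t: "tri (i, x) (j, y) (t x y)" if "x \<in> {0..<7}" "y \<in> {0..<7}" for x y
  proof -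
    have P: "(i, x) \<in> Pts" "(j, y) \<in> Pts" using i ap(1) that unfolding Pts_iff by simp_all
    have "adj (fst (i, x)) (fst (j, y))" using ij by simp
    then show ?thesis unfolding t_def by (rule someI_ex[OF tri_exists[OF P]])
  qed
  have ft: "fst (t x y) = thd i j" if "x \<in> {0..<7}" "y \<in> {0..<7}" for x y
    using tri_coll[OF t[OF that]] coll_thd by fastforce
  let ?L = "\<lambda>(x, y). {(i, x), (j, y), t x y}"
  have inj: "inj_on ?L ?Z"
  proof (rule inj_onI)
    fix u v assume "u \<in> ?Z" "v \<in> ?Z" and eq: "?L u = ?L v"
    then obtain x y x' y' where uv: "u = (x, y)" "v = (x', y')" and r: "x \<in> {0..<7}" "y \<in> {0..<7}" "x' \<in> {0..<7}" "y' \<in> {0..<7}"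
      by blast
    have L: "{(i, x), (j, y), t x y} = {(i, x'), (j, y'), t x' y'}" using eq unfolding uv prod.case .
    have f: "fst (t x' y') = thd i j" by (rule ft[OF r(3,4)])
    have "(i, x) \<in> {(i, x'), (j, y'), t x' y'}" "(j, y) \<in> {(i, x'), (j, y'), t x' y'}"
      unfolding L[symmetric] by (rule insertI1, rule insertI2[OF insertI1])
    moreover have "(i, x) \<noteq> t x' y'" using f ap(8) by (metis fst_conv)
    moreover have "(j, y) \<noteq> t x' y'" using f ap(9) by (metis fst_conv)
    ultimately show "u = v" using ap(7) unfolding uv by auto
  qed
  have "?L ` ?Z = ?X"
  proof
    show "?L ` ?Z \<subseteq> ?X"
    proof (rule image_subsetI)
      fix u assume "u \<in> ?Z"
      then obtain x y where u: "u = (x, y)" "x \<in> {0..<7}" "y \<in> {0..<7}" by blast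
      have "{(i, x), (j, y), t x y} \<in> geo.Lines" using t[OF u(2,3)] unfolding geo.Lines_def by blast
      then show "?L u \<in> ?X" unfolding u(1) prod.case using ft[OF u(2,3)] by simp
    qed
    show "?X \<subseteq> ?L ` ?Z"
    proof
      fix l assume "l \<in> ?X"
      then have l: "l \<in> geo.Lines" "fst ` l = {i, j, thd i j}" by blast+
      then have "i \<in> fst ` l" "j \<in> fst ` l" by blast+
      then obtain P Q where P: "P \<in> l" "i = fst P" and Q: "Q \<in> l" "j = fst Q" by blast
      have "P \<noteq> Q" using P Q ap(7) by blast
      then obtain R where R: "tri P Q R" "l = {P, Q, R}" using geo.line_through[OF l(1) P(1) Q(1)] by blast
      have Z: "snd P \<in> {0..<7}" "snd Q \<in> {0..<7}" using geo.Lines_Pt[OF l(1)] P(1) Q(1) Pts_iff by blast+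
      have e: "(i, snd P) = P" "(j, snd Q) = Q" using P(2) Q(2) by simp_all
      have "t (snd P) (snd Q) = R" by (rule geo.tri_det[OF t[OF Z, unfolded e] R(1)])
      then have "l = ?L (snd P, snd Q)" unfolding prod.case R(2) e by simp
      then show "l \<in> ?L ` ?Z" using Z by blast
    qed
  qed
  then have "card ?X = card ?Z" using card_image[OF inj] by simp
  then show ?thesis by (simp add: card_cartesian_product)
qed

lemma image_funpow:
  fixes a :: "'a \<Rightarrow> 'a"
  shows "((`) a ^^ n) l = (a ^^ n) ` l"
proof (induction n)
  case (Suc n)
  then have "((`) a ^^ Suc n) l = a ` (a ^^ n) ` l" by simp
  also have "\<dots> = (a ^^ Suc n) ` l" unfolding funpow.simps by (rule image_comp)
  finally show ?case .
qed simp

text \<open>The 49 lines above an invariant base line are permuted among themselves, and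
  \<open>q\<close> does not divide 49.\<close>

lemma fixes_line_over_base_line:
  assumes a: "geo.collineation a" and q: "prime q" "\<not> q dvd 49" and id: "\<And>P. P \<in> Pts \<Longrightarrow> (a ^^ q) P = P"
    and f: "fixes_base_line (proj a)"
  shows "\<exists>l\<in>geo.Lines. a ` l = l"
proof -
  obtain i j where ij: "i \<in> base" "adj i j" "proj a ` {i, j, thd i j} = {i, j, thd i j}"
    using f unfolding fixes_base_line_def by blast
  let ?X = "{l \<in> geo.Lines. fst ` l = {i, j, thd i j}}"
  have "\<exists>l\<in>?X. a ` l = l"
  proof (rule exists_fixed_point[OF _ q(1)])
    show "finite ?X" using geo.finite_Lines by simp
    show "(`) a ` ?X \<subseteq> ?X"
    proof (rule image_subsetI)
      fix l assume l: "l \<in> ?X"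
      have "fst ` a ` l = proj a ` fst ` l"
        unfolding image_image by (rule image_cong[OF refl], rule proj_fst[OF a]) (use geo.Lines_Pt l in blast)
      then have "fst ` a ` l = {i, j, thd i j}" using l ij(3) by simp
      then show "a ` l \<in> ?X" using geo.collineation_image[OF a] l by simp
    qed
    show "((`) a ^^ q) l = l" if l: "l \<in> ?X" for l
    proof -
      have "(a ^^ q) P = P" if "P \<in> l" for P using id geo.Lines_Pt[of l] l that by blast
      then show ?thesis unfolding image_funpow by simp
    qed
    show "\<not> q dvd card ?X" unfolding lines_over_base_line[OF ij(1,2)] by (rule q(2))
  qed
  then show ?thesis by blast
qed

lemma prime_order_fixes_line:
  assumes a: "geo.collineation a" and q: "prime q" and id: "\<And>P. P \<in> Pts \<Longrightarrow> (a ^^ q) P = P"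
  shows "\<exists>l\<in>geo.Lines. a ` l = l"
proof (cases "q dvd card geo.Lines")
  case True
  then have "q dvd 2 ^ 4 * (3 * 7 ^ 3)" unfolding card_Lines by simp
  then have "q dvd 2 \<or> q dvd 3 \<or> q dvd 7" unfolding prime_dvd_mult_iff[OF q] using prime_dvd_power[OF q] by blast
  moreover have "prime (2::nat)" "prime (3::nat)" "prime (7::nat)" by simp_all
  ultimately have "q = 2 \<or> q = 3 \<or> q = 7" using primes_dvd_imp_eq[OF q] by blast
  moreover have s: "proj a ^^ q = id" unfolding proj_funpow[OF a, symmetric] by (rule proj_trivial[OF id])
  have "fixes_base_line (proj a)" if "q = 2"
    using order_two_fixes_base_line[OF proj_auts[OF a]] s unfolding that .
  moreover have "fixes_base_line (proj a)" if "q = 3"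
    using order_three_fixes_base_line[OF proj_auts[OF a]] s unfolding that .
  moreover have "\<not> 2 dvd (49::nat)" "\<not> 3 dvd (49::nat)" by simp_all
  ultimately show ?thesis
    using fixes_line_over_base_line[OF a q _ id] order_seven_fixes_line[OF a] id by blast
next
  case False
  show ?thesis
  proof (rule exists_fixed_point[OF geo.finite_Lines q _ _ False])
    show "(`) a ` geo.Lines \<subseteq> geo.Lines" using geo.collineation_image[OF a] by blast
    show "((`) a ^^ q) l = l" if l: "l \<in> geo.Lines" for l
    proof -
      have "(a ^^ q) P = P" if "P \<in> l" for P using id geo.Lines_Pt[OF l] that by blast
      then show ?thesis unfolding image_funpow by simp
    qed
  qed
qed

section \<open>The line graph\<close>

lemma collineation_to_pair:
  assumes P: "P \<in> Pts" and Q: "Q \<in> Pts" and PQ: "adj (fst P) (fst Q)"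
  shows "\<exists>a. geo.collineation a \<and> a (0, 0) = P \<and> a (9, 0) = Q"
proof -
  have b: "(0::int) \<in> base" "(9::int) \<in> base" by simp_all
  have i: "fst P \<in> base" "fst Q \<in> base" using P Q unfolding Pts_iff by blast+
  obtain v where v: "list_all (\<lambda>g. g \<noteq> Go) v" "actw v 0 = fst P" using reach_word[OF i(1)] by blast
  have v0: "wperm v 0 = fst P" using wperm_actw[OF b(1)] v(2) by simp
  define j where "j = inv (wperm v) (fst Q)"
  have vj: "wperm v j = fst Q" unfolding j_def by (rule permutes_inverses(1)[OF auts_permutes[OF wperm_auts]])
  have jb: "j \<in> base" using auts_base[OF wperm_auts, of v j] vj i(2) by simp
  have "adj 0 j" using auts_adj_iff[OF wperm_auts b(1) jb, of v] PQ unfolding v0 vj by blast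
  then obtain w where w: "list_all (\<lambda>g. g \<noteq> Go) w" "actw w 0 = 0" "actw w 9 = j" using nbr_word by blast
  have wv: "wperm (v @ w) 0 = fst P" "wperm (v @ w) 9 = fst Q"
    using v0 vj w(2,3) wperm_actw[OF b(1), of w] wperm_actw[OF b(2), of w] by (simp_all add: wperm_append)
  have "list_all (\<lambda>g. g \<noteq> Go) (v @ w)" using v(1) w(1) by simp
  then obtain a where a: "geo.collineation a" "\<And>X. X \<in> Pts \<Longrightarrow> fst (a X) = actw (v @ w) (fst X)" using word_lift by blast
  have fa: "fst (a X) = wperm (v @ w) (fst X)" if "X \<in> Pts" for X
    using a(2)[OF that] wperm_actw[of "fst X"] that unfolding Pts_iff by simp
  obtain P' where P': "P' \<in> Pts" "P = a P'" using collineation_surj[OF a(1) P] by blast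
  obtain Q' where Q': "Q' \<in> Pts" "Q = a Q'" using collineation_surj[OF a(1) Q] by blast
  have f: "fst P' = 0" "fst Q' = 9"
    using fa[OF P'(1)] fa[OF Q'(1)] wv auts_inj[OF wperm_auts, of "v @ w"] unfolding P'(2)[symmetric] Q'(2)[symmetric] by metis+
  \<comment> \<open>The first two of the six free values of a potential are those at 0 and 9; they
    take up the remaining coordinates, and the other four are set to 0.\<close>
  define F where "F = [snd P', snd Q', 0, 0, 0, 0]"
  have t: "geo.collineation (lift id (\<lambda>_. 1) (\<lambda>i. dot7 (row co_table i) F))"
    by (rule lift_translation[OF potential_dot7]) (simp add: F_def)
  have m: "snd P' mod 7 = snd P'" "snd Q' mod 7 = snd Q'" using P'(1) Q'(1) unfolding Pts_iff by simp_all
  have "lift id (\<lambda>_. 1) (\<lambda>i. dot7 (row co_table i) F) (0, 0) = P'" "lift id (\<lambda>_. 1) (\<lambda>i. dot7 (row co_table i) F) (9, 0) = Q'"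
    using f m by (simp_all add: lift_def co_basis F_def add7_def mul7_def mod_simps prod_eq_iff)
  then show ?thesis using geo.collineation_comp[OF a(1) t] P'(2) Q'(2) by (intro exI[of _ "a \<circ> _"]) auto
qed

lemma collineation_to_line:
  assumes "tri (0, 0) (9, 0) R" "l \<in> geo.Lines"
  shows "\<exists>a. geo.collineation a \<and> a ` {(0, 0), (9, 0), R} = l"
proof -
  obtain P Q S where t: "tri P Q S" "l = {P, Q, S}" using assms(2) unfolding geo.Lines_def by blast
  have PQ: "P \<in> Pts" "Q \<in> Pts" using t unfolding tri_def by blast+
  have "adj (fst P) (fst Q)" using adj_iff_tri[OF PQ] t(1) by blast
  then obtain a where a: "geo.collineation a" "a (0, 0) = P" "a (9, 0) = Q" using collineation_to_pair[OF PQ] by blast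
  have "tri P Q (a R)" using collineation_tri[OF a(1) assms(1)] unfolding a(2,3) .
  then have "a R = S" using t(1) by (rule geo.tri_det)
  then show ?thesis using a t(2) by (intro exI[of _ a]) simp
qed

lemma collineations_transitive:
  assumes l: "l \<in> geo.Lines" and m: "m \<in> geo.Lines"
  shows "\<exists>a. geo.collineation a \<and> a ` l = m"
proof -
  have P: "(0, 0) \<in> Pts" "(9, 0) \<in> Pts" unfolding Pts_iff by simp_all
  obtain R where R: "tri (0, 0) (9, 0) R" using tri_exists[OF P] adj_0_9 by auto
  let ?o = "{(0, 0), (9, 0), R}"
  obtain a b where a: "geo.collineation a" "a ` ?o = l" and b: "geo.collineation b" "b ` ?o = m"
    using collineation_to_line[OF R] l m by blast
  have "R \<in> Pts" using R unfolding tri_def by blast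
  then have "inv_into Pts a ` a ` ?o = ?o" using P inv_into_Pts[OF a(1)] by (simp only: image_insert image_empty)
  then have "(b \<circ> inv_into Pts a) ` l = m" using a(2) b(2) by (metis image_comp)
  then show ?thesis using geo.collineation_comp[OF b(1) geo.collineation_inv[OF a(1)]] by blast
qed

section \<open>The graph of intersecting lines\<close>

definition line_graph :: "point set pair_pre_digraph" where
  "line_graph = \<lparr>pverts = geo.Lines, parcs = {(l, m). l \<in> geo.Lines \<and> m \<in> geo.Lines \<and> l \<noteq> m \<and> l \<inter> m \<noteq> {}}\<rparr>"

lemma line_graph_sel [simp]:
  "pverts line_graph = geo.Lines"
  "(l, m) \<in> parcs line_graph \<longleftrightarrow> l \<in> geo.Lines \<and> m \<in> geo.Lines \<and> l \<noteq> m \<and> l \<inter> m \<noteq> {}"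
  unfolding line_graph_def by simp_all

lemma pair_graph_line_graph: "pair_graph line_graph"
  by (rule pair_graphI) (auto simp: geo.finite_Lines)

lemma line_nonempty: "l \<in> geo.Lines \<Longrightarrow> l \<noteq> {}"
  using geo.card_line by fastforce

text \<open>Take a point \<open>P\<close> of \<open>u\<close> off \<open>v\<close>. Of the 56 lines
  through \<open>P\<close> at most three meet \<open>v\<close>; any other one except
  \<open>u\<close> is adjacent to \<open>u\<close> and not to \<open>v\<close>.\<close>

lemma twin_free_line_graph: "twin_free line_graph"
  unfolding twin_free_def
proof (intro ballI impI)
  fix u v assume "u \<in> pverts line_graph" "v \<in> pverts line_graph" and ne: "u \<noteq> v"
  then have u: "u \<in> geo.Lines" and v: "v \<in> geo.Lines" by simp_all
  have "finite v" using geo.Lines_Pt[OF v] geo.finite_Pt finite_subset by blast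
  then have "\<not> u \<subseteq> v" using ne card_subset_eq geo.card_line[OF u] geo.card_line[OF v] by metis
  then obtain P where P: "P \<in> u" "P \<notin> v" by blast
  have Pt: "P \<in> Pts" using geo.Lines_Pt[OF u] P(1) by blast
  let ?B = "insert u {l \<in> geo.star P. l \<inter> v \<noteq> {}}"
  have fin: "finite {l \<in> geo.star P. l \<inter> v \<noteq> {}}" using geo.finite_star by simp
  have "card ?B \<le> Suc (card {l \<in> geo.star P. l \<inter> v \<noteq> {}})" by (rule card_insert_le_m1) simp_all
  also have "\<dots> \<le> 4" using geo.star_other_card[OF v P(2)] by simp
  finally have "card ?B < card (geo.star P)" unfolding card_star[OF Pt] by simp
  then have "\<not> geo.star P \<subseteq> ?B" using card_mono[of ?B "geo.star P"] fin by auto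
  then obtain w where w: "w \<in> geo.star P" "w \<noteq> u" "w \<inter> v = {}" by blast
  have wL: "w \<in> geo.Lines" "P \<in> w" using w(1) unfolding geo.star_def by blast+
  have "w \<noteq> v" using w(3) line_nonempty[OF v] by blast
  moreover have "(u, w) \<in> parcs line_graph" using u wL w(2) P(1) by auto
  moreover have "(v, w) \<notin> parcs line_graph" using w(3) by auto
  ultimately show "\<exists>w\<in>pverts line_graph. w \<noteq> v \<and> (u, w) \<in> parcs line_graph \<and> (v, w) \<notin> parcs line_graph"
    using wL(1) by (intro bexI[of _ w]) simp_all
qed

lemma vertex_transitive_line_graph: "vertex_transitive line_graph"
  unfolding vertex_transitive_def
proof (intro ballI)
  fix l m assume "l \<in> pverts line_graph" "m \<in> pverts line_graph"
  then have lm: "l \<in> geo.Lines" "m \<in> geo.Lines" by simp_all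
  obtain a where a: "geo.collineation a" "a ` l = m" using collineations_transitive[OF lm] by blast
  define p where "p k = (if k \<in> geo.Lines then a ` k else k)" for k
  have bij: "bij_betw ((`) a) geo.Lines geo.Lines" by (rule geo.collineation_Lines[OF a(1)])
  then have "bij_betw p geo.Lines geo.Lines" by (rule bij_betw_cong[THEN iffD1, rotated]) (simp add: p_def)
  then have perm: "p permutes geo.Lines" by (rule bij_imp_permutes) (simp add: p_def)
  have inj: "inj_on a Pts" using a(1) unfolding geo.collineation_def bij_betw_def by blast
  have meet: "a ` u \<inter> a ` v \<noteq> {} \<longleftrightarrow> u \<inter> v \<noteq> {}" if uv: "u \<in> geo.Lines" "v \<in> geo.Lines" for u v
    using inj_on_image_Int[OF inj geo.Lines_Pt[OF uv(1)] geo.Lines_Pt[OF uv(2)]] by (metis image_is_empty)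
  have "automorphism line_graph p"
    unfolding automorphism_def
  proof (intro conjI ballI)
    show "p permutes pverts line_graph" using perm by simp
    fix u v assume "u \<in> pverts line_graph" "v \<in> pverts line_graph"
    then have uv: "u \<in> geo.Lines" "v \<in> geo.Lines" by simp_all
    have "a ` u = a ` v \<longleftrightarrow> u = v" using bij uv unfolding bij_betw_def by (metis inj_onD)
    then show "(p u, p v) \<in> parcs line_graph \<longleftrightarrow> (u, v) \<in> parcs line_graph"
      using uv meet[OF uv] geo.collineation_image[OF a(1)] by (simp add: p_def)
  qed
  then show "\<exists>p. automorphism line_graph p \<and> p l = m" using a(2) lm(1) by (intro exI[of _ p]) (simp add: p_def)
qed

lemma elusive_line_graph: "elusive line_graph"
  unfolding elusive_def
proof (intro allI impI)
  fix p q assume p: "automorphism line_graph p" and q: "prime (q::nat)" and pq: "p ^^ q = id"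
  have perm: "p permutes geo.Lines" using automorphism_permutes[OF p] by simp
  have meet: "p l \<inter> p m \<noteq> {} \<longleftrightarrow> l \<inter> m \<noteq> {}" if lm: "l \<in> geo.Lines" "m \<in> geo.Lines" for l m
  proof (cases "l = m")
    case True
    then show ?thesis using lm line_nonempty permutes_in_image[OF perm] by auto
  next
    case False
    then have "p l \<noteq> p m" using permutes_inj[OF perm] by (metis injD)
    then show ?thesis using automorphism_arc[OF p, of l m] lm False permutes_in_image[OF perm] by simp
  qed
  obtain a where a: "geo.collineation a" "\<And>l. l \<in> geo.Lines \<Longrightarrow> p l = a ` l"
    using geo.line_action_is_collineation[OF permutes_imp_bij[OF perm] meet] by blast
  have pow: "(p ^^ n) l = (a ^^ n) ` l" if l: "l \<in> geo.Lines" for n l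
  proof (induction n)
    case (Suc n)
    have "(a ^^ n) ` l \<in> geo.Lines" using geo.collineation_image[OF geo.collineation_funpow[OF a(1)] l] .
    then show ?case using Suc a(2) by (simp add: image_comp)
  qed simp
  \<comment> \<open>The hypothesis on \<open>p\<close> speaks of lines; a collineation that fixes
    every line fixes every point.\<close>
  have "(a ^^ q) P = P" if "P \<in> Pts" for P
    using geo.collineation_trivial_on_lines[OF geo.collineation_funpow[OF a(1)] _ that] pow[of _ q] pq by simp
  then obtain l where "l \<in> geo.Lines" "a ` l = l" using prime_order_fixes_line[OF a(1) q] by blast
  then show "\<exists>v\<in>pverts line_graph. p v = v" using a(2) by auto
qed

theorem corollary1p6:
  shows "\<exists>\<Gamma> :: nat \<Rightarrow> nat pair_pre_digraph.
    \<forall>k\<ge>1. pair_graph (\<Gamma> k) \<and> card (pverts (\<Gamma> k)) = 16464 ^ k \<and> vertex_transitive (\<Gamma> k) \<and>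
      \<not> (\<exists>p. automorphism (\<Gamma> k) p \<and> semiregular (pverts (\<Gamma> k)) p)"
proof -
  have ne: "pverts line_graph \<noteq> {}" using card_Lines by auto
  have "\<exists>H :: nat pair_pre_digraph. pair_graph H \<and> card (pverts H) = 16464 ^ k \<and> vertex_transitive H \<and>
      \<not> (\<exists>p. automorphism H p \<and> semiregular (pverts H) p)" if k: "k \<ge> 1" for k
  proof -
    obtain n where n: "k = Suc n" using k by (cases k) auto
    obtain H :: "nat pair_pre_digraph" where H: "pair_graph H" "card (pverts H) = 16464 ^ k" "vertex_transitive H" "elusive H"
      using elusive_powers[OF pair_graph_line_graph vertex_transitive_line_graph twin_free_line_graph elusive_line_graph ne, of n]
      unfolding n line_graph_sel card_Lines by blast
    have "finite (pverts H)" using H(2) card.infinite by fastforce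
    then show ?thesis using H elusive_no_semiregular by blast
  qed
  then show ?thesis by metis
qed

end
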